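(* Consider the functional $$H[f_1,\mathbf E_1,\mathbf B_1]=\frac{\alpha^2}{2}v_{\mathrm{th}}^2\int_{\Omega\times\mathbb R^3}\frac{f_1^2}{f_0}\,d\mathbf x\,d\mathbf v+\frac12\int_\Omega|\mathbf E_1|^2\,d\mathbf x+\frac12\int_\Omega|\mathbf B_1|^2\,d\mathbf x$$ and the Poisson bracket $$ \begin{aligned} \{\mathcal F,\mathcal G\} &= \int_\Omega \left[\left(\nabla_{\mathbf x}\times\frac{\delta\mathcal F}{\delta\mathbf E_1}\right)\cdot\frac{\delta\mathcal G}{\delta\mathbf B_1}-\frac{\delta\mathcal F}{\delta\mathbf B_1}\cdot\left(\nabla_{\mathbf x}\times\frac{\delta\mathcal G}{\delta\mathbf E_1}\right)\right]d\mathbf x\\ &\quad+\frac{1}{v_{\mathrm{th}}^2\,\epsilon}\int_{\Omega\times\mathbb R^3}\left[\frac{\delta\mathcal F}{\delta f_1}\,\frac{\delta\mathcal G}{\delta\mathbf E_1}\cdot\mathbf v-\frac{\delta\mathcal F}{\delta\mathbf E_1}\cdot\mathbf v\,\frac{\delta\mathcal G}{\delta f_1}\right]f_0\,d\mathbf x\,d\mathbf v\\ &\quad+\frac12\,\frac{1}{\alpha^2v_{\mathrm{th}}^2}\int_{\Omega\times\mathbb R^3}f_0\left[\mathbf v\cdot\left(\left(\nabla_{\mathbf x}\frac{\delta\mathcal F}{\delta f_1}\right)\frac{\delta\mathcal G}{\delta f_1}-\frac{\delta\mathcal F}{\delta f_1}\nabla_{\mathbf x}\frac{\delta\mathcal G}{\delta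 f_1}\right)\right.\\ &\qquad\qquad\left.+\frac1\epsilon\left(\mathbf E_0+\mathbf v\times\mathbf B_0\right)\cdot\left(\left(\nabla_{\mathbf v}\frac{\delta\mathcal F}{\delta f_1}\right)\frac{\delta\mathcal G}{\delta f_1}-\frac{\delta\mathcal F}{\delta f_1}\nabla_{\mathbf v}\frac{\delta\mathcal G}{\delta f_1}\right)\right]d\mathbf x\,d\mathbf v . \end{aligned} $$ Then $H$ and $\{\cdot,\cdot\}$ form a non-canonical Hamiltonian system whose equations of motion are the dynamical equations of the linearized Vlasov–Maxwell system; that is, requiring $\frac{d}{dt}\mathcal F=\{\mathcal F,H\}$ for all functionals $\mathcal F=\mathcal F[f_1,\mathbf E_1,\mathbf B_1]$ yields (in weak form) $$ \begin{aligned} \partial_tf_1+\mathbf v\cdot\nabla_{\mathbf x}f_1+\frac1\epsilon(\mathbf E_0+\mathbf v\times\mathbf B_0)\cdot\nabla_{\mathbf v}f_1&=\frac{1}{v_{\mathrm{th}}^2\,\epsilon}\,\mathbf E_1\cdot\mathbf v\,f_0,\\ \partial_t\mathbf E_1&=\nabla_{\mathbf x}\times\mathbf B_1-\frac{\alpha^2}{\epsilon}\int_{\mathbb R^3}f_1\,\mathbf v\,d\mathbf v,\\ \partial_t\mathbf B_1&=-\nabla_{\mathbf x}\times\mathbf E_1 . \end{aligned} $$ Moreover, the two Gauss laws $$\nabla_{\mathbf x}\cdot\mathbf E_1=\frac{\alpha^2}{\epsilon}\int_{\mathbb R^3}f_1\,d\mathbf v,\qquad \nabla_{\mathbf x}\cdot\mathbf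 B_1=0$$ are Casimirs of the bracket: for all smooth test functions $\varphi,\psi:\Omega\to\mathbb R$, the functionals $$C_\varphi=\int_\Omega\varphi\left(\nabla_{\mathbf x}\cdot\mathbf E_1-\frac{\alpha^2}{\epsilon}\int_{\mathbb R^3}f_1\,d\mathbf v\right)d\mathbf x,\qquad D_\psi=\int_\Omega\psi\,\nabla_{\mathbf x}\cdot\mathbf B_1\,d\mathbf x$$ satisfy $\{C_\varphi,\mathcal G\}=0=\{D_\psi,\mathcal G\}$ for every functional $\mathcal G$.
   Context: $\Omega\subseteq\mathbb R^3$ is the spatial domain, $\mathbf x\in\Omega$, $\mathbf v\in\mathbb R^3$. The unknowns are a scalar function $f_1(t,\mathbf x,\mathbf v)$ and $\mathbb R^3$-valued fields $\mathbf E_1(t,\mathbf x)$, $\mathbf B_1(t,\mathbf x)$. The constants are $\alpha\neq0$, $\epsilon\neq 0$ (real, its sign being that of the charge of the species) and $v_{\mathrm{th}}>0$. The time-independent background functions are $$f_0(\mathbf x,\mathbf v)=\frac{n_0(\mathbf x)}{(\sqrt{2\pi}\,v_{\mathrm{th}})^3}\exp\left(-\frac{|\mathbf v|^2}{2v_{\mathrm{th}}^2}\right),\qquad \mathbf E_0(\mathbf x)=v_{\mathrm{th}}^2\,\epsilon\,\nabla_{\mathbf x}\ln n_0(\mathbf x),\qquad \mathbf B_0\in\mathbb R^3\ \text{constant},$$ with $n_0>0$ a given smooth density on $\Omega$. They satisfy the equilibrium condition $\mathbf v\cdot\nabla_{\mathbf x}f_0+\frac1\epsilon(\mathbf E_0+\mathbf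 v\times\mathbf B_0)\cdot\nabla_{\mathbf v}f_0=0$. The functional derivatives of $\mathcal F[f_1,\mathbf E_1,\mathbf B_1]$ are defined by $$\frac{d}{ds}\Big|_{s=0}\mathcal F[f_1+s\,\delta f,\mathbf E_1+s\,\delta\mathbf E,\mathbf B_1+s\,\delta\mathbf B]=\int_{\Omega\times\mathbb R^3}\frac{\delta\mathcal F}{\delta f_1}\,\delta f\,d\mathbf x\,d\mathbf v+\int_\Omega\frac{\delta\mathcal F}{\delta\mathbf E_1}\cdot\delta\mathbf E\,d\mathbf x+\int_\Omega\frac{\delta\mathcal F}{\delta\mathbf B_1}\cdot\delta\mathbf B\,d\mathbf x .$$ A Poisson bracket is a bilinear antisymmetric bracket on functionals satisfying the Leibniz rule and the Jacobi identity. A Casimir of a bracket is a functional $C$ with $\{C,\mathcal G\}=0$ for all functionals $\mathcal G$. The setting is the usual formal one for infinite-dimensional Hamiltonian systems: functionals are smooth (with symmetric second derivatives), all functions and functional derivatives are sufficiently regular and of sufficiently controlled growth or decay in $\mathbf v$ for all expressions to be defined, and integrations by parts in $\mathbf x$ and $\mathbf v$ produce no boundary terms. *)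

theory Defs
  imports "HOL-Analysis.Analysis"
begin

type_synonym R3 = "real^3"

text \<open>\<open>C\<^sup>\<infinity>\<close> on an open set: differentiable there, with all directional derivatives again
  \<open>C\<^sup>\<infinity>\<close>.\<close>

coinductive smooth_on :: "'a::euclidean_space set \<Rightarrow> ('a \<Rightarrow> 'b::real_normed_vector) \<Rightarrow> bool" where
  "\<forall>x\<in>S. f differentiable (at x) \<Longrightarrow>
   \<forall>d. smooth_on S (\<lambda>x. frechet_derivative f (at x) d) \<Longrightarrow> smooth_on S f"

definition test_function_on :: "'a::euclidean_space set \<Rightarrow> ('a \<Rightarrow> 'b::real_normed_vector) \<Rightarrow> bool" where
  "test_function_on S f \<longleftrightarrow>
     smooth_on S f \<and> (\<exists>C. compact C \<and> C \<subseteq> S \<and> (\<forall>x. x \<notin> C \<longrightarrow> f x = 0))"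

definition partial :: "3 \<Rightarrow> (R3 \<Rightarrow> real) \<Rightarrow> R3 \<Rightarrow> real" where
  "partial i \<phi> x = frechet_derivative \<phi> (at x) (axis i 1)"

definition grad :: "(R3 \<Rightarrow> real) \<Rightarrow> R3 \<Rightarrow> R3" where
  "grad \<phi> x = (\<chi> i. partial i \<phi> x)"

definition divergence :: "(R3 \<Rightarrow> R3) \<Rightarrow> R3 \<Rightarrow> real" where
  "divergence E x = (\<Sum>i\<in>UNIV. partial i (\<lambda>y. E y $ i) x)"

definition curl :: "(R3 \<Rightarrow> R3) \<Rightarrow> R3 \<Rightarrow> R3" where
  "curl E x = vector
     [partial 2 (\<lambda>y. E y $ 3) x - partial 3 (\<lambda>y. E y $ 2) x,
      partial 3 (\<lambda>y. E y $ 1) x - partial 1 (\<lambda>y. E y $ 3) x,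
      partial 1 (\<lambda>y. E y $ 2) x - partial 2 (\<lambda>y. E y $ 1) x]"

definition grad_x :: "(R3 \<Rightarrow> R3 \<Rightarrow> real) \<Rightarrow> R3 \<Rightarrow> R3 \<Rightarrow> R3" where
  "grad_x a x v = grad (\<lambda>y. a y v) x"

definition grad_v :: "(R3 \<Rightarrow> R3 \<Rightarrow> real) \<Rightarrow> R3 \<Rightarrow> R3 \<Rightarrow> R3" where
  "grad_v a x v = grad (\<lambda>w. a x w) v"

record background =
  Omega :: "R3 set"
  n0 :: "R3 \<Rightarrow> real"
  vth :: real
  eps :: real
  alpha :: real
  B0 :: R3

definition f0 :: "background \<Rightarrow> R3 \<Rightarrow> R3 \<Rightarrow> real" where
  "f0 P x v = n0 P x / (sqrt (2 * pi) * vth P) ^ 3 * exp (- ((norm v)\<^sup>2 / (2 * (vth P)\<^sup>2)))"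

definition E0 :: "background \<Rightarrow> R3 \<Rightarrow> R3" where
  "E0 P x = ((vth P)\<^sup>2 * eps P) *\<^sub>R grad (\<lambda>y. ln (n0 P y)) x"

definition force :: "background \<Rightarrow> R3 \<Rightarrow> R3 \<Rightarrow> R3" where
  "force P x v = E0 P x + cross3 v (B0 P)"

definition space_int :: "background \<Rightarrow> (R3 \<Rightarrow> real) \<Rightarrow> real" where
  "space_int P h = (LINT x:Omega P|lborel. h x)"

definition phase_int :: "background \<Rightarrow> (R3 \<Rightarrow> R3 \<Rightarrow> real) \<Rightarrow> real" where
  "phase_int P h = (LINT z:Omega P \<times> UNIV|lborel. h (fst z) (snd z))"

definition space_integrable :: "background \<Rightarrow> (R3 \<Rightarrow> real) \<Rightarrow> bool" where
  "space_integrable P h \<longleftrightarrow> set_integrable lborel (Omega P) h"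

definition phase_integrable :: "background \<Rightarrow> (R3 \<Rightarrow> R3 \<Rightarrow> real) \<Rightarrow> bool" where
  "phase_integrable P h \<longleftrightarrow> set_integrable lborel (Omega P \<times> UNIV) (\<lambda>z. h (fst z) (snd z))"

text \<open>Classes of sufficiently regular functions of controlled growth. A state
  \<open>(f\<^sub>1, E\<^sub>1, B\<^sub>1)\<close> has \<open>f\<^sub>1 / f\<^sub>0\<close> in \<open>phase_fns\<close>, \<open>E\<^sub>1\<close> in \<open>E_fields\<close> and \<open>B\<^sub>1\<close> in
  \<open>B_fields\<close>; functional derivatives lie in \<open>phase_fns\<close>, \<open>E_fields\<close>, \<open>B_fields\<close>. The weight
  \<open>1 / f\<^sub>0\<close> is forced by \<open>\<delta>H/\<delta>f\<^sub>1 = \<alpha>\<^sup>2 v\<^sub>t\<^sub>h\<^sup>2 f\<^sub>1 / f\<^sub>0\<close>.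

  For example: phase functions that are smooth, vanish unless \<open>x\<close> lies in some compact subset of
  the domain, and have all derivatives of polynomial growth in \<open>v\<close>, locally uniformly in \<open>x\<close>,
  with smooth compactly supported fields and test functions; or the periodic analogue on a box
  with \<open>n\<^sub>0\<close> periodic, where only periodicity replaces compactness of the support.\<close>

record function_classes =
  phase_fns :: "(R3 \<Rightarrow> R3 \<Rightarrow> real) set"
  E_fields :: "(R3 \<Rightarrow> R3) set"
  B_fields :: "(R3 \<Rightarrow> R3) set"
  test_fns :: "(R3 \<Rightarrow> real) set"

text \<open>Functions are total in HOL; only their values on the domain matter.\<close>

definition phase_class :: "background \<Rightarrow> (R3 \<Rightarrow> R3 \<Rightarrow> real) set \<Rightarrow> bool" where
  "phase_class P A \<longleftrightarrow>
     (\<forall>a\<in>A. smooth_on (Omega P \<times> UNIV) (case_prod a)) \<and>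
     (\<forall>a. test_function_on (Omega P \<times> UNIV) (case_prod a) \<longrightarrow> a \<in> A) \<and>
     (\<forall>a\<in>A. \<forall>a'. (\<forall>x\<in>Omega P. \<forall>v. a' x v = a x v) \<longrightarrow> a' \<in> A) \<and>
     (\<forall>a\<in>A. \<forall>a'\<in>A. \<forall>c. (\<lambda>x v. a x v + c * a' x v) \<in> A)"

definition field_class :: "background \<Rightarrow> (R3 \<Rightarrow> R3) set \<Rightarrow> bool" where
  "field_class P V \<longleftrightarrow>
     (\<forall>e\<in>V. smooth_on (Omega P) e) \<and>
     (\<forall>e. test_function_on (Omega P) e \<longrightarrow> e \<in> V) \<and>
     (\<forall>e\<in>V. \<forall>e'. (\<forall>x\<in>Omega P. e' x = e x) \<longrightarrow> e' \<in> V) \<and>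
     (\<forall>e\<in>V. \<forall>e'\<in>V. \<forall>c. (\<lambda>x. e x + c *\<^sub>R e' x) \<in> V)"

definition test_class :: "background \<Rightarrow> (R3 \<Rightarrow> real) set \<Rightarrow> bool" where
  "test_class P T \<longleftrightarrow>
     (\<forall>\<phi>\<in>T. smooth_on (Omega P) \<phi>) \<and> (\<forall>\<phi>. test_function_on (Omega P) \<phi> \<longrightarrow> \<phi> \<in> T)"

definition expressions_defined :: "background \<Rightarrow> function_classes \<Rightarrow> bool" where
  "expressions_defined P K \<longleftrightarrow>
     (\<forall>a\<in>phase_fns K. \<forall>i.
        (\<lambda>x v. v $ i * a x v) \<in> phase_fns K \<and>
        (\<lambda>x v. E0 P x $ i * a x v) \<in> phase_fns K \<and>
        (\<lambda>x v. grad_x a x v $ i) \<in> phase_fns K \<and>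
        (\<lambda>x v. grad_v a x v $ i) \<in> phase_fns K) \<and>
     (\<forall>a\<in>phase_fns K. (\<forall>x\<in>Omega P. integrable lborel (\<lambda>v. f0 P x v * a x v)) \<and>
        (\<forall>x\<in>Omega P. integrable lborel (\<lambda>v. (f0 P x v * a x v) *\<^sub>R v)) \<and>
        (\<lambda>x. LINT v|lborel. (f0 P x v * a x v) *\<^sub>R v) \<in> E_fields K) \<and>
     (\<forall>e\<in>E_fields K. curl e \<in> B_fields K \<and> (\<forall>i. (\<lambda>x v. e x $ i) \<in> phase_fns K)) \<and>
     (\<forall>b\<in>B_fields K. curl b \<in> E_fields K) \<and>
     (\<forall>\<phi>\<in>test_fns K. (\<lambda>x v. \<phi> x) \<in> phase_fns K \<and>
        grad \<phi> \<in> E_fields K \<and> grad \<phi> \<in> B_fields K) \<and>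
     (\<forall>a\<in>phase_fns K. \<forall>a'\<in>phase_fns K. phase_integrable P (\<lambda>x v. f0 P x v * a x v * a' x v)) \<and>
     (\<forall>e\<in>E_fields K. \<forall>e'\<in>E_fields K. space_integrable P (\<lambda>x. e x \<bullet> e' x)) \<and>
     (\<forall>b\<in>B_fields K. \<forall>b'\<in>B_fields K. space_integrable P (\<lambda>x. b x \<bullet> b' x)) \<and>
     (\<forall>\<phi>\<in>test_fns K. \<forall>e\<in>E_fields K \<union> B_fields K. space_integrable P (\<lambda>x. \<phi> x * divergence e x))"

definition no_boundary_terms :: "background \<Rightarrow> function_classes \<Rightarrow> bool" where
  "no_boundary_terms P K \<longleftrightarrow>
     (\<forall>a\<in>phase_fns K. \<forall>a'\<in>phase_fns K. \<forall>i.
        phase_int P (\<lambda>x v. f0 P x v * a x v * grad_x a' x v $ i) =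
          - phase_int P (\<lambda>x v. grad_x (\<lambda>x v. f0 P x v * a x v) x v $ i * a' x v) \<and>
        phase_int P (\<lambda>x v. f0 P x v * a x v * grad_v a' x v $ i) =
          - phase_int P (\<lambda>x v. grad_v (\<lambda>x v. f0 P x v * a x v) x v $ i * a' x v)) \<and>
     (\<forall>e\<in>E_fields K. \<forall>b\<in>B_fields K.
        space_int P (\<lambda>x. curl e x \<bullet> b x) = space_int P (\<lambda>x. e x \<bullet> curl b x)) \<and>
     (\<forall>\<phi>\<in>test_fns K. \<forall>e\<in>E_fields K \<union> B_fields K.
        space_int P (\<lambda>x. \<phi> x * divergence e x) = - space_int P (\<lambda>x. grad \<phi> x \<bullet> e x))"

definition formal_setting :: "background \<Rightarrow> function_classes \<Rightarrow> bool" where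
  "formal_setting P K \<longleftrightarrow>
     phase_class P (phase_fns K) \<and> field_class P (E_fields K) \<and> field_class P (B_fields K) \<and>
     test_class P (test_fns K) \<and> expressions_defined P K \<and> no_boundary_terms P K"

text \<open>Both the states and the triples of functional derivatives have the following type.\<close>

type_synonym fields = "(R3 \<Rightarrow> R3 \<Rightarrow> real) \<times> (R3 \<Rightarrow> R3) \<times> (R3 \<Rightarrow> R3)"

type_synonym functional = "fields \<Rightarrow> real"

definition ratio :: "background \<Rightarrow> fields \<Rightarrow> fields" where
  "ratio P = (\<lambda>(f, E, B). (\<lambda>x v. f x v / f0 P x v, E, B))"

definition gradients :: "function_classes \<Rightarrow> fields set" where
  "gradients K = phase_fns K \<times> E_fields K \<times> B_fields K"

definition states :: "background \<Rightarrow> function_classes \<Rightarrow> fields set" where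
  "states P K = {u. ratio P u \<in> gradients K}"

definition add_scaled :: "fields \<Rightarrow> real \<Rightarrow> fields \<Rightarrow> fields" where
  "add_scaled = (\<lambda>(f, E, B) s (f', E', B').
     (\<lambda>x v. f x v + s * f' x v, \<lambda>x. E x + s *\<^sub>R E' x, \<lambda>x. B x + s *\<^sub>R B' x))"

definition pairing :: "background \<Rightarrow> fields \<Rightarrow> fields \<Rightarrow> real" where
  "pairing P = (\<lambda>(a, e, b) (f, E, B).
     phase_int P (\<lambda>x v. a x v * f x v) + space_int P (\<lambda>x. e x \<bullet> E x) + space_int P (\<lambda>x. b x \<bullet> B x))"

definition has_functional_derivative ::
    "background \<Rightarrow> function_classes \<Rightarrow> functional \<Rightarrow> fields \<Rightarrow> fields \<Rightarrow> bool" where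
  "has_functional_derivative P K F u g \<longleftrightarrow> g \<in> gradients K \<and>
     (\<forall>w\<in>states P K. ((\<lambda>s. F (add_scaled u s w)) has_real_derivative pairing P g w) (at 0))"

definition functional_derivative ::
    "background \<Rightarrow> function_classes \<Rightarrow> functional \<Rightarrow> fields \<Rightarrow> fields" where
  "functional_derivative P K F u = (SOME g. has_functional_derivative P K F u g)"

definition functionals :: "background \<Rightarrow> function_classes \<Rightarrow> functional set" where
  "functionals P K = {F. \<forall>u\<in>states P K. \<exists>g. has_functional_derivative P K F u g}"

text \<open>\<open>vanishing S C r\<close>: as \<open>s \<rightarrow> 0\<close>, the family \<open>r s\<close> and all its iterated directional
  derivatives tend to 0, uniformly on \<open>S\<close> relative to functions from the growth class \<open>C\<close>.\<close>

definition iterated_derivative ::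
    "'a::euclidean_space list \<Rightarrow> ('a \<Rightarrow> 'b::real_normed_vector) \<Rightarrow> 'a \<Rightarrow> 'b" where
  "iterated_derivative ds r = foldr (\<lambda>d g x. frechet_derivative g (at x) d) ds r"

definition vanishing ::
    "'a::euclidean_space set \<Rightarrow> ('a \<Rightarrow> 'b::real_normed_vector) set \<Rightarrow> (real \<Rightarrow> 'a \<Rightarrow> 'b) \<Rightarrow> bool" where
  "vanishing S C r \<longleftrightarrow> (\<forall>ds. \<exists>Ms \<delta>. set Ms \<subseteq> C \<and> (\<delta> \<longlongrightarrow> 0) (at 0) \<and>
     (\<forall>\<^sub>F s in at 0. \<forall>z\<in>S.
        norm (iterated_derivative ds (r s) z) \<le> \<delta> s * (\<Sum>M\<leftarrow>Ms. norm (M z))))"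

text \<open>\<open>g'\<close> is the derivative of the curve \<open>g\<close> at parameter 0.\<close>

definition has_velocity ::
    "background \<Rightarrow> function_classes \<Rightarrow> (real \<Rightarrow> fields) \<Rightarrow> fields \<Rightarrow> bool" where
  "has_velocity P K g g' \<longleftrightarrow>
     vanishing (Omega P \<times> UNIV) (case_prod ` phase_fns K)
       (\<lambda>s (x, v). (fst (g s) x v - fst (g 0) x v) / s - fst g' x v) \<and>
     vanishing (Omega P) (E_fields K)
       (\<lambda>s x. (fst (snd (g s)) x - fst (snd (g 0)) x) /\<^sub>R s - fst (snd g') x) \<and>
     vanishing (Omega P) (B_fields K)
       (\<lambda>s x. (snd (snd (g s)) x - snd (snd (g 0)) x) /\<^sub>R s - snd (snd g') x)"

definition state_curve ::
    "background \<Rightarrow> function_classes \<Rightarrow> (real \<Rightarrow> fields) \<Rightarrow> fields \<Rightarrow> fields \<Rightarrow> bool" where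
  "state_curve P K c u w \<longleftrightarrow>
     c 0 = u \<and> (\<forall>\<^sub>F s in nhds 0. c s \<in> states P K) \<and> w \<in> states P K \<and>
     has_velocity P K (\<lambda>s. ratio P (c s)) (ratio P w)"

text \<open>Smooth functionals: the chain rule holds along differentiable curves of states, for the
  functional and for its functional derivative, and the second derivative is symmetric. Nothing
  beyond second order is required.\<close>

definition smooth_functionals :: "background \<Rightarrow> function_classes \<Rightarrow> functional set" where
  "smooth_functionals P K = {F. \<exists>dF L. \<forall>u\<in>states P K.
     dF u \<in> gradients K \<and>
     (\<forall>w\<in>states P K. L u w \<in> gradients K) \<and>
     (\<forall>w\<in>states P K. \<forall>w'\<in>states P K. pairing P (L u w) w' = pairing P (L u w') w) \<and>
     (\<forall>c w. state_curve P K c u w \<longrightarrow>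
        ((\<lambda>s. F (c s)) has_real_derivative pairing P (dF u) w) (at 0) \<and>
        has_velocity P K (\<lambda>s. dF (c s)) (L u w))}"

definition bracket ::
    "background \<Rightarrow> function_classes \<Rightarrow> functional \<Rightarrow> functional \<Rightarrow> functional" where
  "bracket P K F G u =
     (case (functional_derivative P K F u, functional_derivative P K G u) of
        ((Ff, FE, FB), (Gf, GE, GB)) \<Rightarrow>
          space_int P (\<lambda>x. curl FE x \<bullet> GB x - FB x \<bullet> curl GE x)
        + 1 / ((vth P)\<^sup>2 * eps P) *
            phase_int P (\<lambda>x v. (Ff x v * (GE x \<bullet> v) - (FE x \<bullet> v) * Gf x v) * f0 P x v)
        + 1 / 2 * (1 / ((alpha P)\<^sup>2 * (vth P)\<^sup>2)) *
            phase_int P (\<lambda>x v. f0 P x v *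
              (v \<bullet> (Gf x v *\<^sub>R grad_x Ff x v - Ff x v *\<^sub>R grad_x Gf x v)
               + 1 / eps P * (force P x v \<bullet> (Gf x v *\<^sub>R grad_v Ff x v - Ff x v *\<^sub>R grad_v Gf x v)))))"

definition hamiltonian :: "background \<Rightarrow> functional" where
  "hamiltonian P = (\<lambda>(f, E, B).
     (alpha P)\<^sup>2 / 2 * (vth P)\<^sup>2 * phase_int P (\<lambda>x v. (f x v)\<^sup>2 / f0 P x v)
     + 1 / 2 * space_int P (\<lambda>x. (norm (E x))\<^sup>2) + 1 / 2 * space_int P (\<lambda>x. (norm (B x))\<^sup>2))"

text \<open>The algebraic identities are required of all functionals that have functional
  derivatives. The Jacobi identity is required of the smooth ones, whose brackets must again have
  functional derivatives so that nested brackets are defined.\<close>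

definition poisson_bracket ::
    "background \<Rightarrow> function_classes \<Rightarrow> (functional \<Rightarrow> functional \<Rightarrow> functional) \<Rightarrow> bool" where
  "poisson_bracket P K br \<longleftrightarrow>
     (\<forall>F\<in>functionals P K. \<forall>G\<in>functionals P K. \<forall>M\<in>functionals P K. \<forall>c. \<forall>u\<in>states P K.
        (\<lambda>w. F w + c * G w) \<in> functionals P K \<and>
        br (\<lambda>w. F w + c * G w) M u = br F M u + c * br G M u \<and>
        br M (\<lambda>w. F w + c * G w) u = br M F u + c * br M G u \<and>
        br F G u = - br G F u \<and>
        (\<lambda>w. F w * G w) \<in> functionals P K \<and>
        br (\<lambda>w. F w * G w) M u = F u * br G M u + br F M u * G u) \<and>
     smooth_functionals P K \<subseteq> functionals P K \<and>
     (\<forall>F\<in>smooth_functionals P K. \<forall>G\<in>smooth_functionals P K. br F G \<in> functionals P K) \<and>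
     (\<forall>F\<in>smooth_functionals P K. \<forall>G\<in>smooth_functionals P K. \<forall>M\<in>smooth_functionals P K.
        \<forall>u\<in>states P K. br (br F G) M u + br (br G M) F u + br (br M F) G u = 0)"

definition casimir ::
    "background \<Rightarrow> function_classes \<Rightarrow> (functional \<Rightarrow> functional \<Rightarrow> functional) \<Rightarrow> functional \<Rightarrow> bool" where
  "casimir P K br C \<longleftrightarrow> C \<in> smooth_functionals P K \<and>
     (\<forall>G\<in>functionals P K. \<forall>u\<in>states P K. br C G u = 0)"

definition gauss_E :: "background \<Rightarrow> (R3 \<Rightarrow> real) \<Rightarrow> functional" where
  "gauss_E P \<phi> = (\<lambda>(f, E, B). space_int P (\<lambda>x.
     \<phi> x * (divergence E x - (alpha P)\<^sup>2 / eps P * (LINT v|lborel. f x v))))"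

definition gauss_B :: "background \<Rightarrow> (R3 \<Rightarrow> real) \<Rightarrow> functional" where
  "gauss_B P \<psi> = (\<lambda>(f, E, B). space_int P (\<lambda>x. \<psi> x * divergence B x))"

definition trajectory ::
    "background \<Rightarrow> function_classes \<Rightarrow> real set \<Rightarrow> (real \<Rightarrow> fields) \<Rightarrow> bool" where
  "trajectory P K I u \<longleftrightarrow> open I \<and> (\<forall>t\<in>I. \<exists>w. state_curve P K (\<lambda>s. u (t + s)) (u t) w)"

definition hamiltonian_motion ::
    "background \<Rightarrow> function_classes \<Rightarrow> (functional \<Rightarrow> functional \<Rightarrow> functional) \<Rightarrow> functional \<Rightarrow>
     real set \<Rightarrow> (real \<Rightarrow> fields) \<Rightarrow> bool" where
  "hamiltonian_motion P K br H I u \<longleftrightarrow> (\<forall>F\<in>smooth_functionals P K. \<forall>t\<in>I.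
     ((\<lambda>t. F (u t)) has_real_derivative br F H (u t)) (at t))"

definition linearized_VM ::
    "background \<Rightarrow> real set \<Rightarrow> (real \<Rightarrow> R3 \<Rightarrow> R3 \<Rightarrow> real) \<Rightarrow> (real \<Rightarrow> R3 \<Rightarrow> R3) \<Rightarrow> (real \<Rightarrow> R3 \<Rightarrow> R3) \<Rightarrow> bool" where
  "linearized_VM P I f1 E1 B1 \<longleftrightarrow> (\<forall>t\<in>I. \<forall>x\<in>Omega P.
     (\<forall>v. deriv (\<lambda>t. f1 t x v) t + v \<bullet> grad_x (f1 t) x v
            + 1 / eps P * (force P x v \<bullet> grad_v (f1 t) x v)
          = 1 / ((vth P)\<^sup>2 * eps P) * (E1 t x \<bullet> v) * f0 P x v) \<and>
     vector_derivative (\<lambda>t. E1 t x) (at t)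
       = curl (B1 t) x - ((alpha P)\<^sup>2 / eps P) *\<^sub>R (LINT v|lborel. f1 t x v *\<^sub>R v) \<and>
     vector_derivative (\<lambda>t. B1 t x) (at t) = - curl (E1 t) x)"

text \<open>Weak form, the \<open>x\<close>- and \<open>v\<close>-derivatives being moved onto the test functions
  \<open>a\<close>, \<open>e\<close>, \<open>b\<close>; the vector field \<open>(v, (E\<^sub>0 + v \<times> B\<^sub>0) / \<epsilon>)\<close> is divergence free.\<close>

definition weak_linearized_VM ::
    "background \<Rightarrow> function_classes \<Rightarrow> real set \<Rightarrow>
     (real \<Rightarrow> R3 \<Rightarrow> R3 \<Rightarrow> real) \<Rightarrow> (real \<Rightarrow> R3 \<Rightarrow> R3) \<Rightarrow> (real \<Rightarrow> R3 \<Rightarrow> R3) \<Rightarrow> bool" where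
  "weak_linearized_VM P K I f1 E1 B1 \<longleftrightarrow> (\<forall>t\<in>I.
     (\<forall>a\<in>phase_fns K.
        phase_int P (\<lambda>x v. a x v * deriv (\<lambda>t. f1 t x v) t)
          - phase_int P (\<lambda>x v. f1 t x v *
              (v \<bullet> grad_x a x v + 1 / eps P * (force P x v \<bullet> grad_v a x v)))
        = 1 / ((vth P)\<^sup>2 * eps P) * phase_int P (\<lambda>x v. a x v * (E1 t x \<bullet> v) * f0 P x v)) \<and>
     (\<forall>e\<in>E_fields K.
        space_int P (\<lambda>x. e x \<bullet> vector_derivative (\<lambda>t. E1 t x) (at t))
        = space_int P (\<lambda>x. curl e x \<bullet> B1 t x)
          - (alpha P)\<^sup>2 / eps P * space_int P (\<lambda>x. e x \<bullet> (LINT v|lborel. f1 t x v *\<^sub>R v))) \<and>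
     (\<forall>b\<in>B_fields K.
        space_int P (\<lambda>x. b x \<bullet> vector_derivative (\<lambda>t. B1 t x) (at t))
        = - space_int P (\<lambda>x. curl b x \<bullet> E1 t x)))"

end

theory Submission
  imports Defs
begin

text \<open>Dividing the phase space component of a state by \<open>f\<^sub>0\<close> turns the pairing of functional
  derivatives with variations into a symmetric positive definite form \<open>Q\<close> on triples of functional
  derivatives. Because \<open>f\<^sub>0\<close> is an equilibrium and \<open>(v, (E\<^sub>0 + v \<times> B\<^sub>0) / \<epsilon>)\<close> is divergence free, the
  transport operator is skew for \<open>Q\<close>, and so the bracket equals \<open>Q (\<delta>F) (J (\<delta>G))\<close> with a linear
  operator \<open>J\<close> that is skew and does not depend on the state. The functional derivative of \<open>{F, G}\<close>
  at \<open>u\<close> is then \<open>F'' (J \<delta>G) - G'' (J \<delta>F)\<close>, and in the Jacobi sum the symmetric second derivatives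
  cancel in pairs. The equations of motion read \<open>u' = f\<^sub>0 J (\<delta>H)\<close>, with the factor \<open>f\<^sub>0\<close> acting on the
  phase space component only; testing with linear functionals and the definiteness of \<open>Q\<close> give the
  weak and the strong form. The Gauss laws are linear functionals whose functional derivatives lie
  in the kernel of \<open>J\<close>, since \<open>curl grad = 0\<close> and \<open>v f\<^sub>0\<close> has vanishing velocity average.\<close>

subsection \<open>Smooth functions\<close>

text \<open>Two obstacles shape the proof. First, \<open>bracket\<close> inserts functional
  derivatives picked by \<open>SOME\<close>. Two candidates have the same \<open>Q\<close> product
  with every triple in \<open>gradients K\<close>; since \<open>J\<close> maps this set into itself,
  \<open>Q g (J h)\<close> depends on \<open>g\<close> only through such products, and skewness
  settles the other argument. Second, the Jacobi identity needs the derivative of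
  \<open>Br (dF (c s)) (dG (c s))\<close> in \<open>s\<close>, but the function classes carry no
  topology. What \<open>vanishing\<close> supplies is a bound by a null factor times a finite sum of
  members of the class, for the remainder and all its derivatives. Members of the class stay square
  integrable (with weight \<open>f0\<close> on phase space) after multiplication by velocity or
  force, so a product estimate with square integrable majorants makes the error terms of
  \<open>Q\<close> and \<open>Br\<close> tend to 0, and a product rule for both forms follows.
  Variations are states while \<open>J\<close> yields a triple of the type of functional
  derivatives; \<open>ratio\<close> and \<open>weighted\<close> pass between the two. The factor 1/2
  of the bracket disappears in \<open>Br\<close> because its two transport terms are equal by
  skewness.\<close>

lemma smooth_on_differentiable: "smooth_on S f \<Longrightarrow> x \<in> S \<Longrightarrow> f differentiable (at x)"
  by (erule smooth_on.cases) auto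

lemma smooth_on_derivative:
  "smooth_on S f \<Longrightarrow> smooth_on S (\<lambda>x. frechet_derivative f (at x) d)"
  by (erule smooth_on.cases) auto

text \<open>The zero function is its own derivative in every direction, so the coinduction closes
  after one step.\<close>

lemma smooth_on_zero: "smooth_on S (\<lambda>_. 0)"
proof -
  define f :: "'a \<Rightarrow> 'b" where "f = (\<lambda>_. 0)"
  then have "smooth_on S f"
    by (coinduction arbitrary: f) (auto simp: frechet_derivative_const)
  then show ?thesis by (simp add: f_def)
qed

lemma smooth_on_continuous: "smooth_on S f \<Longrightarrow> continuous_on S f"
  by (auto intro!: continuous_at_imp_continuous_on differentiable_imp_continuous_within
      simp: smooth_on_differentiable)

lemma smooth_on_iterated_derivative:
  "smooth_on S f \<Longrightarrow> smooth_on S (iterated_derivative ds f)"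
  by (induction ds) (auto simp: iterated_derivative_def smooth_on_derivative)

lemma iterated_derivative_zero: "iterated_derivative ds (\<lambda>_. 0) = (\<lambda>_. 0)"
  by (induction ds) (auto simp: iterated_derivative_def frechet_derivative_const)

text \<open>Functions are total and prescribed only over the domain; openness makes their values
  elsewhere irrelevant for derivatives.\<close>

lemma frechet_derivative_cong_open:
  assumes "open S" "x \<in> S" "\<And>y. y \<in> S \<Longrightarrow> f y = g y" "g differentiable (at x)"
  shows "frechet_derivative f (at x) = frechet_derivative g (at x)"
proof -
  have "(g has_derivative frechet_derivative g (at x)) (at x)"
    using assms(4) frechet_derivative_works by blast
  then have "(f has_derivative frechet_derivative g (at x)) (at x)"
    using has_derivative_transform_within_open assms(1-3) by (metis (no_types, lifting))
  then show ?thesis by (rule frechet_derivative_at[symmetric])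
qed

lemma iterated_derivative_scale:
  fixes f :: "'a::euclidean_space \<Rightarrow> 'b::real_normed_vector"
  assumes S: "open S" and f: "smooth_on S f"
  shows "z \<in> S \<Longrightarrow> iterated_derivative ds (\<lambda>x. c *\<^sub>R f x) z = c *\<^sub>R iterated_derivative ds f z"
\<comment> \<open>The point must vary: one more derivative at \<open>z\<close> needs the scaling
  identity on a neighbourhood of \<open>z\<close>.\<close>
proof (induction ds arbitrary: z)
  case Nil
  then show ?case by (simp add: iterated_derivative_def)
next
  case (Cons d ds)
  let ?g = "iterated_derivative ds f"
  have g: "?g differentiable (at z)"
    using smooth_on_differentiable[OF smooth_on_iterated_derivative[OF f] Cons.prems] .
  have "frechet_derivative (iterated_derivative ds (\<lambda>x. c *\<^sub>R f x)) (at z)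
      = frechet_derivative (\<lambda>x. c *\<^sub>R ?g x) (at z)"
    using Cons.IH g by (intro frechet_derivative_cong_open[OF S Cons.prems]) auto
  also have "\<dots> = (\<lambda>d. c *\<^sub>R frechet_derivative ?g (at z) d)"
    using has_derivative_scaleR_right[OF g[unfolded frechet_derivative_works], of c]
    by (rule frechet_derivative_at[symmetric])
  finally show ?case by (simp add: iterated_derivative_def)
qed

lemma line_derivative:
  fixes f :: "'a::real_normed_vector \<Rightarrow> real"
  assumes "f differentiable (at (z + s *\<^sub>R u))"
  shows "((\<lambda>s. f (z + s *\<^sub>R u)) has_real_derivative
          frechet_derivative f (at (z + s *\<^sub>R u)) u) (at s)"
proof -
  let ?D = "frechet_derivative f (at (z + s *\<^sub>R u))"
  have D: "(f has_derivative ?D) (at (z + s *\<^sub>R u))"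
    using assms frechet_derivative_works by blast
  have "((\<lambda>s. z + s *\<^sub>R u) has_derivative (\<lambda>h. h *\<^sub>R u)) (at s)"
    by (auto intro!: derivative_eq_intros)
  from has_derivative_compose[OF this D]
  have "((\<lambda>s. f (z + s *\<^sub>R u)) has_derivative (\<lambda>h. ?D (h *\<^sub>R u))) (at s)" .
  moreover have "?D (h *\<^sub>R u) = h * ?D u" for h
    using linear_cmul[OF has_derivative_linear[OF D]] by simp
  ultimately show ?thesis
    by (simp add: has_field_derivative_def mult_commute_abs)
qed

text \<open>Two applications of the mean value theorem, first along \<open>u\<close> to the
  increment in direction \<open>w\<close>, then along \<open>w\<close> to the derivative in
  direction \<open>u\<close>.\<close>

lemma second_difference_mean_value:
  fixes f :: "'a::euclidean_space \<Rightarrow> real"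
  assumes f: "smooth_on S f" and S: "ball x \<delta> \<subseteq> S" and t: "t > 0" "t * (norm u + norm w) < \<delta>"
  obtains y where "y \<in> ball x \<delta>"
    and "f (x + t *\<^sub>R u + t *\<^sub>R w) - f (x + t *\<^sub>R u) - f (x + t *\<^sub>R w) + f x
       = t * t * frechet_derivative (\<lambda>z. frechet_derivative f (at z) u) (at y) w"
proof -
  have mem: "x + a *\<^sub>R u + b *\<^sub>R w \<in> ball x \<delta>" if "0 \<le> a" "a \<le> t" "0 \<le> b" "b \<le> t" for a b
  proof -
    have "norm (a *\<^sub>R u + b *\<^sub>R w) \<le> a * norm u + b * norm w"
      using norm_triangle_ineq[of "a *\<^sub>R u" "b *\<^sub>R w"] that by simp
    also have "\<dots> \<le> t * norm u + t * norm w"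
      using that by (intro add_mono mult_right_mono) auto
    finally have "norm (a *\<^sub>R u + b *\<^sub>R w) < \<delta>"
      using t by (simp add: algebra_simps)
    then show ?thesis
      using norm_minus_cancel[of "a *\<^sub>R u + b *\<^sub>R w"] by (simp add: dist_norm del: norm_minus_cancel)
  qed
  let ?Du = "\<lambda>z. frechet_derivative f (at z) u"
  have df: "f differentiable (at z)" "?Du differentiable (at z)" if "z \<in> ball x \<delta>" for z
    using smooth_on_differentiable[OF f] smooth_on_differentiable[OF smooth_on_derivative[OF f]]
      that S by auto
  let ?\<phi> = "\<lambda>s. f ((x + t *\<^sub>R w) + s *\<^sub>R u) - f (x + s *\<^sub>R u)"
  have "\<exists>z>0. z < t \<and> ?\<phi> t - ?\<phi> 0
      = (t - 0) * (?Du ((x + t *\<^sub>R w) + z *\<^sub>R u) - ?Du (x + z *\<^sub>R u))"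
  proof (rule MVT2)
    fix s assume s: "0 \<le> s" "s \<le> t"
    show "(?\<phi> has_real_derivative ?Du ((x + t *\<^sub>R w) + s *\<^sub>R u) - ?Du (x + s *\<^sub>R u)) (at s)"
      using mem[of s t] mem[of s 0] s t
      by (intro DERIV_diff line_derivative df) (auto simp: algebra_simps)
  qed (rule t)
  then obtain \<xi> where \<xi>: "0 < \<xi>" "\<xi> < t"
    "?\<phi> t - ?\<phi> 0 = t * (?Du ((x + t *\<^sub>R w) + \<xi> *\<^sub>R u) - ?Du (x + \<xi> *\<^sub>R u))" by auto
  \<comment> \<open>The increment of \<open>?\<psi>\<close> over \<open>[0, t]\<close> is exactly
    the difference of derivatives left by the first mean value step.\<close>
  let ?\<psi> = "\<lambda>s. ?Du ((x + \<xi> *\<^sub>R u) + s *\<^sub>R w)"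
  have "\<exists>z>0. z < t \<and> ?\<psi> t - ?\<psi> 0
      = (t - 0) * frechet_derivative ?Du (at ((x + \<xi> *\<^sub>R u) + z *\<^sub>R w)) w"
  proof (rule MVT2)
    fix s assume s: "0 \<le> s" "s \<le> t"
    show "(?\<psi> has_real_derivative frechet_derivative ?Du (at ((x + \<xi> *\<^sub>R u) + s *\<^sub>R w)) w) (at s)"
      using mem[of \<xi> s] s \<xi> by (intro line_derivative df) auto
  qed (rule t)
  then obtain \<eta> where \<eta>: "0 < \<eta>" "\<eta> < t"
    "?\<psi> t - ?\<psi> 0 = t * frechet_derivative ?Du (at (x + \<xi> *\<^sub>R u + \<eta> *\<^sub>R w)) w" by auto
  show ?thesis
  proof
    show "x + \<xi> *\<^sub>R u + \<eta> *\<^sub>R w \<in> ball x \<delta>" using mem[of \<xi> \<eta>] \<xi> \<eta> by simp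
    have "?\<psi> t - ?\<psi> 0 = ?Du ((x + t *\<^sub>R w) + \<xi> *\<^sub>R u) - ?Du (x + \<xi> *\<^sub>R u)"
      by (simp add: algebra_simps)
    with \<xi>(3) \<eta>(3) show "f (x + t *\<^sub>R u + t *\<^sub>R w) - f (x + t *\<^sub>R u) - f (x + t *\<^sub>R w) + f x
       = t * t * frechet_derivative ?Du (at (x + \<xi> *\<^sub>R u + \<eta> *\<^sub>R w)) w"
      by (simp add: algebra_simps)
  qed
qed

text \<open>The second difference is symmetric in \<open>u\<close> and \<open>w\<close>. Evaluated
  in both orders it gives equal mixed derivatives at two points near \<open>x\<close>, and these
  derivatives are continuous because they are again differentiable.\<close>

lemma mixed_derivatives_commute:
  fixes f :: "'a::euclidean_space \<Rightarrow> real"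
  assumes f: "smooth_on S f" and S: "open S" and x: "x \<in> S"
  shows "frechet_derivative (\<lambda>z. frechet_derivative f (at z) u) (at x) w
       = frechet_derivative (\<lambda>z. frechet_derivative f (at z) w) (at x) u"
proof -
  define D where "D u w y = frechet_derivative (\<lambda>z. frechet_derivative f (at z) u) (at y) w" for u w y
  have cont: "isCont (D u w) x" for u w
    unfolding D_def
    by (intro differentiable_imp_continuous_within
        smooth_on_differentiable[OF smooth_on_derivative[OF smooth_on_derivative[OF f]] x])
  have "\<bar>D u w x - D w u x\<bar> < e" if "e > 0" for e
  proof -
    obtain d1 where d1: "d1 > 0" "\<And>y. dist y x < d1 \<Longrightarrow> dist (D u w y) (D u w x) < e / 2"
      using cont[of u w] \<open>e > 0\<close> unfolding continuous_at_eps_delta by (meson half_gt_zero)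
    obtain d2 where d2: "d2 > 0" "\<And>y. dist y x < d2 \<Longrightarrow> dist (D w u y) (D w u x) < e / 2"
      using cont[of w u] \<open>e > 0\<close> unfolding continuous_at_eps_delta by (meson half_gt_zero)
    obtain d3 where d3: "d3 > 0" "ball x d3 \<subseteq> S"
      using S x openE by blast
    define \<delta> where "\<delta> = min d1 (min d2 d3)"
    have \<delta>: "\<delta> > 0" "ball x \<delta> \<subseteq> S" using d1 d2 d3 by (auto simp: \<delta>_def)
    \<comment> \<open>Small enough for the whole parallelogram to stay in the ball; the
      \<open>+ 1\<close> keeps the denominator positive even if \<open>u = w = 0\<close>.\<close>
    define t where "t = \<delta> / (2 * (norm u + norm w + 1))"
    have "norm u + norm w + 1 > 0" by (simp add: add_nonneg_pos)
    then have t: "t > 0" using \<delta> by (simp add: t_def)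
    have "t * (norm u + norm w) < t * (2 * (norm u + norm w + 1))"
      using t by (intro mult_strict_left_mono) (auto simp: add_nonneg_pos)
    also have "\<dots> = \<delta>" using \<open>norm u + norm w + 1 > 0\<close> by (simp add: t_def)
    finally have t': "t * (norm u + norm w) < \<delta>" .
    obtain y where y: "y \<in> ball x \<delta>"
      "f (x + t *\<^sub>R u + t *\<^sub>R w) - f (x + t *\<^sub>R u) - f (x + t *\<^sub>R w) + f x = t * t * D u w y"
      using second_difference_mean_value[OF f \<delta>(2) t t'] unfolding D_def by blast
    obtain z where z: "z \<in> ball x \<delta>"
      "f (x + t *\<^sub>R w + t *\<^sub>R u) - f (x + t *\<^sub>R w) - f (x + t *\<^sub>R u) + f x = t * t * D w u z"
      using second_difference_mean_value[OF f \<delta>(2) t, of w u] t'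
      unfolding D_def add.commute[of "norm u"] by blast
    have comm: "x + t *\<^sub>R w + t *\<^sub>R u = x + t *\<^sub>R u + t *\<^sub>R w" by simp
    then have "t * t * D u w y = t * t * D w u z" using y(2) z(2)[unfolded comm] by linarith
    then have "D u w y = D w u z" using t by simp
    moreover have "dist y x < d1" "dist z x < d2"
      using y(1) z(1) dist_commute[of x y] dist_commute[of x z] by (auto simp: \<delta>_def)
    then have "dist (D u w y) (D u w x) < e / 2" "dist (D w u z) (D w u x) < e / 2"
      using d1(2) d2(2) by blast+
    ultimately show ?thesis unfolding dist_real_def by linarith
  qed
  \<comment> \<open>With \<open>e\<close> equal to the discrepancy itself, a positive discrepancy
    would be smaller than itself.\<close>
  from this[of "\<bar>D u w x - D w u x\<bar>"] have "D u w x = D w u x"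
    by linarith
  then show ?thesis by (simp add: D_def)
qed

subsection \<open>Square integrable majorants\<close>

text \<open>The set where \<open>h\<close> is positive is open and, the integral being 0, null; a
  nonempty open set is not null. This yields the definiteness of \<open>Q\<close>.\<close>

lemma continuous_nonneg_integral_zero:
  fixes h :: "'a::euclidean_space \<Rightarrow> real"
  assumes S: "open S" and h: "continuous_on S h" "\<And>z. z \<in> S \<Longrightarrow> h z \<ge> 0"
    and int: "set_integrable lborel S h" "(LINT z:S|lborel. h z) = 0" and z: "z \<in> S"
  shows "h z = 0"
proof (rule ccontr)
  assume "h z \<noteq> 0"
  define U where "U = {y \<in> S. h y > 0}"
  have "z \<in> U" using \<open>h z \<noteq> 0\<close> h(2)[OF z] z by (auto simp: U_def)
  have "open (S \<inter> h -` {0<..})"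
    by (intro continuous_open_preimage h(1) S open_greaterThan)
  then have U: "open U" by (simp add: U_def vimage_def Int_def conj_commute)
  have "AE y in lborel. indicator S y *\<^sub>R h y = 0"
    using int h(2) unfolding set_integrable_def set_lebesgue_integral_def
    by (subst (asm) integral_nonneg_eq_0_iff_AE) (auto simp: indicator_def)
  then have "AE y in lborel. y \<notin> U"
    by eventually_elim (auto simp: U_def)
  then have "U \<in> null_sets lborel"
    using U by (subst (asm) AE_iff_null_sets[symmetric]) auto
  then have "negligible U"
    by (simp add: negligible_iff_null_sets null_sets_completionI)
  then show False
    using open_not_negligible[OF U] \<open>z \<in> U\<close> by blast
qed

text \<open>Membership in a weighted L2 space. The weight is \<open>f0\<close> on phase space and 1
  on the spatial domain.\<close>

definition sq_int :: "'z::euclidean_space set \<Rightarrow> ('z \<Rightarrow> real) \<Rightarrow> ('z \<Rightarrow> real) \<Rightarrow> bool" where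
  "sq_int S w N \<longleftrightarrow> set_integrable lborel S (\<lambda>z. w z * (N z)\<^sup>2)"

lemma sq_int_abs [simp]: "sq_int S w (\<lambda>z. \<bar>N z\<bar>) = sq_int S w N"
  by (simp add: sq_int_def)

lemma sq_int_norm:
  "set_integrable lborel S (\<lambda>z. w z * (h z \<bullet> h z)) \<Longrightarrow> sq_int S w (\<lambda>z. norm (h z))"
  by (simp add: sq_int_def power2_norm_eq_inner)

lemma sq_int_mult:
  assumes w: "\<And>z. z \<in> S \<Longrightarrow> w z \<ge> 0" and MN: "sq_int S w M" "sq_int S w N"
  shows "set_integrable lborel S (\<lambda>z. w z * (\<bar>M z\<bar> * \<bar>N z\<bar>))"
proof -
  let ?m = "\<lambda>z. indicat_real S z * (w z * (M z)\<^sup>2)" and ?n = "\<lambda>z. indicat_real S z * (w z * (N z)\<^sup>2)"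
  let ?f = "\<lambda>z. indicat_real S z * (w z * (\<bar>M z\<bar> * \<bar>N z\<bar>))"
  have int: "integrable lborel ?m" "integrable lborel ?n"
    using MN by (auto simp: sq_int_def set_integrable_def)
  \<comment> \<open>Measurability is available only for the weighted squares; written through their
    square roots, the product becomes measurable, and the arithmetic-geometric mean inequality
    bounds it by their sum.\<close>
  have eq: "?f z = sqrt (?m z) * sqrt (?n z)" for z
    using w[of z] by (auto simp: indicator_def real_sqrt_mult)
  have "integrable lborel (\<lambda>z. sqrt (?m z) * sqrt (?n z))"
  proof (rule Bochner_Integration.integrable_bound)
    show "integrable lborel (\<lambda>z. ?m z + ?n z)" using int by simp
    show "(\<lambda>z. sqrt (?m z) * sqrt (?n z)) \<in> borel_measurable lborel"
      using borel_measurable_integrable[OF int(1)] borel_measurable_integrable[OF int(2)]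
      by measurable
    have "\<bar>sqrt a * sqrt b\<bar> \<le> \<bar>a + b\<bar>" if "a \<ge> 0" "b \<ge> 0" for a b :: real
    proof -
      have "sqrt a * sqrt b \<le> a + b"
        using arith_geo_mean_sqrt[OF that] that by (simp add: real_sqrt_mult)
      then show ?thesis using that by simp
    qed
    then show "AE z in lborel. norm (sqrt (?m z) * sqrt (?n z)) \<le> norm (?m z + ?n z)"
      using w by (intro AE_I2) (auto simp: indicator_def)
  qed
  then show ?thesis by (simp add: set_integrable_def eq[symmetric])
qed

lemma sq_int_add:
  assumes w: "\<And>z. z \<in> S \<Longrightarrow> w z \<ge> 0" and MN: "sq_int S w M" "sq_int S w N"
  shows "sq_int S w (\<lambda>z. \<bar>M z\<bar> + \<bar>N z\<bar>)"
proof -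
  have "set_integrable lborel S (\<lambda>z. w z * (M z)\<^sup>2 + w z * (N z)\<^sup>2 + 2 * (w z * (\<bar>M z\<bar> * \<bar>N z\<bar>)))"
    using MN sq_int_mult[OF w MN] unfolding sq_int_def
    by (intro set_integral_add set_integrable_mult_right) auto
  then show ?thesis
    by (simp add: sq_int_def power2_sum algebra_simps)
qed

lemma sq_int_sum_list:
  assumes w: "\<And>z. z \<in> S \<Longrightarrow> w z \<ge> 0" and "\<And>M. M \<in> set Ms \<Longrightarrow> sq_int S w (m M)"
  shows "sq_int S w (\<lambda>z. \<Sum>M\<leftarrow>Ms. \<bar>m M z\<bar>)"
  using assms(2)
proof (induction Ms)
  case Nil
  then show ?case by (simp add: sq_int_def set_integrable_def)
next
  case (Cons M Ms)
  have eq: "\<bar>\<Sum>M\<leftarrow>Ms. \<bar>m M z\<bar>\<bar> = (\<Sum>M\<leftarrow>Ms. \<bar>m M z\<bar>)" for z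
    by (intro abs_of_nonneg sum_list_nonneg) auto
  have "sq_int S w (\<lambda>z. \<bar>m M z\<bar> + \<bar>\<Sum>M\<leftarrow>Ms. \<bar>m M z\<bar>\<bar>)"
    using Cons by (intro sq_int_add w) auto
  then show ?case unfolding eq by simp
qed

text \<open>In all families the parameter \<open>s\<close> tends to 0.\<close>

definition dominated ::
    "'z::euclidean_space set \<Rightarrow> ('z \<Rightarrow> real) \<Rightarrow> (real \<Rightarrow> real) \<Rightarrow> (real \<Rightarrow> 'z \<Rightarrow> 'b::real_normed_vector) \<Rightarrow> bool" where
  "dominated S w \<delta> r \<longleftrightarrow> (\<exists>N. sq_int S w N \<and> (\<forall>z\<in>S. N z \<ge> 0) \<and>
     (\<forall>\<^sub>F s in at 0. \<forall>z\<in>S. norm (r s z) \<le> \<delta> s * N z))"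

definition small ::
    "'z::euclidean_space set \<Rightarrow> ('z \<Rightarrow> real) \<Rightarrow> (real \<Rightarrow> 'z \<Rightarrow> 'b::real_normed_vector) \<Rightarrow> bool" where
  "small S w r \<longleftrightarrow> (\<exists>\<delta>. (\<delta> \<longlongrightarrow> 0) (at 0) \<and> dominated S w \<delta> r)"

lemma small_imp_dominated:
  assumes "small S w r"
  shows "dominated S w (\<lambda>_. 1) r"
proof -
  obtain \<delta> N where \<delta>: "(\<delta> \<longlongrightarrow> 0) (at 0)" and N: "sq_int S w N" "\<forall>z\<in>S. N z \<ge> 0"
    and ev: "\<forall>\<^sub>F s in at 0. \<forall>z\<in>S. norm (r s z) \<le> \<delta> s * N z"
    using assms unfolding small_def dominated_def by auto
  have "\<forall>\<^sub>F s in at 0. \<delta> s < 1" using \<delta> order_tendstoD(2) by fastforce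
  then have "\<forall>\<^sub>F s in at 0. \<forall>z\<in>S. norm (r s z) \<le> 1 * N z"
    using ev
  proof eventually_elim
    case (elim s)
    show ?case
    proof
      fix z assume z: "z \<in> S"
      have "\<delta> s * N z \<le> 1 * N z" using elim N z by (intro mult_right_mono) auto
      then show "norm (r s z) \<le> 1 * N z" using elim z by force
    qed
  qed
  then show ?thesis unfolding dominated_def using N by blast
qed

lemma dominated_const:
  assumes "set_integrable lborel S (\<lambda>z. w z * (h z \<bullet> h z))"
  shows "dominated S w (\<lambda>_. 1) (\<lambda>_. h)"
  unfolding dominated_def using sq_int_norm[OF assms] by (intro exI[of _ "\<lambda>z. norm (h z)"]) auto

lemma small_mono:
  assumes "small S w r" "\<forall>\<^sub>F s in at 0. \<forall>z\<in>S. norm (q s z) \<le> norm (r s z)"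
  shows "small S w q"
proof -
  obtain \<delta> N where \<delta>: "(\<delta> \<longlongrightarrow> 0) (at 0)" and N: "sq_int S w N" "\<forall>z\<in>S. N z \<ge> 0"
    and ev: "\<forall>\<^sub>F s in at 0. \<forall>z\<in>S. norm (r s z) \<le> \<delta> s * N z"
    using assms(1) unfolding small_def dominated_def by auto
  have "\<forall>\<^sub>F s in at 0. \<forall>z\<in>S. norm (q s z) \<le> \<delta> s * N z"
    using ev assms(2) by eventually_elim force
  then show ?thesis unfolding small_def dominated_def using \<delta> N by blast
qed

lemma small_scale:
  assumes "small S w r"
  shows "small S w (\<lambda>s z. c *\<^sub>R r s z)"
proof -
  obtain \<delta> N where \<delta>: "(\<delta> \<longlongrightarrow> 0) (at 0)" and N: "sq_int S w N" "\<forall>z\<in>S. N z \<ge> 0"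
    and ev: "\<forall>\<^sub>F s in at 0. \<forall>z\<in>S. norm (r s z) \<le> \<delta> s * N z"
    using assms(1) unfolding small_def dominated_def by auto
  have "\<forall>\<^sub>F s in at 0. \<forall>z\<in>S. norm (c *\<^sub>R r s z) \<le> (\<bar>c\<bar> * \<delta> s) * N z"
    using ev by eventually_elim (auto simp: mult.assoc intro!: mult_left_mono)
  moreover have "((\<lambda>s. \<bar>c\<bar> * \<delta> s) \<longlongrightarrow> 0) (at 0)" using tendsto_mult_right_zero[OF \<delta>] .
  ultimately show ?thesis unfolding small_def dominated_def using N by blast
qed

lemma small_add:
  assumes w: "\<And>z. z \<in> S \<Longrightarrow> w z \<ge> 0" and "small S w r" "small S w q"
  shows "small S w (\<lambda>s z. r s z + q s z)"
proof -
  obtain \<delta> N where \<delta>: "(\<delta> \<longlongrightarrow> 0) (at 0)" and N: "sq_int S w N" "\<forall>z\<in>S. N z \<ge> 0"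
    and ev: "\<forall>\<^sub>F s in at 0. \<forall>z\<in>S. norm (r s z) \<le> \<delta> s * N z"
    using assms(2) unfolding small_def dominated_def by auto
  obtain \<delta>' N' where \<delta>': "(\<delta>' \<longlongrightarrow> 0) (at 0)" and N': "sq_int S w N'" "\<forall>z\<in>S. N' z \<ge> 0"
    and ev': "\<forall>\<^sub>F s in at 0. \<forall>z\<in>S. norm (q s z) \<le> \<delta>' s * N' z"
    using assms(3) unfolding small_def dominated_def by auto
  have "\<forall>\<^sub>F s in at 0. \<forall>z\<in>S. norm (r s z + q s z) \<le> (\<bar>\<delta> s\<bar> + \<bar>\<delta>' s\<bar>) * (\<bar>N z\<bar> + \<bar>N' z\<bar>)"
    using ev ev'
  proof eventually_elim
    case (elim s)
    show ?case
    proof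
      fix z assume z: "z \<in> S"
      have "norm (r s z + q s z) \<le> \<delta> s * N z + \<delta>' s * N' z"
        using elim z norm_triangle_mono by blast
      also have "\<dots> \<le> \<bar>\<delta> s\<bar> * \<bar>N z\<bar> + \<bar>\<delta>' s\<bar> * \<bar>N' z\<bar>"
        using N N' z by (intro add_mono mult_mono) auto
      also have "\<dots> \<le> (\<bar>\<delta> s\<bar> + \<bar>\<delta>' s\<bar>) * (\<bar>N z\<bar> + \<bar>N' z\<bar>)"
        by (simp add: algebra_simps)
      finally show "norm (r s z + q s z) \<le> \<dots>" .
    qed
  qed
  moreover have "((\<lambda>s. \<bar>\<delta> s\<bar> + \<bar>\<delta>' s\<bar>) \<longlongrightarrow> 0) (at 0)"
    using tendsto_add[OF tendsto_rabs[OF \<delta>] tendsto_rabs[OF \<delta>']] by simp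
  moreover have "\<forall>z\<in>S. \<bar>N z\<bar> + \<bar>N' z\<bar> \<ge> 0" by simp
  ultimately show ?thesis
    unfolding small_def dominated_def using sq_int_add[OF w N(1) N'(1)] by blast
qed

lemma small_sum:
  assumes w: "\<And>z. z \<in> S \<Longrightarrow> w z \<ge> 0" and "finite I" and "\<And>i. i \<in> I \<Longrightarrow> small S w (r i)"
  shows "small S w (\<lambda>s z. \<Sum>i\<in>I. r i s z)"
  using assms(2,3)
proof (induction I)
  case empty
  have "sq_int S w (\<lambda>_. 0)" by (simp add: sq_int_def set_integrable_def)
  then show ?case
    unfolding small_def dominated_def by (auto intro!: exI[of _ "\<lambda>_. 0"])
next
  case (insert i I)
  then have "small S w (\<lambda>s z. r i s z + (\<Sum>i\<in>I. r i s z))"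
    by (intro small_add w) auto
  with insert.hyps show ?case by simp
qed

text \<open>The integrand is at most \<open>\<bar>\<delta> s\<bar>\<close> times a fixed integrable
  product of two majorants, so the integral is of order \<open>\<delta> s\<close>.\<close>

lemma small_dominated_integral:
  fixes r q :: "real \<Rightarrow> 'z::euclidean_space \<Rightarrow> 'b::euclidean_space"
  assumes w: "\<And>z. z \<in> S \<Longrightarrow> w z \<ge> 0"
    and r: "small S w r" and q: "dominated S w (\<lambda>_. 1) q"
    and int: "\<forall>\<^sub>F s in at 0. set_integrable lborel S (\<lambda>z. w z * (r s z \<bullet> q s z))"
  shows "((\<lambda>s. LINT z:S|lborel. w z * (r s z \<bullet> q s z)) \<longlongrightarrow> 0) (at 0)"
proof -
  obtain \<delta> N where \<delta>: "(\<delta> \<longlongrightarrow> 0) (at 0)" and N: "sq_int S w N" "\<forall>z\<in>S. N z \<ge> 0"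
    and ev: "\<forall>\<^sub>F s in at 0. \<forall>z\<in>S. norm (r s z) \<le> \<delta> s * N z"
    using r unfolding small_def dominated_def by auto
  obtain N' where N': "sq_int S w N'" "\<forall>z\<in>S. N' z \<ge> 0"
    and ev': "\<forall>\<^sub>F s in at 0. \<forall>z\<in>S. norm (q s z) \<le> N' z"
    using q unfolding dominated_def by auto
  define C where "C = (LINT z:S|lborel. w z * (\<bar>N z\<bar> * \<bar>N' z\<bar>))"
  have "\<forall>\<^sub>F s in at 0. norm (LINT z:S|lborel. w z * (r s z \<bullet> q s z)) \<le> \<bar>\<delta> s\<bar> * C"
    using ev ev' int
  proof eventually_elim
    case (elim s)
    have bd: "norm (w z * (r s z \<bullet> q s z)) \<le> \<bar>\<delta> s\<bar> * (w z * (\<bar>N z\<bar> * \<bar>N' z\<bar>))" if z: "z \<in> S" for z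
    proof -
      have "\<bar>r s z \<bullet> q s z\<bar> \<le> norm (r s z) * norm (q s z)" by (rule Cauchy_Schwarz_ineq2)
      also have "\<dots> \<le> (\<bar>\<delta> s\<bar> * \<bar>N z\<bar>) * \<bar>N' z\<bar>"
      proof (intro mult_mono)
        have "norm (r s z) \<le> \<delta> s * N z" using elim z by blast
        also have "\<dots> \<le> \<bar>\<delta> s\<bar> * \<bar>N z\<bar>" using abs_ge_self[of "\<delta> s * N z"] by (simp add: abs_mult)
        finally show "norm (r s z) \<le> \<bar>\<delta> s\<bar> * \<bar>N z\<bar>" .
      qed (use elim z in force)+
      finally have "w z * \<bar>r s z \<bullet> q s z\<bar> \<le> w z * ((\<bar>\<delta> s\<bar> * \<bar>N z\<bar>) * \<bar>N' z\<bar>)"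
        using w[OF z] mult_left_mono by blast
      then show ?thesis using w[OF z] by (simp add: abs_mult mult_ac)
    qed
    have "norm (LINT z:S|lborel. w z * (r s z \<bullet> q s z))
        \<le> (LINT z:S|lborel. \<bar>\<delta> s\<bar> * (w z * (\<bar>N z\<bar> * \<bar>N' z\<bar>)))"
      unfolding set_lebesgue_integral_def
    proof (rule Bochner_Integration.integral_norm_bound_integral)
      show "integrable lborel (\<lambda>z. indicat_real S z *\<^sub>R (w z * (r s z \<bullet> q s z)))"
        using elim(3) unfolding set_integrable_def .
      show "integrable lborel (\<lambda>z. indicat_real S z *\<^sub>R (\<bar>\<delta> s\<bar> * (w z * (\<bar>N z\<bar> * \<bar>N' z\<bar>))))"
        unfolding set_integrable_def[symmetric]
        by (intro set_integrable_mult_right sq_int_mult w N N')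
      show "norm (indicat_real S z *\<^sub>R (w z * (r s z \<bullet> q s z)))
          \<le> indicat_real S z *\<^sub>R (\<bar>\<delta> s\<bar> * (w z * (\<bar>N z\<bar> * \<bar>N' z\<bar>)))" for z
        using bd[of z] by (auto simp: indicator_def)
    qed
    then show ?case by (simp add: C_def)
  qed
  moreover have "((\<lambda>s. \<bar>\<delta> s\<bar> * C) \<longlongrightarrow> 0) (at 0)"
    using tendsto_mult_left_zero[OF tendsto_rabs_zero[OF \<delta>]] .
  ultimately show ?thesis by (rule Lim_null_comparison)
qed

text \<open>The finite sum in \<open>vanishing\<close> becomes the square integrable majorant. The
  multiplier \<open>\<phi>\<close> allows factors such as velocity or force; the map
  \<open>p\<close> allows a field on the domain to be read on phase space.\<close>

lemma vanishing_small:
  fixes r :: "real \<Rightarrow> 'a::euclidean_space \<Rightarrow> 'b::real_normed_vector"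
  assumes w: "\<And>z. z \<in> Z \<Longrightarrow> w z \<ge> 0" and r: "vanishing S C r" and p: "\<And>z. z \<in> Z \<Longrightarrow> p z \<in> S"
    and M: "\<And>M. M \<in> C \<Longrightarrow> sq_int Z w (\<lambda>z. \<phi> z * norm (M (p z)))"
  shows "small Z w (\<lambda>s z. \<phi> z *\<^sub>R iterated_derivative ds (r s) (p z))"
proof -
  obtain Ms \<delta> where Ms: "set Ms \<subseteq> C" and \<delta>: "(\<delta> \<longlongrightarrow> 0) (at 0)"
    and ev: "\<forall>\<^sub>F s in at 0. \<forall>z\<in>S. norm (iterated_derivative ds (r s) z) \<le> \<delta> s * (\<Sum>M\<leftarrow>Ms. norm (M z))"
    using r unfolding vanishing_def by meson
  let ?N = "\<lambda>z. \<Sum>M\<leftarrow>Ms. \<bar>\<phi> z * norm (M (p z))\<bar>"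
  have "sq_int Z w ?N"
    using Ms M by (intro sq_int_sum_list w) auto
  moreover have "\<forall>z\<in>Z. ?N z \<ge> 0" by (auto intro!: sum_list_nonneg)
  moreover have "\<forall>\<^sub>F s in at 0. \<forall>z\<in>Z. norm (\<phi> z *\<^sub>R iterated_derivative ds (r s) (p z)) \<le> \<delta> s * ?N z"
    using ev
  proof eventually_elim
    case (elim s)
    show ?case
    proof
      fix z assume z: "z \<in> Z"
      have "\<bar>\<phi> z\<bar> * norm (iterated_derivative ds (r s) (p z))
          \<le> \<bar>\<phi> z\<bar> * (\<delta> s * (\<Sum>M\<leftarrow>Ms. norm (M (p z))))"
        using elim p[OF z] by (intro mult_left_mono) auto
      also have "\<dots> = \<delta> s * ?N z"
        by (simp add: abs_mult sum_list_const_mult mult_ac)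
      finally show "norm (\<phi> z *\<^sub>R iterated_derivative ds (r s) (p z)) \<le> \<delta> s * ?N z" by simp
    qed
  qed
  ultimately show ?thesis unfolding small_def dominated_def using \<delta> by blast
qed

section \<open>Vector calculus: partial derivatives, curl, and slices of phase space
  functions\<close>

lemma has_derivative_partial:
  "(\<phi> has_derivative D) (at x) \<Longrightarrow> partial i \<phi> x = D (axis i 1)"
  unfolding partial_def by (simp add: frechet_derivative_at[symmetric])

lemma partial_linear:
  assumes "\<phi> differentiable (at x)" "\<psi> differentiable (at x)"
  shows "partial i (\<lambda>y. \<phi> y + c * \<psi> y) x = partial i \<phi> x + c * partial i \<psi> x"
  using assms unfolding partial_def frechet_derivative_works
  by (intro has_derivative_partial[unfolded partial_def] derivative_intros)

lemma partial_product:
  assumes "\<phi> differentiable (at x)" "\<psi> differentiable (at x)"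
  shows "partial i (\<lambda>y. \<phi> y * \<psi> y) x = \<phi> x * partial i \<psi> x + partial i \<phi> x * \<psi> x"
  using assms unfolding partial_def frechet_derivative_works
  by (intro has_derivative_partial[unfolded partial_def] has_derivative_mult)

lemma partial_component:
  assumes "e differentiable (at x)"
  shows "partial i (\<lambda>y. e y $ j) x = frechet_derivative e (at x) (axis i 1) $ j"
  using assms unfolding frechet_derivative_works
  by (intro has_derivative_partial bounded_linear.has_derivative[OF bounded_linear_vec_nth])

text \<open>Expressing curl through the Frechet derivative makes its linearity and its norm bound
  consequences of those of the cross product.\<close>

lemma curl_eq_sum_cross:
  assumes "e differentiable (at x)"
  shows "curl e x = (\<Sum>i\<in>UNIV. cross3 (axis i 1) (frechet_derivative e (at x) (axis i 1)))"
  unfolding curl_def partial_component[OF assms]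
  by (simp add: vec_eq_iff forall_3 sum_3 cross_components axis_def)

lemma curl_linear:
  assumes "e differentiable (at x)" "e' differentiable (at x)"
  shows "curl (\<lambda>y. e y + c *\<^sub>R e' y) x = curl e x + c *\<^sub>R curl e' x"
proof -
  let ?D = "\<lambda>e. frechet_derivative e (at x)"
  have D: "((\<lambda>y. e y + c *\<^sub>R e' y) has_derivative (\<lambda>h. ?D e h + c *\<^sub>R ?D e' h)) (at x)"
    using assms unfolding frechet_derivative_works by (intro derivative_intros)
  then have "(\<lambda>y. e y + c *\<^sub>R e' y) differentiable (at x)" by (rule differentiableI)
  then show ?thesis
    using assms by (simp add: curl_eq_sum_cross frechet_derivative_at[OF D, symmetric]
        cross_add_right cross_mult_right sum.distrib scaleR_right.sum)
qed

lemma curl_zero: "curl (\<lambda>_. 0) x = 0"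
  by (simp add: curl_def vec_eq_iff forall_3 partial_def frechet_derivative_const)

lemma curl_scale:
  assumes "e differentiable (at x)"
  shows "curl (\<lambda>y. c *\<^sub>R e y) x = c *\<^sub>R curl e x"
  using curl_linear[OF differentiable_const assms, of 0 c] by (simp add: curl_zero)

lemma norm_cross_le: "norm (cross3 x y) \<le> norm x * norm y"
proof (rule power2_le_imp_le)
  have "(norm (cross3 x y))\<^sup>2 + (x \<bullet> y)\<^sup>2 = (norm x * norm y)\<^sup>2" by (rule norm_cross_dot)
  then show "(norm (cross3 x y))\<^sup>2 \<le> (norm x * norm y)\<^sup>2"
    using zero_le_power2[of "x \<bullet> y"] by linarith
qed simp

lemma norm_curl_le:
  assumes "e differentiable (at x)"
  shows "norm (curl e x) \<le> (\<Sum>i\<in>UNIV. norm (frechet_derivative e (at x) (axis i 1)))"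
proof -
  have "norm (cross3 (axis i 1) (frechet_derivative e (at x) (axis i 1)))
      \<le> norm (frechet_derivative e (at x) (axis i 1))" for i
    using norm_cross_le[of "axis i 1" "frechet_derivative e (at x) (axis i 1)"] by simp
  then show ?thesis
    unfolding curl_eq_sum_cross[OF assms] by (intro order.trans[OF norm_sum] sum_mono)
qed

text \<open>Each component of the curl is a difference of two mixed second derivatives of
  \<open>\<phi>\<close>.\<close>

lemma curl_grad:
  assumes "open S" "smooth_on S \<phi>" "x \<in> S"
  shows "curl (grad \<phi>) x = 0"
proof -
  have "partial i (\<lambda>y. grad \<phi> y $ j) x = partial j (\<lambda>y. grad \<phi> y $ i) x" for i j
    using mixed_derivatives_commute[OF assms(2,1,3)] by (simp add: grad_def partial_def)
  then show ?thesis by (simp add: curl_def vec_eq_iff forall_3)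
qed

text \<open>Chain rule for the embeddings of a slice. \<open>grad_x\<close> and
  \<open>grad_v\<close> differentiate slices, whereas smoothness and \<open>vanishing\<close>
  concern joint derivatives on phase space.\<close>

lemma
  assumes "case_prod a differentiable (at (x, v))"
  shows x_slice_derivative:
      "((\<lambda>y. a y v) has_derivative (\<lambda>h. frechet_derivative (case_prod a) (at (x, v)) (h, 0))) (at x)"
    and v_slice_derivative:
      "((\<lambda>w. a x w) has_derivative (\<lambda>h. frechet_derivative (case_prod a) (at (x, v)) (0, h))) (at v)"
proof -
  let ?D = "frechet_derivative (case_prod a) (at (x, v))"
  have D: "(case_prod a has_derivative ?D) (at (x, v))"
    using assms frechet_derivative_works by blast
  have "((\<lambda>y. (y, v)) has_derivative (\<lambda>h. (h, 0))) (at x)"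
    "((\<lambda>w. (x, w)) has_derivative (\<lambda>h. (0, h))) (at v)"
    by (auto intro!: derivative_eq_intros)
  then show "((\<lambda>y. a y v) has_derivative (\<lambda>h. ?D (h, 0))) (at x)"
    "((\<lambda>w. a x w) has_derivative (\<lambda>h. ?D (0, h))) (at v)"
    using has_derivative_compose[where f = "\<lambda>y. (y, v)" and g = "case_prod a" and g' = ?D]
      has_derivative_compose[where f = "\<lambda>w. (x, w)" and g = "case_prod a" and g' = ?D] D
    by fastforce+
qed

lemma
  assumes "case_prod a differentiable (at (x, v))"
  shows grad_x_nth: "grad_x a x v $ i = frechet_derivative (case_prod a) (at (x, v)) (axis i 1, 0)"
    and grad_v_nth: "grad_v a x v $ i = frechet_derivative (case_prod a) (at (x, v)) (0, axis i 1)"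
  using has_derivative_partial[OF x_slice_derivative[OF assms]]
    has_derivative_partial[OF v_slice_derivative[OF assms]]
  by (simp_all add: grad_x_def grad_v_def grad_def)

lemma field_class_linear:
  "field_class P V \<Longrightarrow> e \<in> V \<Longrightarrow> e' \<in> V \<Longrightarrow> (\<lambda>x. e x + c *\<^sub>R e' x) \<in> V"
  by (simp add: field_class_def)

lemma field_class_zero: "field_class P V \<Longrightarrow> (\<lambda>_. 0) \<in> V"
  by (simp add: field_class_def test_function_on_def smooth_on_zero exI[of _ "{}"])

lemma field_class_scale: "field_class P V \<Longrightarrow> e \<in> V \<Longrightarrow> (\<lambda>x. c *\<^sub>R e x) \<in> V"
  using field_class_linear[OF _ field_class_zero] by fastforce

text \<open>The magnetic part is linear in velocity, so closure of the phase class under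
  multiplication by velocity components and by \<open>E0\<close> gives closure under multiplication
  by the force.\<close>

lemma force_component:
  "force P x v $ i = E0 P x $ i + (\<Sum>j\<in>UNIV. cross3 (axis j 1) (B0 P) $ i * v $ j)"
proof -
  have "cross3 v (B0 P) $ i = (\<Sum>j\<in>UNIV. cross3 (axis j 1) (B0 P) $ i * v $ j)"
    using exhaust_3[of i] by (auto simp: sum_3 cross_components axis_def)
  then show ?thesis by (simp add: force_def)
qed

definition transport :: "background \<Rightarrow> (R3 \<Rightarrow> R3 \<Rightarrow> real) \<Rightarrow> R3 \<Rightarrow> R3 \<Rightarrow> real" where
  "transport P a x v = v \<bullet> grad_x a x v + 1 / eps P * (force P x v \<bullet> grad_v a x v)"

subsection \<open>The formal setting\<close>

locale vlasov_maxwell =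
  fixes P :: background and K :: function_classes
  assumes open_Omega: "open (Omega P)"
    and smooth_n0: "smooth_on (Omega P) (n0 P)" and n0_pos: "\<And>x. x \<in> Omega P \<Longrightarrow> n0 P x > 0"
    and vth_pos: "vth P > 0" and eps_nonzero: "eps P \<noteq> 0" and alpha_nonzero: "alpha P \<noteq> 0"
    and setting: "formal_setting P K"
begin

abbreviation "A \<equiv> phase_fns K"
abbreviation "Z \<equiv> Omega P \<times> (UNIV :: R3 set)"

text \<open>Both field classes satisfy the same closure and integrability conditions; this predicate
  lets one lemma serve both.\<close>

definition is_field_class :: "(R3 \<Rightarrow> R3) set \<Rightarrow> bool" where
  "is_field_class V \<longleftrightarrow> V = E_fields K \<or> V = B_fields K"

lemma is_field_class [simp, intro]: "is_field_class (E_fields K)" "is_field_class (B_fields K)"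
  by (simp_all add: is_field_class_def)

lemma phase_class_A: "phase_class P A"
  using setting by (simp add: formal_setting_def)

lemma field_class: "is_field_class V \<Longrightarrow> field_class P V"
  using setting by (auto simp: formal_setting_def is_field_class_def)

lemmas field_linear = field_class_linear[OF field_class]
lemmas field_zero = field_class_zero[OF field_class]
lemmas field_scale = field_class_scale[OF field_class]

lemma field_smooth: "is_field_class V \<Longrightarrow> e \<in> V \<Longrightarrow> smooth_on (Omega P) e"
  using field_class by (auto simp: field_class_def)

lemma field_differentiable:
  "is_field_class V \<Longrightarrow> e \<in> V \<Longrightarrow> x \<in> Omega P \<Longrightarrow> e differentiable (at x)"
  using field_smooth smooth_on_differentiable by blast

lemma A_linear: "a \<in> A \<Longrightarrow> a' \<in> A \<Longrightarrow> (\<lambda>x v. a x v + c * a' x v) \<in> A"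
  using phase_class_A by (simp add: phase_class_def)

lemma A_zero: "(\<lambda>x v. 0) \<in> A"
proof -
  have eq: "case_prod (\<lambda>x v. 0) = (\<lambda>_. 0 :: real)" by auto
  have "test_function_on Z (case_prod (\<lambda>x v. 0 :: real))"
    unfolding eq by (auto simp: test_function_on_def smooth_on_zero intro: exI[of _ "{}"])
  then show ?thesis using phase_class_A unfolding phase_class_def by blast
qed

lemma A_scale: "a \<in> A \<Longrightarrow> (\<lambda>x v. c * a x v) \<in> A"
  using A_linear[OF A_zero] by fastforce

lemma A_add: "a \<in> A \<Longrightarrow> a' \<in> A \<Longrightarrow> (\<lambda>x v. a x v + a' x v) \<in> A"
  using A_linear[of a a' 1] by simp

lemma A_sum: "finite I \<Longrightarrow> (\<And>i. i \<in> I \<Longrightarrow> a i \<in> A) \<Longrightarrow> (\<lambda>x v. \<Sum>i\<in>I. a i x v) \<in> A"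
  by (induction I rule: finite_induct) (auto intro: A_zero A_add)

lemma A_cong: "a \<in> A \<Longrightarrow> (\<And>x v. x \<in> Omega P \<Longrightarrow> a' x v = a x v) \<Longrightarrow> a' \<in> A"
  using phase_class_A unfolding phase_class_def by blast

lemma A_smooth: "a \<in> A \<Longrightarrow> smooth_on Z (case_prod a)"
  using phase_class_A unfolding phase_class_def by blast

lemma A_differentiable: "a \<in> A \<Longrightarrow> x \<in> Omega P \<Longrightarrow> case_prod a differentiable (at (x, v))"
  using A_smooth smooth_on_differentiable by blast

lemma
  assumes "a \<in> A" "x \<in> Omega P"
  shows A_differentiable_x: "(\<lambda>y. a y v) differentiable (at x)"
    and A_differentiable_v: "(\<lambda>w. a x w) differentiable (at v)"
  using x_slice_derivative[OF A_differentiable[OF assms]]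
    v_slice_derivative[OF A_differentiable[OF assms]] differentiableI by blast+

lemma expressions: "expressions_defined P K" and by_parts: "no_boundary_terms P K"
  using setting by (simp_all add: formal_setting_def)

lemma
  assumes "a \<in> A"
  shows A_velocity: "(\<lambda>x v. v $ i * a x v) \<in> A"
    and A_E0: "(\<lambda>x v. E0 P x $ i * a x v) \<in> A"
    and A_grad_x: "(\<lambda>x v. grad_x a x v $ i) \<in> A"
    and A_grad_v: "(\<lambda>x v. grad_v a x v $ i) \<in> A"
  using expressions assms unfolding expressions_defined_def by blast+

lemma A_force:
  assumes "a \<in> A"
  shows "(\<lambda>x v. force P x v $ i * a x v) \<in> A"
proof -
  have "(\<lambda>x v. E0 P x $ i * a x v + (\<Sum>j\<in>UNIV. cross3 (axis j 1) (B0 P) $ i * (v $ j * a x v))) \<in> A"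
    by (intro A_add A_E0 A_sum A_scale A_velocity assms) simp
  then show ?thesis
    by (simp add: force_component algebra_simps sum_distrib_left)
qed

lemma transport_eq:
  "transport P a = (\<lambda>x v. (\<Sum>i\<in>UNIV. v $ i * grad_x a x v $ i)
     + 1 / eps P * (\<Sum>i\<in>UNIV. force P x v $ i * grad_v a x v $ i))"
  by (intro ext) (simp add: transport_def inner_vec_def)

lemma A_transport: "a \<in> A \<Longrightarrow> transport P a \<in> A"
  unfolding transport_eq
  by (intro A_linear A_sum A_velocity A_force A_grad_x A_grad_v) simp_all

lemma A_field: "e \<in> E_fields K \<Longrightarrow> (\<lambda>x v. e x $ i) \<in> A"
  using expressions unfolding expressions_defined_def by blast

lemma A_field_velocity: "e \<in> E_fields K \<Longrightarrow> (\<lambda>x v. e x \<bullet> v) \<in> A"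
proof -
  assume "e \<in> E_fields K"
  then have "(\<lambda>x v. \<Sum>i\<in>UNIV. v $ i * e x $ i) \<in> A"
    by (intro A_sum A_velocity A_field) simp_all
  then show ?thesis by (simp add: inner_vec_def mult.commute)
qed

lemma curl_E: "e \<in> E_fields K \<Longrightarrow> curl e \<in> B_fields K"
  and curl_B: "b \<in> B_fields K \<Longrightarrow> curl b \<in> E_fields K"
  using expressions unfolding expressions_defined_def by blast+

lemma f0_pos: "x \<in> Omega P \<Longrightarrow> f0 P x v > 0"
  using n0_pos vth_pos by (simp add: f0_def)

section \<open>Integrals over the domain and over phase space, and the inner products built from
  them\<close>

lemma phase_int_cong:
  "(\<And>x v. x \<in> Omega P \<Longrightarrow> h x v = h' x v) \<Longrightarrow> phase_int P h = phase_int P h'"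
  unfolding phase_int_def by (intro set_lebesgue_integral_cong) (auto simp: open_Omega open_Times)

lemma phase_integrable_cong:
  "(\<And>x v. x \<in> Omega P \<Longrightarrow> h x v = h' x v) \<Longrightarrow> phase_integrable P h = phase_integrable P h'"
  unfolding phase_integrable_def by (intro set_integrable_cong) (auto simp: open_Omega open_Times)

lemma space_int_cong:
  "(\<And>x. x \<in> Omega P \<Longrightarrow> h x = h' x) \<Longrightarrow> space_int P h = space_int P h'"
  unfolding space_int_def by (intro set_lebesgue_integral_cong) (auto simp: open_Omega open_Times)

lemma phase_int_linear:
  assumes "phase_integrable P h" "phase_integrable P h'"
  shows "phase_int P (\<lambda>x v. h x v + c * h' x v) = phase_int P h + c * phase_int P h'"
  using assms unfolding phase_int_def phase_integrable_def
  by (simp add: set_integral_add)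

lemma space_int_linear:
  assumes "space_integrable P h" "space_integrable P h'"
  shows "space_int P (\<lambda>x. h x + c * h' x) = space_int P h + c * space_int P h'"
  using assms unfolding space_int_def space_integrable_def
  by (simp add: set_integral_add)

text \<open>Fubini; the indicator of the integration region depends on \<open>x\<close> alone and
  leaves the inner integral.\<close>

lemma
  assumes "phase_integrable P h"
  shows phase_int_iterated: "phase_int P h = space_int P (\<lambda>x. LINT v|lborel. h x v)"
    and phase_integrable_iterated: "space_integrable P (\<lambda>x. LINT v|lborel. h x v)"
proof -
  let ?f = "\<lambda>z. indicat_real Z z *\<^sub>R h (fst z) (snd z)"
  have "integrable (lborel \<Otimes>\<^sub>M lborel) ?f"
    using assms by (simp add: phase_integrable_def set_integrable_def lborel_prod)
  note int = lborel_pair.integral_fst'[OF this] lborel_pair.integrable_fst'[OF this]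
  have "(LINT v|lborel. ?f (x, v)) = indicat_real (Omega P) x *\<^sub>R (LINT v|lborel. h x v)" for x
    by (simp add: indicator_times)
  with int show "phase_int P h = space_int P (\<lambda>x. LINT v|lborel. h x v)"
    "space_integrable P (\<lambda>x. LINT v|lborel. h x v)"
    by (simp_all add: phase_int_def space_int_def set_lebesgue_integral_def space_integrable_def
        set_integrable_def lborel_prod)
qed

definition ip :: "(R3 \<Rightarrow> R3 \<Rightarrow> real) \<Rightarrow> (R3 \<Rightarrow> R3 \<Rightarrow> real) \<Rightarrow> real" where
  "ip a a' = phase_int P (\<lambda>x v. f0 P x v * a x v * a' x v)"

definition sip :: "(R3 \<Rightarrow> R3) \<Rightarrow> (R3 \<Rightarrow> R3) \<Rightarrow> real" where
  "sip e e' = space_int P (\<lambda>x. e x \<bullet> e' x)"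

lemma ip_integrable:
  "a \<in> A \<Longrightarrow> a' \<in> A \<Longrightarrow> phase_integrable P (\<lambda>x v. f0 P x v * a x v * a' x v)"
  using expressions unfolding expressions_defined_def by blast

lemma sip_integrable:
  "is_field_class V \<Longrightarrow> e \<in> V \<Longrightarrow> e' \<in> V \<Longrightarrow> space_integrable P (\<lambda>x. e x \<bullet> e' x)"
  using expressions unfolding expressions_defined_def is_field_class_def by blast

lemma ip_commute: "ip a a' = ip a' a"
  by (simp add: ip_def mult_ac)

lemma sip_commute: "sip e e' = sip e' e"
  by (simp add: sip_def inner_commute)

lemma ip_cong:
  "(\<And>x v. x \<in> Omega P \<Longrightarrow> a x v = b x v) \<Longrightarrow> (\<And>x v. x \<in> Omega P \<Longrightarrow> a' x v = b' x v) \<Longrightarrow> ip a a' = ip b b'"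
  unfolding ip_def by (intro phase_int_cong) simp

lemma sip_cong:
  "(\<And>x. x \<in> Omega P \<Longrightarrow> a x = b x) \<Longrightarrow> (\<And>x. x \<in> Omega P \<Longrightarrow> a' x = b' x) \<Longrightarrow> sip a a' = sip b b'"
  unfolding sip_def by (intro space_int_cong) simp

lemma ip_linear_right:
  assumes "a \<in> A" "b \<in> A" "b' \<in> A"
  shows "ip a (\<lambda>x v. b x v + c * b' x v) = ip a b + c * ip a b'"
  unfolding ip_def phase_int_linear[OF ip_integrable[OF assms(1,2)] ip_integrable[OF assms(1,3)], symmetric]
  by (intro phase_int_cong) (simp add: algebra_simps)

lemma ip_zero_right: "ip a (\<lambda>x v. 0) = 0"
  by (simp add: ip_def phase_int_def)

lemma ip_scale_right: "a \<in> A \<Longrightarrow> b \<in> A \<Longrightarrow> ip a (\<lambda>x v. c * b x v) = c * ip a b"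
  using ip_linear_right[OF _ A_zero, of a b c] by (simp add: ip_zero_right)

lemma ip_sum_right:
  assumes "a \<in> A" "finite I" "\<And>i. i \<in> I \<Longrightarrow> b i \<in> A"
  shows "ip a (\<lambda>x v. \<Sum>i\<in>I. b i x v) = (\<Sum>i\<in>I. ip a (b i))"
  using assms(2,3)
proof (induction I)
  case empty
  then show ?case by (simp add: ip_zero_right)
next
  case (insert i I)
  then have "ip a (\<lambda>x v. b i x v + 1 * (\<Sum>i\<in>I. b i x v)) = ip a (b i) + 1 * ip a (\<lambda>x v. \<Sum>i\<in>I. b i x v)"
    by (intro ip_linear_right assms(1) A_sum) auto
  with insert show ?case by simp
qed

lemma sip_linear_right:
  assumes V: "is_field_class V" and e: "e \<in> V" "b \<in> V" "b' \<in> V"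
  shows "sip e (\<lambda>x. b x + c *\<^sub>R b' x) = sip e b + c * sip e b'"
  unfolding sip_def space_int_linear[OF sip_integrable[OF V e(1,2)] sip_integrable[OF V e(1,3)], symmetric]
  by (intro space_int_cong) (simp add: inner_add_right)

lemma sip_zero_right: "sip e (\<lambda>x. 0) = 0"
  by (simp add: sip_def space_int_def)

lemma sip_scale_right:
  "is_field_class V \<Longrightarrow> e \<in> V \<Longrightarrow> b \<in> V \<Longrightarrow> sip e (\<lambda>x. c *\<^sub>R b x) = c * sip e b"
  using sip_linear_right[OF _ _ field_zero, of V e b c] by (simp add: sip_zero_right)

abbreviation "\<kappa> \<equiv> 1 / ((vth P)\<^sup>2 * eps P)"

lemma n0_differentiable: "x \<in> Omega P \<Longrightarrow> n0 P differentiable (at x)"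
  using smooth_n0 smooth_on_differentiable by blast

text \<open>\<open>E0\<close> is defined so that the gradient of \<open>ln n0\<close> is
  \<open>\<kappa>\<close> times \<open>E0\<close>: the coupling constant of the bracket is also the
  constant in the logarithmic derivative of \<open>f0\<close>.\<close>

lemma partial_n0:
  assumes x: "x \<in> Omega P"
  shows "partial i (n0 P) x = \<kappa> * E0 P x $ i * n0 P x"
proof -
  let ?D = "frechet_derivative (n0 P) (at x)"
  have D: "(n0 P has_derivative ?D) (at x)"
    using n0_differentiable[OF x] frechet_derivative_works by blast
  have "((\<lambda>y. ln (n0 P y)) has_derivative (\<lambda>h. ?D h * inverse (n0 P x))) (at x)"
    using D n0_pos[OF x] by (auto intro!: derivative_eq_intros)
  from has_derivative_partial[OF this]
  have "partial i (\<lambda>y. ln (n0 P y)) x = partial i (n0 P) x / n0 P x"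
    by (simp add: has_derivative_partial[OF D] divide_inverse)
  then show ?thesis
    using n0_pos[OF x] vth_pos eps_nonzero by (simp add: E0_def grad_def)
qed

lemma
  assumes x: "x \<in> Omega P"
  shows f0_differentiable_x: "(\<lambda>y. f0 P y v) differentiable (at x)"
    and partial_f0_x: "partial i (\<lambda>y. f0 P y v) x = \<kappa> * E0 P x $ i * f0 P x v"
proof -
  let ?D = "frechet_derivative (n0 P) (at x)"
  let ?c = "exp (- ((norm v)\<^sup>2 / (2 * (vth P)\<^sup>2))) / (sqrt (2 * pi) * vth P) ^ 3"
  have "(n0 P has_derivative ?D) (at x)"
    using n0_differentiable[OF x] frechet_derivative_works by blast
  then have "((\<lambda>y. n0 P y * ?c) has_derivative (\<lambda>h. ?D h * ?c)) (at x)"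
    by (rule has_derivative_mult_left)
  moreover have "(\<lambda>y. f0 P y v) = (\<lambda>y. n0 P y * ?c)"
    by (simp add: f0_def fun_eq_iff)
  ultimately have D: "((\<lambda>y. f0 P y v) has_derivative (\<lambda>h. ?D h * ?c)) (at x)" by simp
  then show "(\<lambda>y. f0 P y v) differentiable (at x)" by (rule differentiableI)
  show "partial i (\<lambda>y. f0 P y v) x = \<kappa> * E0 P x $ i * f0 P x v"
    using has_derivative_partial[OF D] partial_n0[OF x, of i]
    by (simp add: partial_def f0_def)
qed

lemma f0_differentiable_v: "(\<lambda>w. f0 P x w) differentiable (at v)"
  and partial_f0_v: "partial i (\<lambda>w. f0 P x w) v = - (v $ i / (vth P)\<^sup>2) * f0 P x v"
proof -
  define q where "q = 1 / (2 * (vth P)\<^sup>2)"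
  let ?c = "n0 P x / (sqrt (2 * pi) * vth P) ^ 3"
  have "((\<lambda>w. ?c * exp (- (q * (w \<bullet> w)))) has_derivative
      (\<lambda>h. ?c * (- (q * (v \<bullet> h + h \<bullet> v)) * exp (- (q * (v \<bullet> v)))))) (at v)"
    by (intro has_derivative_mult_right has_derivative_exp has_derivative_minus has_derivative_inner
        has_derivative_ident)
  moreover have "(\<lambda>w. f0 P x w) = (\<lambda>w. ?c * exp (- (q * (w \<bullet> w))))"
    by (simp add: f0_def fun_eq_iff power2_norm_eq_inner q_def)
  ultimately have D: "((\<lambda>w. f0 P x w) has_derivative
      (\<lambda>h. ?c * (- (q * (v \<bullet> h + h \<bullet> v)) * exp (- (q * (v \<bullet> v)))))) (at v)"
    by simp
  then show "(\<lambda>w. f0 P x w) differentiable (at v)" by (rule differentiableI)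
  have "q * (v $ i + v $ i) = v $ i / (vth P)\<^sup>2" by (simp add: q_def)
  then have "partial i (\<lambda>w. f0 P x w) v = ?c * (- (v $ i / (vth P)\<^sup>2) * exp (- (q * (v \<bullet> v))))"
    unfolding has_derivative_partial[OF D] by (simp add: inner_axis inner_axis')
  then show "partial i (\<lambda>w. f0 P x w) v = - (v $ i / (vth P)\<^sup>2) * f0 P x v"
    by (simp add: f0_def power2_norm_eq_inner q_def mult_ac)
qed

lemma f0_continuous: "continuous_on Z (\<lambda>z. f0 P (fst z) (snd z))"
proof -
  have "continuous_on Z (\<lambda>z. n0 P (fst z))"
    by (rule continuous_on_compose2[OF smooth_on_continuous[OF smooth_n0] continuous_on_fst]) auto
  then show ?thesis
    unfolding f0_def using vth_pos by (auto intro!: continuous_intros)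
qed

text \<open>The zeroth-order term is the logarithmic derivative of the weight.\<close>

lemma grad_x_weighted:
  assumes "b \<in> A" "x \<in> Omega P"
  shows "grad_x (\<lambda>x v. f0 P x v * b x v) x v $ i
    = f0 P x v * (\<kappa> * (E0 P x $ i * b x v) + grad_x b x v $ i)"
  unfolding grad_x_def grad_def
  using partial_product[OF f0_differentiable_x[of x v] A_differentiable_x[of b x v], of i] assms
  by (simp add: partial_f0_x algebra_simps)

lemma grad_v_weighted:
  assumes "b \<in> A" "x \<in> Omega P"
  shows "grad_v (\<lambda>x v. f0 P x v * b x v) x v $ i
    = f0 P x v * (- 1 / (vth P)\<^sup>2 * (v $ i * b x v) + grad_v b x v $ i)"
  unfolding grad_v_def grad_def
  using partial_product[OF f0_differentiable_v[of x v] A_differentiable_v[of b x v], of i] assms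
  by (simp add: partial_f0_v algebra_simps)

lemma grad_x_velocity:
  assumes "a \<in> A" "x \<in> Omega P"
  shows "grad_x (\<lambda>x v. v $ j * a x v) x v $ i = v $ j * grad_x a x v $ i"
  using partial_product[OF differentiable_const A_differentiable_x[OF assms], of i "v $ j" v]
  by (simp add: grad_x_def grad_def partial_def)

text \<open>The component of \<open>v \<times> B\<^sub>0\<close> along an axis does not depend on the velocity along that axis.\<close>

lemma grad_v_force:
  assumes "a \<in> A" "x \<in> Omega P"
  shows "grad_v (\<lambda>x v. force P x v $ i * a x v) x v $ i = force P x v $ i * grad_v a x v $ i"
proof -
  have D: "((\<lambda>w. force P x w $ i) has_derivative (\<lambda>h. \<Sum>j\<in>UNIV. cross3 (axis j 1) (B0 P) $ i * h $ j)) (at v)"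
    unfolding force_component
    by (auto intro!: derivative_eq_intros bounded_linear.has_derivative[OF bounded_linear_vec_nth])
  then have "partial i (\<lambda>w. force P x w $ i) v = 0"
    using has_derivative_partial[OF D, of i] exhaust_3[of i]
    by (auto simp: sum_3 cross_components axis_def)
  then show ?thesis
    using partial_product[OF differentiableI[OF D] A_differentiable_v[OF assms], of i]
    by (simp add: grad_v_def grad_def)
qed

text \<open>In the weighted product the adjoint of a partial derivative is minus that derivative
  plus a correction by the logarithmic derivative of \<open>f0\<close>.\<close>

lemma ip_grad_x:
  assumes "b \<in> A" "a' \<in> A"
  shows "ip b (\<lambda>x v. grad_x a' x v $ i)
    = - ip (\<lambda>x v. grad_x b x v $ i + \<kappa> * (E0 P x $ i * b x v)) a'"
proof -
  have "ip b (\<lambda>x v. grad_x a' x v $ i)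
      = - phase_int P (\<lambda>x v. grad_x (\<lambda>x v. f0 P x v * b x v) x v $ i * a' x v)"
    using by_parts assms unfolding no_boundary_terms_def ip_def by blast
  also have "phase_int P (\<lambda>x v. grad_x (\<lambda>x v. f0 P x v * b x v) x v $ i * a' x v)
      = ip (\<lambda>x v. grad_x b x v $ i + \<kappa> * (E0 P x $ i * b x v)) a'"
    unfolding ip_def by (intro phase_int_cong) (simp only: grad_x_weighted[OF assms(1)], simp only: add_ac mult_ac)
  finally show ?thesis .
qed

lemma ip_grad_v:
  assumes "b \<in> A" "a' \<in> A"
  shows "ip b (\<lambda>x v. grad_v a' x v $ i)
    = - ip (\<lambda>x v. grad_v b x v $ i + - 1 / (vth P)\<^sup>2 * (v $ i * b x v)) a'"
proof -
  have "ip b (\<lambda>x v. grad_v a' x v $ i)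
      = - phase_int P (\<lambda>x v. grad_v (\<lambda>x v. f0 P x v * b x v) x v $ i * a' x v)"
    using by_parts assms unfolding no_boundary_terms_def ip_def by blast
  also have "phase_int P (\<lambda>x v. grad_v (\<lambda>x v. f0 P x v * b x v) x v $ i * a' x v)
      = ip (\<lambda>x v. grad_v b x v $ i + - 1 / (vth P)\<^sup>2 * (v $ i * b x v)) a'"
    unfolding ip_def by (intro phase_int_cong) (simp only: grad_v_weighted[OF assms(1)], simp only: add_ac mult_ac)
  finally show ?thesis .
qed

lemma velocity_dot_force: "v \<bullet> force P x v = v \<bullet> E0 P x"
  by (simp add: force_def inner_add_right dot_cross_self)

text \<open>The weight \<open>f\<^sub>0\<close> is in equilibrium and the characteristic vector field is divergence free,
  so all zeroth-order terms produced by the integrations by parts cancel.\<close>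

lemma ip_transport:
  assumes a: "a \<in> A" and a': "a' \<in> A"
  shows "ip a (transport P a') = - ip (transport P a) a'"
proof -
  \<comment> \<open>\<open>?X i\<close> and \<open>?Y i\<close> come from moving one derivative off
    \<open>a'\<close>: the coefficient, velocity or force, is first attached to \<open>a\<close> and
    then differentiated along with it.\<close>
  let ?X = "\<lambda>i x v. grad_x (\<lambda>x v. v $ i * a x v) x v $ i + \<kappa> * (E0 P x $ i * (v $ i * a x v))"
  let ?Y = "\<lambda>i x v. grad_v (\<lambda>x v. force P x v $ i * a x v) x v $ i
      + - 1 / (vth P)\<^sup>2 * (v $ i * (force P x v $ i * a x v))"
  have X: "?X i \<in> A" and Y: "?Y i \<in> A" for i
    by (intro A_linear A_E0 A_grad_x A_grad_v A_velocity A_force a)+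
  have S: "(\<Sum>i\<in>UNIV. ip (h i) a') = ip a' (\<lambda>x v. \<Sum>i\<in>UNIV. h i x v)"
    if "\<And>i. h i \<in> A" for h :: "3 \<Rightarrow> _"
    using ip_sum_right[OF a' finite, of UNIV h] that by (simp only: ip_commute[of a'])
  have shift: "ip a (\<lambda>x v. p x v * b x v) = ip (\<lambda>x v. p x v * a x v) b" for p b
    unfolding ip_def by (intro phase_int_cong) simp
  have "ip a (transport P a') = (\<Sum>i\<in>UNIV. ip a (\<lambda>x v. v $ i * grad_x a' x v $ i))
      + 1 / eps P * (\<Sum>i\<in>UNIV. ip a (\<lambda>x v. force P x v $ i * grad_v a' x v $ i))"
    unfolding transport_eq using a a'
    by (subst ip_linear_right)
      (auto intro!: A_sum A_velocity A_force A_grad_x A_grad_v arg_cong2[where f = "(+)"] ip_sum_right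
        arg_cong[where f = "\<lambda>t. t / eps P"])
  also have "\<dots> = (\<Sum>i\<in>UNIV. - ip (?X i) a') + 1 / eps P * (\<Sum>i\<in>UNIV. - ip (?Y i) a')"
    unfolding shift using a a' by (simp add: ip_grad_x ip_grad_v A_velocity A_force)
  also have "\<dots> = - (ip a' (\<lambda>x v. \<Sum>i\<in>UNIV. ?X i x v) + 1 / eps P * ip a' (\<lambda>x v. \<Sum>i\<in>UNIV. ?Y i x v))"
    unfolding sum_negf S[OF X] S[OF Y] by (simp only: minus_add_distrib mult_minus_right)
  also have "\<dots> = - ip a' (\<lambda>x v. (\<Sum>i\<in>UNIV. ?X i x v) + 1 / eps P * (\<Sum>i\<in>UNIV. ?Y i x v))"
    using a' X Y by (subst ip_linear_right) (auto intro!: A_sum)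
  also have "ip a' (\<lambda>x v. (\<Sum>i\<in>UNIV. ?X i x v) + 1 / eps P * (\<Sum>i\<in>UNIV. ?Y i x v)) = ip a' (transport P a)"
  proof (rule ip_cong)
    fix x v assume x: "x \<in> Omega P"
    have SX: "(\<Sum>i\<in>UNIV. ?X i x v) = v \<bullet> grad_x a x v + \<kappa> * (v \<bullet> E0 P x) * a x v"
      using grad_x_velocity[OF a x]
      by (simp add: inner_vec_def sum.distrib sum_distrib_left sum_distrib_right mult_ac)
    have SY: "(\<Sum>i\<in>UNIV. ?Y i x v)
        = force P x v \<bullet> grad_v a x v + - 1 / (vth P)\<^sup>2 * (v \<bullet> force P x v) * a x v"
      unfolding grad_v_force[OF a x] inner_vec_def inner_real_def sum_3
      by (simp add: algebra_simps add_divide_distrib diff_divide_distrib)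
    \<comment> \<open>The zeroth-order terms are \<open>\<kappa> * (v \<bullet> E0)\<close> and
      \<open>- \<kappa> * (v \<bullet> E0)\<close>, since the magnetic force is orthogonal to the
      velocity.\<close>
    show "(\<Sum>i\<in>UNIV. ?X i x v) + 1 / eps P * (\<Sum>i\<in>UNIV. ?Y i x v) = transport P a x v"
      unfolding SX SY transport_def velocity_dot_force
      using vth_pos eps_nonzero by (simp add: field_simps)
  qed simp
  finally show ?thesis by (simp add: ip_commute)
qed

text \<open>The first velocity moment of \<open>f0 * a\<close>, which is the current density up to a
  constant when \<open>a\<close> is \<open>f1 / f0\<close>.\<close>

definition flux :: "(R3 \<Rightarrow> R3 \<Rightarrow> real) \<Rightarrow> R3 \<Rightarrow> R3" where
  "flux a x = (LINT v|lborel. (f0 P x v * a x v) *\<^sub>R v)"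

lemma flux_field: "a \<in> A \<Longrightarrow> flux a \<in> E_fields K"
  using expressions unfolding expressions_defined_def flux_def by blast

text \<open>By Fubini, \<open>flux\<close> is the adjoint of the map taking a field \<open>e\<close>
  to the phase function \<open>e x \<bullet> v\<close>. This makes the field-particle coupling in
  \<open>J\<close> skew.\<close>

lemma ip_flux:
  assumes e: "e \<in> E_fields K" and a: "a \<in> A"
  shows "ip (\<lambda>x v. e x \<bullet> v) a = sip e (flux a)"
proof -
  have "ip (\<lambda>x v. e x \<bullet> v) a = space_int P (\<lambda>x. LINT v|lborel. f0 P x v * (e x \<bullet> v) * a x v)"
    unfolding ip_def by (intro phase_int_iterated ip_integrable A_field_velocity e a)
  also have "\<dots> = sip e (flux a)"
    unfolding sip_def
  proof (rule space_int_cong)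
    fix x assume "x \<in> Omega P"
    then have "integrable lborel (\<lambda>v. (f0 P x v * a x v) *\<^sub>R v)"
      using expressions a unfolding expressions_defined_def by blast
    then have "(LINT v|lborel. e x \<bullet> ((f0 P x v * a x v) *\<^sub>R v)) = e x \<bullet> flux a x"
      unfolding flux_def by (intro integral_inner_right)
    then show "(LINT v|lborel. f0 P x v * (e x \<bullet> v) * a x v) = e x \<bullet> flux a x"
      by (simp add: mult_ac)
  qed
  finally show ?thesis .
qed

lemma sip_curl: "e \<in> E_fields K \<Longrightarrow> b \<in> B_fields K \<Longrightarrow> sip (curl e) b = sip e (curl b)"
  using by_parts unfolding no_boundary_terms_def sip_def by blast

end

subsection \<open>The Poisson operator\<close>

lemma add_scaled_simp [simp]:
  "add_scaled (f, E, B) s (f', E', B') =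
    (\<lambda>x v. f x v + s * f' x v, \<lambda>x. E x + s *\<^sub>R E' x, \<lambda>x. B x + s *\<^sub>R B' x)"
  by (simp add: add_scaled_def)

lemma ratio_simp [simp]: "ratio P (f, E, B) = (\<lambda>x v. f x v / f0 P x v, E, B)"
  by (simp add: ratio_def)

lemma add_scaled_zero [simp]: "add_scaled u 0 w = u"
  by (cases u; cases w) simp

lemma ratio_add_scaled: "ratio P (add_scaled u s w) = add_scaled (ratio P u) s (ratio P w)"
  by (cases u; cases w) (simp add: add_divide_distrib)

definition zero_fields :: fields where
  "zero_fields = (\<lambda>x v. 0, \<lambda>x. 0, \<lambda>x. 0)"

text \<open>Inverse of \<open>ratio\<close> over the domain; it turns triples of functional
  derivatives into admissible variations.\<close>

definition weighted :: "background \<Rightarrow> fields \<Rightarrow> fields" where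
  "weighted P = (\<lambda>(a, e, b). (\<lambda>x v. f0 P x v * a x v, e, b))"

context vlasov_maxwell
begin

lemma f0_nonzero: "x \<in> Omega P \<Longrightarrow> f0 P x v \<noteq> 0"
  using f0_pos by (metis less_irrefl)

lemma gradients_iff [simp]:
  "(a, e, b) \<in> gradients K \<longleftrightarrow> a \<in> A \<and> e \<in> E_fields K \<and> b \<in> B_fields K"
  by (simp add: gradients_def)

lemma gradients_cases:
  assumes "g \<in> gradients K"
  obtains a e b where "g = (a, e, b)" "a \<in> A" "e \<in> E_fields K" "b \<in> B_fields K"
  using assms by (cases g) simp

lemma add_scaled_gradients:
  "g \<in> gradients K \<Longrightarrow> h \<in> gradients K \<Longrightarrow> add_scaled g c h \<in> gradients K"
  by (elim gradients_cases) (simp add: A_linear field_linear)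

lemma zero_gradients: "zero_fields \<in> gradients K"
  by (simp add: zero_fields_def A_zero field_zero)

lemma add_scaled_states:
  "u \<in> states P K \<Longrightarrow> w \<in> states P K \<Longrightarrow> add_scaled u s w \<in> states P K"
  by (simp add: states_def ratio_add_scaled add_scaled_gradients)

lemma weighted_states: "g \<in> gradients K \<Longrightarrow> weighted P g \<in> states P K"
proof (elim gradients_cases)
  fix a e b assume g: "g = (a, e, b)" "a \<in> A" "e \<in> E_fields K" "b \<in> B_fields K"
  have "(\<lambda>x v. f0 P x v * a x v / f0 P x v) \<in> A"
    \<comment> \<open>The quotient reduces to \<open>a\<close> only over the domain; the class is
      closed under changes elsewhere.\<close>
    using g(2) by (rule A_cong) (simp add: f0_nonzero)
  with g show ?thesis by (simp add: states_def weighted_def)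
qed

definition Q :: "fields \<Rightarrow> fields \<Rightarrow> real" where
  "Q = (\<lambda>(a, e, b) (a', e', b'). ip a a' + sip e e' + sip b b')"

text \<open>The bracket with all derivatives moved onto its second argument.\<close>

definition Br :: "fields \<Rightarrow> fields \<Rightarrow> real" where
  "Br = (\<lambda>(a, e, b) (a', e', b').
     ip a (\<lambda>x v. \<kappa> * (e' x \<bullet> v) + - 1 / ((alpha P)\<^sup>2 * (vth P)\<^sup>2) * transport P a' x v)
     + sip e (curl b') - \<kappa> * ip (\<lambda>x v. e x \<bullet> v) a' - sip b (curl e'))"

text \<open>The Poisson operator: it sends \<open>\<delta>G\<close> to the velocity of the flow generated by \<open>G\<close>, with
  the phase space component divided by \<open>f\<^sub>0\<close>.\<close>

definition J :: "fields \<Rightarrow> fields" where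
  "J = (\<lambda>(a, e, b).
     (\<lambda>x v. \<kappa> * (e x \<bullet> v) + - 1 / ((alpha P)\<^sup>2 * (vth P)\<^sup>2) * transport P a x v,
      \<lambda>x. curl b x + (- \<kappa>) *\<^sub>R flux a x,
      \<lambda>x. (- 1) *\<^sub>R curl e x))"

lemma J_gradients: "g \<in> gradients K \<Longrightarrow> J g \<in> gradients K"
proof (elim gradients_cases)
  fix a e b assume g: "g = (a, e, b)" "a \<in> A" "e \<in> E_fields K" "b \<in> B_fields K"
  show ?thesis
    unfolding g J_def prod.case gradients_iff using g(2-)
    by (intro conjI A_linear A_scale A_field_velocity A_transport field_linear field_scale curl_B curl_E
      flux_field is_field_class)
qed

lemma Q_commute: "Q g h = Q h g"
  by (cases g; cases h) (simp add: Q_def ip_commute sip_commute)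

lemma Q_linear_right:
  "g \<in> gradients K \<Longrightarrow> h \<in> gradients K \<Longrightarrow> h' \<in> gradients K \<Longrightarrow>
    Q g (add_scaled h c h') = Q g h + c * Q g h'"
  by (elim gradients_cases) (simp add: Q_def ip_linear_right
      sip_linear_right[OF is_field_class(1)] sip_linear_right[OF is_field_class(2)] algebra_simps)

lemma Q_linear_left:
  "g \<in> gradients K \<Longrightarrow> h \<in> gradients K \<Longrightarrow> h' \<in> gradients K \<Longrightarrow>
    Q (add_scaled h c h') g = Q h g + c * Q h' g"
  using Q_linear_right by (simp add: Q_commute)

lemma Q_zero_left: "Q zero_fields g = 0"
  by (cases g) (simp add: Q_def zero_fields_def ip_commute sip_commute ip_zero_right sip_zero_right)

text \<open>Only the coupling term differs between the two sides, and \<open>ip_flux\<close>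
  converts it into the current term of \<open>J\<close>.\<close>

lemma Br_eq_Q_J:
  assumes "g \<in> gradients K" "h \<in> gradients K"
  shows "Br g h = Q g (J h)"
  using assms
proof (elim gradients_cases)
  fix a e b a' e' b'
  assume g: "g = (a, e, b)" "a \<in> A" "e \<in> E_fields K" "b \<in> B_fields K"
    and h: "h = (a', e', b')" "a' \<in> A" "e' \<in> E_fields K" "b' \<in> B_fields K"
  have "sip e (\<lambda>x. curl b' x + (- \<kappa>) *\<^sub>R flux a' x) = sip e (curl b') + (- \<kappa>) * sip e (flux a')"
    using g h by (intro sip_linear_right[OF is_field_class(1)] curl_B flux_field) auto
  moreover have "sip b (\<lambda>x. (- 1) *\<^sub>R curl e' x) = (- 1) * sip b (curl e')"
    using g h by (intro sip_scale_right[OF is_field_class(2)] curl_E) auto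
  ultimately show ?thesis
    unfolding g h Br_def Q_def J_def prod.case using g h ip_flux by simp
qed

text \<open>Transport is skew for \<open>ip\<close>, curl is symmetric between the two field
  classes, and the two coupling terms exchange roles with opposite sign.\<close>

lemma Br_skew:
  assumes "g \<in> gradients K" "h \<in> gradients K"
  shows "Br g h = - Br h g"
  using assms
proof (elim gradients_cases)
  fix a e b a' e' b'
  assume g: "g = (a, e, b)" "a \<in> A" "e \<in> E_fields K" "b \<in> B_fields K"
    and h: "h = (a', e', b')" "a' \<in> A" "e' \<in> E_fields K" "b' \<in> B_fields K"
  have expand: "ip a (\<lambda>x v. \<kappa> * (e' x \<bullet> v) + c * transport P a' x v)
      = \<kappa> * ip (\<lambda>x v. e' x \<bullet> v) a + c * ip a (transport P a')"
    if "a \<in> A" "a' \<in> A" "e' \<in> E_fields K" for a a' e' c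
    using that
    by (subst ip_linear_right) (auto intro!: A_scale A_field_velocity A_transport
        simp: ip_scale_right[OF _ A_field_velocity] ip_commute simp del: times_divide_eq_left)
  show ?thesis
    unfolding g h Br_def prod.case
      expand[OF g(2) h(2,3)] expand[OF h(2) g(2,3)] ip_transport[OF g(2) h(2)]
      sip_curl[OF g(3) h(4), symmetric] sip_curl[OF h(3) g(4), symmetric]
    by (simp add: ip_commute sip_commute algebra_simps)
qed

lemma Br_linear_left:
  "g \<in> gradients K \<Longrightarrow> h \<in> gradients K \<Longrightarrow> h' \<in> gradients K \<Longrightarrow>
    Br (add_scaled h c h') g = Br h g + c * Br h' g"
  by (simp add: Br_eq_Q_J add_scaled_gradients Q_linear_left J_gradients)

lemma Br_linear_right:
  "g \<in> gradients K \<Longrightarrow> h \<in> gradients K \<Longrightarrow> h' \<in> gradients K \<Longrightarrow>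
    Br g (add_scaled h c h') = Br g h + c * Br g h'"
  by (simp add: Br_skew[of g] add_scaled_gradients Br_linear_left)

lemma Br_zero_right: "g \<in> gradients K \<Longrightarrow> Br g zero_fields = 0"
  by (simp add: Br_skew[of g] zero_gradients Br_eq_Q_J[OF zero_gradients] Q_zero_left)

lemma Br_scale_right:
  "g \<in> gradients K \<Longrightarrow> h \<in> gradients K \<Longrightarrow> Br g (add_scaled zero_fields c h) = c * Br g h"
  by (simp add: Br_linear_right zero_gradients Br_zero_right)

lemma Q_cong:
  assumes "\<And>x v. x \<in> Omega P \<Longrightarrow> a x v = a' x v" "\<And>x. x \<in> Omega P \<Longrightarrow> e x = e' x"
    "\<And>x. x \<in> Omega P \<Longrightarrow> b x = b' x"
  shows "Q g (a, e, b) = Q g (a', e', b')"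
  using assms
  by (cases g) (auto simp: Q_def intro!: arg_cong2[where f = "(+)"] ip_cong sip_cong)

text \<open>Over the domain \<open>a * f = f0 * a * (f / f0)\<close>, so the unweighted pairing with
  a state is the weighted form with its ratio.\<close>

lemma pairing_ratio: "pairing P g w = Q g (ratio P w)"
proof (cases g; cases w)
  fix a e b f E B assume gw: "g = (a, e, b)" "w = (f, E, B)"
  have "phase_int P (\<lambda>x v. a x v * f x v) = ip a (\<lambda>x v. f x v / f0 P x v)"
    unfolding ip_def by (rule phase_int_cong) (simp add: f0_nonzero)
  then show ?thesis by (simp add: gw pairing_def Q_def sip_def)
qed

lemma pairing_weighted: "pairing P g (weighted P h) = Q g h"
proof (cases h)
  case (fields a e b)
  have "f0 P x v * a x v / f0 P x v = a x v" if "x \<in> Omega P" for x v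
    using f0_pos[OF that, of v] by simp
  then show ?thesis unfolding pairing_ratio fields weighted_def prod.case ratio_simp by (intro Q_cong) auto
qed

section \<open>Independence of the bracket from the choice of functional derivatives\<close>

lemma functional_derivative_unique:
  assumes "has_functional_derivative P K F u g" "has_functional_derivative P K F u g'" "h \<in> gradients K"
  shows "Q g h = Q g' h"
  using assms weighted_states[OF assms(3)] DERIV_unique
  unfolding has_functional_derivative_def pairing_weighted[symmetric] by blast

text \<open>Since \<open>J h\<close> is itself an admissible test triple, equality of
  \<open>Q\<close> products suffices to replace \<open>g\<close>; skewness transfers this to the
  second argument.\<close>

lemma Br_unique:
  assumes "has_functional_derivative P K F u g" "has_functional_derivative P K F u g'"
    "has_functional_derivative P K G u h" "has_functional_derivative P K G u h'"
  shows "Br g h = Br g' h'"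
proof -
  have mem: "g \<in> gradients K" "g' \<in> gradients K" "h \<in> gradients K" "h' \<in> gradients K"
    using assms by (auto simp: has_functional_derivative_def)
  have "Br g h = Br g' h"
    using functional_derivative_unique[OF assms(1,2)] mem by (simp add: Br_eq_Q_J J_gradients)
  moreover have "Br h g' = Br h' g'"
    using functional_derivative_unique[OF assms(3,4)] mem by (simp add: Br_eq_Q_J J_gradients)
  ultimately show ?thesis using mem by (simp add: Br_skew[of g'])
qed

text \<open>Curl and transport are moved from the first to the second argument; no derivative of the
  first argument remains.\<close>

lemma bracket_integrals:
  assumes "a \<in> A" "e \<in> E_fields K" "b \<in> B_fields K" "a' \<in> A" "e' \<in> E_fields K" "b' \<in> B_fields K"
  shows "space_int P (\<lambda>x. curl e x \<bullet> b' x - b x \<bullet> curl e' x)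
      + 1 / ((vth P)\<^sup>2 * eps P) *
          phase_int P (\<lambda>x v. (a x v * (e' x \<bullet> v) - (e x \<bullet> v) * a' x v) * f0 P x v)
      + 1 / 2 * (1 / ((alpha P)\<^sup>2 * (vth P)\<^sup>2)) *
          phase_int P (\<lambda>x v. f0 P x v *
            (v \<bullet> (a' x v *\<^sub>R grad_x a x v - a x v *\<^sub>R grad_x a' x v)
             + 1 / eps P * (force P x v \<bullet> (a' x v *\<^sub>R grad_v a x v - a x v *\<^sub>R grad_v a' x v))))
    = Br (a, e, b) (a', e', b')"
proof -
  let ?c = "1 / ((alpha P)\<^sup>2 * (vth P)\<^sup>2)"
  have diff: "phase_int P (\<lambda>x v. f0 P x v * p x v * q x v + - 1 * (f0 P x v * p' x v * q' x v)) = ip p q - ip p' q'"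
    if "p \<in> A" "q \<in> A" "p' \<in> A" "q' \<in> A" for p q p' q'
    unfolding phase_int_linear[OF ip_integrable[OF that(1,2)] ip_integrable[OF that(3,4)]] ip_def by simp
  have "space_int P (\<lambda>x. curl e x \<bullet> b' x - b x \<bullet> curl e' x)
      = space_int P (\<lambda>x. curl e x \<bullet> b' x + - 1 * (b x \<bullet> curl e' x))" by simp
  also have "\<dots> = sip (curl e) b' - sip b (curl e')"
    using assms
    by (subst space_int_linear) (auto intro!: sip_integrable[of "B_fields K"] curl_E simp: sip_def)
  finally have 1: "space_int P (\<lambda>x. curl e x \<bullet> b' x - b x \<bullet> curl e' x) = sip e (curl b') - sip b (curl e')"
    using sip_curl assms by simp
  have "phase_int P (\<lambda>x v. (a x v * (e' x \<bullet> v) - (e x \<bullet> v) * a' x v) * f0 P x v)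
      = phase_int P (\<lambda>x v. f0 P x v * a x v * (e' x \<bullet> v) + - 1 * (f0 P x v * (e x \<bullet> v) * a' x v))"
    by (intro phase_int_cong) (simp add: algebra_simps)
  also have "\<dots> = ip a (\<lambda>x v. e' x \<bullet> v) - ip (\<lambda>x v. e x \<bullet> v) a'"
    using assms by (intro diff A_field_velocity)
  finally have 2: "phase_int P (\<lambda>x v. (a x v * (e' x \<bullet> v) - (e x \<bullet> v) * a' x v) * f0 P x v)
      = ip a (\<lambda>x v. e' x \<bullet> v) - ip (\<lambda>x v. e x \<bullet> v) a'" .
  have "phase_int P (\<lambda>x v. f0 P x v *
            (v \<bullet> (a' x v *\<^sub>R grad_x a x v - a x v *\<^sub>R grad_x a' x v)
             + 1 / eps P * (force P x v \<bullet> (a' x v *\<^sub>R grad_v a x v - a x v *\<^sub>R grad_v a' x v))))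
      = phase_int P (\<lambda>x v. f0 P x v * a' x v * transport P a x v
            + - 1 * (f0 P x v * a x v * transport P a' x v))"
    unfolding transport_def inner_diff_right inner_scaleR_right
    by (intro phase_int_cong) (simp add: algebra_simps diff_divide_distrib)
  also have "\<dots> = ip a' (transport P a) - ip a (transport P a')"
    using assms by (intro diff A_transport)
  \<comment> \<open>Skewness merges the two antisymmetrized transport terms; the resulting 2 cancels
    the 1/2 of the bracket.\<close>
  also have "\<dots> = - 2 * ip a (transport P a')"
    using ip_transport[of a' a] ip_commute[of "transport P a'" a] assms by simp
  finally have 3: "phase_int P (\<lambda>x v. f0 P x v *
            (v \<bullet> (a' x v *\<^sub>R grad_x a x v - a x v *\<^sub>R grad_x a' x v)
             + 1 / eps P * (force P x v \<bullet> (a' x v *\<^sub>R grad_v a x v - a x v *\<^sub>R grad_v a' x v))))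
      = - 2 * ip a (transport P a')" .
  have "ip a (\<lambda>x v. \<kappa> * (e' x \<bullet> v) + - 1 / ((alpha P)\<^sup>2 * (vth P)\<^sup>2) * transport P a' x v)
      = ip a (\<lambda>x v. \<kappa> * (e' x \<bullet> v)) + - 1 / ((alpha P)\<^sup>2 * (vth P)\<^sup>2) * ip a (transport P a')"
    using assms by (intro ip_linear_right A_scale A_field_velocity A_transport)
  also have "ip a (\<lambda>x v. \<kappa> * (e' x \<bullet> v)) = \<kappa> * ip a (\<lambda>x v. e' x \<bullet> v)"
    using assms by (intro ip_scale_right A_field_velocity)
  finally show ?thesis
    unfolding 1 2 3 Br_def prod.case by (simp add: algebra_simps diff_divide_distrib)
qed

lemma bracket_eq_Br:
  assumes "has_functional_derivative P K F u g" "has_functional_derivative P K G u h"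
  shows "bracket P K F G u = Br g h"
proof -
  let ?F = "functional_derivative P K F u" and ?G = "functional_derivative P K G u"
  have F: "has_functional_derivative P K F u ?F" and G: "has_functional_derivative P K G u ?G"
    using assms unfolding functional_derivative_def by (auto intro: someI)
  have "?F \<in> gradients K" "?G \<in> gradients K"
    using F G by (auto simp: has_functional_derivative_def)
  then have "bracket P K F G u = Br ?F ?G"
  proof (elim gradients_cases)
    fix a e b a' e' b'
    assume F: "?F = (a, e, b)" "a \<in> A" "e \<in> E_fields K" "b \<in> B_fields K"
      and G: "?G = (a', e', b')" "a' \<in> A" "e' \<in> E_fields K" "b' \<in> B_fields K"
    show ?thesis
      unfolding bracket_def F G prod.case by (rule bracket_integrals) fact+
  qed
  also have "\<dots> = Br g h"
    by (rule Br_unique[OF F assms(1) G assms(2)])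
  finally show ?thesis .
qed

lemma has_functional_derivative_linear:
  assumes "has_functional_derivative P K F u g" "has_functional_derivative P K G u h"
  shows "has_functional_derivative P K (\<lambda>w. F w + c * G w) u (add_scaled g c h)"
proof -
  have mem: "g \<in> gradients K" "h \<in> gradients K"
    using assms by (auto simp: has_functional_derivative_def)
  have "pairing P (add_scaled g c h) w = pairing P g w + c * pairing P h w" if "w \<in> states P K" for w
    using that mem by (simp add: pairing_ratio states_def Q_linear_left)
  with assms mem show ?thesis
    unfolding has_functional_derivative_def
    by (auto simp: add_scaled_gradients intro!: DERIV_add DERIV_cmult)
qed

text \<open>The nested \<open>add_scaled\<close> is the triple \<open>F u * h + G u * g\<close> of
  the product rule.\<close>

lemma has_functional_derivative_product:
  assumes "has_functional_derivative P K F u g" "has_functional_derivative P K G u h"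
  shows "has_functional_derivative P K (\<lambda>w. F w * G w) u
    (add_scaled (add_scaled zero_fields (F u) h) (G u) g)"
proof -
  have mem: "g \<in> gradients K" "h \<in> gradients K"
    using assms by (auto simp: has_functional_derivative_def)
  have "((\<lambda>s. F (add_scaled u s w) * G (add_scaled u s w)) has_real_derivative
      pairing P (add_scaled (add_scaled zero_fields (F u) h) (G u) g) w) (at 0)"
    if w: "w \<in> states P K" for w
  proof -
    have "((\<lambda>s. F (add_scaled u s w) * G (add_scaled u s w)) has_real_derivative
        pairing P g w * G (add_scaled u 0 w) + pairing P h w * F (add_scaled u 0 w)) (at 0)"
      using assms w unfolding has_functional_derivative_def by (intro DERIV_mult) auto
    moreover have "pairing P (add_scaled (add_scaled zero_fields (F u) h) (G u) g) w
        = pairing P g w * G (add_scaled u 0 w) + pairing P h w * F (add_scaled u 0 w)"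
      using w mem
      by (simp add: pairing_ratio states_def Q_linear_left Q_zero_left add_scaled_gradients zero_gradients)
    ultimately show ?thesis by simp
  qed
  with mem show ?thesis
    unfolding has_functional_derivative_def by (auto intro!: add_scaled_gradients zero_gradients)
qed

lemma bracket_algebra:
  assumes F: "F \<in> functionals P K" and G: "G \<in> functionals P K" and M: "M \<in> functionals P K"
    and u: "u \<in> states P K"
  shows "bracket P K (\<lambda>w. F w + c * G w) M u = bracket P K F M u + c * bracket P K G M u"
    and "bracket P K M (\<lambda>w. F w + c * G w) u = bracket P K M F u + c * bracket P K M G u"
    and "bracket P K F G u = - bracket P K G F u"
    and "bracket P K (\<lambda>w. F w * G w) M u = F u * bracket P K G M u + bracket P K F M u * G u"
proof -
  obtain f g m where d: "has_functional_derivative P K F u f" "has_functional_derivative P K G u g"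
    "has_functional_derivative P K M u m"
    using assms unfolding functionals_def by blast
  have mem: "f \<in> gradients K" "g \<in> gradients K" "m \<in> gradients K"
    using d by (auto simp: has_functional_derivative_def)
  note lin = has_functional_derivative_linear[OF d(1,2), of c]
  note prd = has_functional_derivative_product[OF d(1,2)]
  show "bracket P K (\<lambda>w. F w + c * G w) M u = bracket P K F M u + c * bracket P K G M u"
    using mem by (simp add: bracket_eq_Br[OF lin d(3)] bracket_eq_Br[OF d(1,3)] bracket_eq_Br[OF d(2,3)]
        Br_linear_left)
  show "bracket P K M (\<lambda>w. F w + c * G w) u = bracket P K M F u + c * bracket P K M G u"
    using mem by (simp add: bracket_eq_Br[OF d(3) lin] bracket_eq_Br[OF d(3,1)] bracket_eq_Br[OF d(3,2)]
        Br_linear_right)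
  show "bracket P K F G u = - bracket P K G F u"
    unfolding bracket_eq_Br[OF d(1,2)] bracket_eq_Br[OF d(2,1)] by (rule Br_skew) fact+
  have "bracket P K (\<lambda>w. F w * G w) M u
      = - Br m (add_scaled (add_scaled zero_fields (F u) g) (G u) f)"
    unfolding bracket_eq_Br[OF prd d(3)] using mem
    by (intro Br_skew add_scaled_gradients zero_gradients)
  also have "\<dots> = F u * Br g m + Br f m * G u"
    using mem by (simp add: Br_linear_right Br_scale_right add_scaled_gradients zero_gradients
        Br_skew[of m f] Br_skew[of m g] Br_zero_right)
  finally show "bracket P K (\<lambda>w. F w * G w) M u = F u * bracket P K G M u + bracket P K F M u * G u"
    by (simp add: bracket_eq_Br[OF d(1,3)] bracket_eq_Br[OF d(2,3)])
qed

end

subsection \<open>Derivatives along curves\<close>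

text \<open>The proposed velocity is already subtracted: this is the remainder that
  \<open>has_velocity\<close> requires to vanish, so that \<open>g s\<close> equals
  \<open>g 0\<close> plus \<open>s\<close> times the velocity plus \<open>s\<close> times this
  triple.\<close>

definition difference_quotient :: "(real \<Rightarrow> fields) \<Rightarrow> fields \<Rightarrow> real \<Rightarrow> fields" where
  "difference_quotient g g' s =
     (\<lambda>x v. (fst (g s) x v - fst (g 0) x v) / s - fst g' x v,
      \<lambda>x. (fst (snd (g s)) x - fst (snd (g 0)) x) /\<^sub>R s - fst (snd g') x,
      \<lambda>x. (snd (snd (g s)) x - snd (snd (g 0)) x) /\<^sub>R s - snd (snd g') x)"

lemma difference_quotient_expand:
  assumes "s \<noteq> 0"
  shows "g s = add_scaled (add_scaled (g 0) s g') s (difference_quotient g g' s)"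
proof -
  have "z + s *\<^sub>R y + s *\<^sub>R ((x - z) /\<^sub>R s - y) = x" for x y z :: R3
    using assms by (simp add: scaleR_diff_right)
  moreover have "z + s * y + s * ((x - z) / s - y) = x" for x y z :: real
    using assms by (simp add: field_simps)
  ultimately show ?thesis
    by (cases "g s"; cases "g 0"; cases g') (simp add: difference_quotient_def)
qed

text \<open>Written with \<open>add_scaled\<close> alone, the remainder is seen to stay in
  \<open>gradients K\<close>.\<close>

lemma difference_quotient_eq:
  "difference_quotient g g' s
    = add_scaled (add_scaled zero_fields (1 / s) (add_scaled (g s) (- 1) (g 0))) (- 1) g'"
  by (cases "g s"; cases "g 0"; cases g')
    (simp add: difference_quotient_def zero_fields_def divide_inverse mult.commute)

context vlasov_maxwell
begin

abbreviation "weight \<equiv> \<lambda>z. f0 P (fst z) (snd z)"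
abbreviation "one \<equiv> \<lambda>_ :: R3. 1 :: real"

definition vanishing_fields :: "(real \<Rightarrow> fields) \<Rightarrow> bool" where
  "vanishing_fields r \<longleftrightarrow> (\<forall>\<^sub>F s in at 0. r s \<in> gradients K) \<and>
     vanishing Z (case_prod ` A) (\<lambda>s. case_prod (fst (r s))) \<and>
     vanishing (Omega P) (E_fields K) (\<lambda>s. fst (snd (r s))) \<and>
     vanishing (Omega P) (B_fields K) (\<lambda>s. snd (snd (r s)))"

text \<open>Families with fixed square integrable majorants. The field dotted with velocity has its
  own clause because the coupling term of \<open>Br\<close> pairs it with the phase
  component.\<close>

definition tame :: "(real \<Rightarrow> fields) \<Rightarrow> bool" where
  "tame g \<longleftrightarrow> (\<forall>\<^sub>F s in at 0. g s \<in> gradients K) \<and>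
     dominated Z weight (\<lambda>_. 1) (\<lambda>s. case_prod (fst (g s))) \<and>
     dominated Z weight (\<lambda>_. 1) (\<lambda>s z. fst (snd (g s)) (fst z) \<bullet> snd z) \<and>
     dominated (Omega P) one (\<lambda>_. 1) (\<lambda>s. fst (snd (g s))) \<and>
     dominated (Omega P) one (\<lambda>_. 1) (\<lambda>s. snd (snd (g s)))"

lemma weight_nonneg: "z \<in> Z \<Longrightarrow> weight z \<ge> 0"
  by (auto intro: less_imp_le[OF f0_pos])

lemma ip_eq: "ip a a' = (LINT z:Z|lborel. weight z * (case_prod a z \<bullet> case_prod a' z))"
  by (simp add: ip_def phase_int_def case_prod_unfold mult.assoc)

lemma sip_eq: "sip e e' = (LINT x:Omega P|lborel. 1 * (e x \<bullet> e' x))"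
  by (simp add: sip_def space_int_def)

lemma ip_set_integrable:
  "a \<in> A \<Longrightarrow> a' \<in> A \<Longrightarrow> set_integrable lborel Z (\<lambda>z. weight z * (case_prod a z \<bullet> case_prod a' z))"
  using ip_integrable by (simp add: phase_integrable_def case_prod_unfold mult.assoc)

lemma sip_set_integrable:
  "is_field_class V \<Longrightarrow> e \<in> V \<Longrightarrow> e' \<in> V \<Longrightarrow> set_integrable lborel (Omega P) (\<lambda>x. 1 * (e x \<bullet> e' x))"
  using sip_integrable by (simp add: space_integrable_def)

lemma A_sq_int:
  assumes "(\<lambda>x v. p x v * a x v) \<in> A"
  shows "sq_int Z weight (\<lambda>z. p (fst z) (snd z) * norm (case_prod a z))"
  using ip_set_integrable[OF assms assms]
  by (simp add: sq_int_def case_prod_unfold power_mult_distrib power2_eq_square[symmetric])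

text \<open>The squared product of norms is the sum of all \<open>(v $ i * e x $ j)\<^sup>2\<close>,
  and each factor \<open>v $ i * e x $ j\<close> belongs to the phase class.\<close>

lemma field_velocity_sq_int:
  assumes "e \<in> E_fields K"
  shows "sq_int Z weight (\<lambda>z. norm (snd z) * norm (e (fst z)))"
proof -
  have "set_integrable lborel Z (\<lambda>z. weight z * (snd z $ i * e (fst z) $ j)\<^sup>2)" for i j
    using ip_set_integrable[OF A_velocity[OF A_field] A_velocity[OF A_field], OF assms assms, of i j i j]
    by (simp add: case_prod_unfold power2_eq_square)
  then have "integrable lborel (\<lambda>z. \<Sum>i\<in>UNIV. \<Sum>j\<in>UNIV.
      indicat_real Z z *\<^sub>R (weight z * (snd z $ i * e (fst z) $ j)\<^sup>2))"
    unfolding set_integrable_def by (intro Bochner_Integration.integrable_sum)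
  moreover have "(norm v * norm y)\<^sup>2 = (\<Sum>i\<in>UNIV. \<Sum>j\<in>UNIV. (v $ i * y $ j)\<^sup>2)" for v y :: R3
    unfolding power_mult_distrib power2_norm_eq_inner inner_vec_def inner_real_def sum_product
    by (simp add: power2_eq_square)
  ultimately show ?thesis
    by (simp add: sq_int_def set_integrable_def sum_distrib_left)
qed

lemma small_phase:
  assumes r: "vanishing Z (case_prod ` A) (\<lambda>s. case_prod (r s))"
    and p: "\<And>a. a \<in> A \<Longrightarrow> (\<lambda>x v. p x v * a x v) \<in> A"
  shows "small Z weight (\<lambda>s z. p (fst z) (snd z) *\<^sub>R iterated_derivative ds (case_prod (r s)) z)"
proof (rule vanishing_small[OF weight_nonneg r])
  fix M assume "M \<in> case_prod ` A"
  then show "sq_int Z weight (\<lambda>z. p (fst z) (snd z) * norm (M z))"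
    using A_sq_int p by blast
qed auto

lemma small_phase_value:
  assumes "vanishing Z (case_prod ` A) (\<lambda>s. case_prod (r s))"
  shows "small Z weight (\<lambda>s. case_prod (r s))"
  using small_phase[OF assms, of "\<lambda>x v. 1" "[]"] by (simp add: iterated_derivative_def)

text \<open>Transport is a combination of first derivatives with velocity and force coefficients;
  \<open>vanishing\<close> controls the derivatives, and the coefficients preserve the phase class
  of majorants.\<close>

lemma small_transport:
  assumes r: "vanishing Z (case_prod ` A) (\<lambda>s. case_prod (r s))"
    and ev: "\<forall>\<^sub>F s in at 0. r s \<in> A"
  shows "small Z weight (\<lambda>s. case_prod (transport P (r s)))"
proof -
  let ?T = "\<lambda>s z. (\<Sum>i\<in>UNIV. snd z $ i *\<^sub>R iterated_derivative [(axis i 1, 0)] (case_prod (r s)) z)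
    + (1 / eps P) *\<^sub>R (\<Sum>i\<in>UNIV. force P (fst z) (snd z) $ i *\<^sub>R
        iterated_derivative [(0, axis i 1)] (case_prod (r s)) z)"
  have "small Z weight ?T"
    by (intro small_add small_scale small_sum weight_nonneg finite
        small_phase[OF r, of "\<lambda>x v. v $ i" for i] small_phase[OF r, of "\<lambda>x v. force P x v $ i" for i]
        A_velocity A_force)
  moreover have "\<forall>\<^sub>F s in at 0. \<forall>z\<in>Z. norm (case_prod (transport P (r s)) z) \<le> norm (?T s z)"
    using ev
  proof eventually_elim
    case (elim s)
    have "case_prod (transport P (r s)) z = ?T s z" if "z \<in> Z" for z
      using that grad_x_nth[OF A_differentiable[OF elim]] grad_v_nth[OF A_differentiable[OF elim]]
      by (auto simp: transport_eq iterated_derivative_def)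
    then show ?case by simp
  qed
  ultimately show ?thesis by (rule small_mono)
qed

lemma small_field:
  assumes V: "is_field_class V" and r: "vanishing (Omega P) V r"
  shows "small (Omega P) one (\<lambda>s x. iterated_derivative ds (r s) x)"
proof -
  have "small (Omega P) one (\<lambda>s x. 1 *\<^sub>R iterated_derivative ds (r s) x)"
  proof (rule vanishing_small[OF _ r])
    fix M assume "M \<in> V"
    then show "sq_int (Omega P) one (\<lambda>x. 1 * norm (M x))"
      using sq_int_norm[OF sip_set_integrable[OF V]] by simp
  qed auto
  then show ?thesis by simp
qed

lemma small_field_value:
  "is_field_class V \<Longrightarrow> vanishing (Omega P) V r \<Longrightarrow> small (Omega P) one r"
  using small_field[of V r "[]"] by (simp add: iterated_derivative_def)

lemma small_curl:
  assumes V: "is_field_class V" and r: "vanishing (Omega P) V r"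
    and ev: "\<forall>\<^sub>F s in at 0. r s \<in> V"
  shows "small (Omega P) one (\<lambda>s. curl (r s))"
proof -
  let ?T = "\<lambda>s x. \<Sum>i\<in>UNIV. norm (iterated_derivative [axis i 1] (r s) x)"
  have "small (Omega P) one (\<lambda>s x. norm (iterated_derivative [axis i 1] (r s) x))" for i
    using small_field[OF V r, of "[axis i 1]"] by (rule small_mono) simp
  then have "small (Omega P) one ?T"
    by (intro small_sum) auto
  moreover have "\<forall>\<^sub>F s in at 0. \<forall>x\<in>Omega P. norm (curl (r s) x) \<le> norm (?T s x)"
    using ev
  proof eventually_elim
    case (elim s)
    show ?case
      using norm_curl_le[OF field_differentiable[OF V elim]]
      by (auto simp: iterated_derivative_def sum_nonneg)
  qed
  ultimately show ?thesis by (rule small_mono)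
qed

lemma small_field_velocity:
  assumes r: "vanishing (Omega P) (E_fields K) r"
  shows "small Z weight (\<lambda>s z. r s (fst z) \<bullet> snd z)"
proof -
  have "small Z weight (\<lambda>s z. norm (snd z) *\<^sub>R iterated_derivative [] (r s) (fst z))"
    by (rule vanishing_small[OF weight_nonneg r]) (auto intro: field_velocity_sq_int)
  then show ?thesis
  proof (rule small_mono)
    have "\<bar>y \<bullet> v\<bar> \<le> norm v * norm y" for y v :: R3
      using Cauchy_Schwarz_ineq2[of y v] by (simp add: mult.commute)
    then show "\<forall>\<^sub>F s in at 0. \<forall>z\<in>Z. norm (r s (fst z) \<bullet> snd z)
        \<le> norm (norm (snd z) *\<^sub>R iterated_derivative [] (r s) (fst z))"
      by (simp add: iterated_derivative_def)
  qed
qed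

lemma tame_const:
  assumes "g \<in> gradients K"
  shows "tame (\<lambda>_. g)"
  using assms
proof (elim gradients_cases)
  fix a e b assume g: "g = (a, e, b)" "a \<in> A" "e \<in> E_fields K" "b \<in> B_fields K"
  have "dominated Z weight (\<lambda>_. 1) (\<lambda>_ :: real. case_prod (\<lambda>x v. e x \<bullet> v))"
    by (intro dominated_const ip_set_integrable A_field_velocity g)
  moreover have "dominated Z weight (\<lambda>_. 1) (\<lambda>_ :: real. case_prod a)"
    by (intro dominated_const ip_set_integrable g)
  moreover have "dominated (Omega P) one (\<lambda>_. 1) (\<lambda>_ :: real. e)"
    by (intro dominated_const sip_set_integrable[OF is_field_class(1)] g)
  moreover have "dominated (Omega P) one (\<lambda>_. 1) (\<lambda>_ :: real. b)"
    by (intro dominated_const sip_set_integrable[OF is_field_class(2)] g)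
  ultimately show ?thesis
    using g by (simp add: tame_def case_prod_unfold)
qed

lemma tame_vanishing:
  assumes "vanishing_fields r"
  shows "tame r"
proof -
  have v: "vanishing Z (case_prod ` A) (\<lambda>s. case_prod (fst (r s)))"
    "vanishing (Omega P) (E_fields K) (\<lambda>s. fst (snd (r s)))"
    "vanishing (Omega P) (B_fields K) (\<lambda>s. snd (snd (r s)))"
    using assms by (simp_all add: vanishing_fields_def)
  show ?thesis
    using assms small_imp_dominated[OF small_phase_value[OF v(1)]]
      small_imp_dominated[OF small_field_velocity[OF v(2)]]
      small_imp_dominated[OF small_field_value[OF is_field_class(1) v(2)]]
      small_imp_dominated[OF small_field_value[OF is_field_class(2) v(3)]]
    by (simp add: tame_def vanishing_fields_def)
qed

lemma ip_tendsto_zero: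
  assumes "small Z weight (\<lambda>s. case_prod (r s))" "dominated Z weight (\<lambda>_. 1) (\<lambda>s. case_prod (q s))"
    and "\<forall>\<^sub>F s in at 0. r s \<in> A" "\<forall>\<^sub>F s in at 0. q s \<in> A"
  shows "((\<lambda>s. ip (r s) (q s)) \<longlongrightarrow> 0) (at 0)"
  unfolding ip_eq
proof (rule small_dominated_integral[OF weight_nonneg assms(1,2)])
  show "\<forall>\<^sub>F s in at 0. set_integrable lborel Z (\<lambda>z. weight z * (case_prod (r s) z \<bullet> case_prod (q s) z))"
    using assms(3,4) by eventually_elim (rule ip_set_integrable)
qed

lemma sip_tendsto_zero:
  assumes V: "is_field_class V"
    and "small (Omega P) one r" "dominated (Omega P) one (\<lambda>_. 1) q"
    and "\<forall>\<^sub>F s in at 0. r s \<in> V" "\<forall>\<^sub>F s in at 0. q s \<in> V"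
  shows "((\<lambda>s. sip (r s) (q s)) \<longlongrightarrow> 0) (at 0)"
  unfolding sip_eq
proof (rule small_dominated_integral[OF _ assms(2,3)])
  show "\<forall>\<^sub>F s in at 0. set_integrable lborel (Omega P) (\<lambda>z. 1 * (r s z \<bullet> q s z))"
    using assms(4,5) by eventually_elim (rule sip_set_integrable[OF V])
qed simp

text \<open>Every term of \<open>Q\<close> and of \<open>Br\<close> pairs a small family with a
  dominated one. In \<open>Br\<close> the derivatives all fall on \<open>r\<close>, where
  \<open>vanishing\<close> controls them.\<close>

lemma
  assumes g: "tame g" and r: "vanishing_fields r"
  shows Q_tendsto_zero: "((\<lambda>s. Q (r s) (g s)) \<longlongrightarrow> 0) (at 0)"
    and Br_tendsto_zero: "((\<lambda>s. Br (g s) (r s)) \<longlongrightarrow> 0) (at 0)"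
proof -
  obtain ga ge gb where g_eq: "g = (\<lambda>s. (ga s, ge s, gb s))"
    using that[of "\<lambda>s. fst (g s)" "\<lambda>s. fst (snd (g s))" "\<lambda>s. snd (snd (g s))"] by simp
  obtain ra re rb where r_eq: "r = (\<lambda>s. (ra s, re s, rb s))"
    using that[of "\<lambda>s. fst (r s)" "\<lambda>s. fst (snd (r s))" "\<lambda>s. snd (snd (r s))"] by simp
  have ev: "\<forall>\<^sub>F s in at 0. ga s \<in> A" "\<forall>\<^sub>F s in at 0. ge s \<in> E_fields K" "\<forall>\<^sub>F s in at 0. gb s \<in> B_fields K"
    "\<forall>\<^sub>F s in at 0. ra s \<in> A" "\<forall>\<^sub>F s in at 0. re s \<in> E_fields K" "\<forall>\<^sub>F s in at 0. rb s \<in> B_fields K"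
    using g r by (auto simp: tame_def vanishing_fields_def g_eq r_eq eventually_conj_iff)
  have v: "vanishing Z (case_prod ` A) (\<lambda>s. case_prod (ra s))"
    "vanishing (Omega P) (E_fields K) re" "vanishing (Omega P) (B_fields K) rb"
    using r by (simp_all add: vanishing_fields_def r_eq)
  have d: "dominated Z weight (\<lambda>_. 1) (\<lambda>s. case_prod (ga s))"
    "dominated Z weight (\<lambda>_. 1) (\<lambda>s. case_prod (\<lambda>x v. ge s x \<bullet> v))"
    "dominated (Omega P) one (\<lambda>_. 1) ge" "dominated (Omega P) one (\<lambda>_. 1) gb"
    using g by (simp_all add: tame_def g_eq case_prod_unfold)
  have 11: "((\<lambda>s. ip (ra s) (ga s)) \<longlongrightarrow> 0) (at 0)"
    by (rule ip_tendsto_zero[OF small_phase_value[OF v(1)] d(1) ev(4,1)])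
  have 12: "((\<lambda>s. sip (re s) (ge s)) \<longlongrightarrow> 0) (at 0)"
    by (rule sip_tendsto_zero[OF is_field_class(1) small_field_value[OF is_field_class(1) v(2)] d(3) ev(5,2)])
  have 13: "((\<lambda>s. sip (rb s) (gb s)) \<longlongrightarrow> 0) (at 0)"
    by (rule sip_tendsto_zero[OF is_field_class(2) small_field_value[OF is_field_class(2) v(3)] d(4) ev(6,3)])
  show "((\<lambda>s. Q (r s) (g s)) \<longlongrightarrow> 0) (at 0)"
    unfolding g_eq r_eq Q_def prod.case using tendsto_add[OF tendsto_add[OF 11 12] 13] by simp
  let ?h = "\<lambda>s x v. \<kappa> * (re s x \<bullet> v) + - 1 / ((alpha P)\<^sup>2 * (vth P)\<^sup>2) * transport P (ra s) x v"
  have "small Z weight (\<lambda>s z. \<kappa> *\<^sub>R (re s (fst z) \<bullet> snd z)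
      + (- 1 / ((alpha P)\<^sup>2 * (vth P)\<^sup>2)) *\<^sub>R case_prod (transport P (ra s)) z)"
    by (intro small_add small_scale small_field_velocity small_transport weight_nonneg v ev)
  then have h: "small Z weight (\<lambda>s. case_prod (?h s))"
    by (simp add: case_prod_unfold)
  have evh: "\<forall>\<^sub>F s in at 0. ?h s \<in> A"
    using ev(4,5) by eventually_elim (intro A_linear A_scale A_field_velocity A_transport)
  have evv: "\<forall>\<^sub>F s in at 0. (\<lambda>x v. ge s x \<bullet> v) \<in> A"
    using ev(2) by eventually_elim (rule A_field_velocity)
  have evB: "\<forall>\<^sub>F s in at 0. curl (rb s) \<in> E_fields K" and evE: "\<forall>\<^sub>F s in at 0. curl (re s) \<in> B_fields K"
    using eventually_mono[OF ev(6) curl_B] eventually_mono[OF ev(5) curl_E] by simp_all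
  have 1: "((\<lambda>s. ip (?h s) (ga s)) \<longlongrightarrow> 0) (at 0)"
    by (rule ip_tendsto_zero[OF h d(1) evh ev(1)])
  have 2: "((\<lambda>s. sip (curl (rb s)) (ge s)) \<longlongrightarrow> 0) (at 0)"
    by (rule sip_tendsto_zero[OF is_field_class(1) small_curl[OF is_field_class(2) v(3) ev(6)] d(3) evB ev(2)])
  \<comment> \<open>Here the tame field is multiplied by velocity, which the extra clause of
    \<open>tame\<close> provides for.\<close>
  have 3: "((\<lambda>s. ip (ra s) (\<lambda>x v. ge s x \<bullet> v)) \<longlongrightarrow> 0) (at 0)"
    by (rule ip_tendsto_zero[OF small_phase_value[OF v(1)] d(2) ev(4) evv])
  have 4: "((\<lambda>s. sip (curl (re s)) (gb s)) \<longlongrightarrow> 0) (at 0)"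
    by (rule sip_tendsto_zero[OF is_field_class(2) small_curl[OF is_field_class(1) v(2) ev(5)] d(4) evE ev(3)])
  have "((\<lambda>s. ip (?h s) (ga s) + sip (curl (rb s)) (ge s) - \<kappa> * ip (ra s) (\<lambda>x v. ge s x \<bullet> v)
      - sip (curl (re s)) (gb s)) \<longlongrightarrow> 0 + 0 - \<kappa> * 0 - 0) (at 0)"
    by (intro tendsto_intros 1 2 3 4)
  then show "((\<lambda>s. Br (g s) (r s)) \<longlongrightarrow> 0) (at 0)"
    unfolding g_eq r_eq Br_def prod.case
    by (simp add: ip_commute sip_commute)
qed

definition gradient_curve :: "(real \<Rightarrow> fields) \<Rightarrow> fields \<Rightarrow> bool" where
  "gradient_curve g g' \<longleftrightarrow> g 0 \<in> gradients K \<and> (\<forall>\<^sub>F s in at 0. g s \<in> gradients K) \<and>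
     g' \<in> gradients K \<and> has_velocity P K g g'"

lemma gradient_curve_vanishing:
  assumes "gradient_curve g g'"
  shows "vanishing_fields (difference_quotient g g')"
proof -
  have "\<forall>\<^sub>F s in at 0. difference_quotient g g' s \<in> gradients K"
    using assms unfolding gradient_curve_def difference_quotient_eq
    by (auto elim!: eventually_mono intro!: add_scaled_gradients zero_gradients)
  then show ?thesis
    using assms unfolding gradient_curve_def has_velocity_def vanishing_fields_def
    by (simp add: difference_quotient_def)
qed

text \<open>Bilinearity with just enough continuity for a product rule along curves, stated
  abstractly to cover both \<open>Q\<close> and \<open>Br\<close>.\<close>

definition admissible_form :: "(fields \<Rightarrow> fields \<Rightarrow> real) \<Rightarrow> bool" where
  "admissible_form \<Phi> \<longleftrightarrow>
     (\<forall>g\<in>gradients K. \<forall>h\<in>gradients K. \<forall>h'\<in>gradients K. \<forall>c.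
        \<Phi> g (add_scaled h c h') = \<Phi> g h + c * \<Phi> g h' \<and>
        \<Phi> (add_scaled h c h') g = \<Phi> h g + c * \<Phi> h' g) \<and>
     (\<forall>g r. tame g \<longrightarrow> vanishing_fields r \<longrightarrow>
        ((\<lambda>s. \<Phi> (g s) (r s)) \<longlongrightarrow> 0) (at 0) \<and> ((\<lambda>s. \<Phi> (r s) (g s)) \<longlongrightarrow> 0) (at 0))"

lemma admissible_Q: "admissible_form Q"
  unfolding admissible_form_def
  using Q_tendsto_zero by (simp add: Q_linear_left Q_linear_right Q_commute)

lemma admissible_Br: "admissible_form Br"
proof -
  \<comment> \<open>The estimates for \<open>Br\<close> have the vanishing family in the second
    slot; skewness handles the other order.\<close>
  have "((\<lambda>s. Br (r s) (g s)) \<longlongrightarrow> 0) (at 0)" if g: "tame g" and r: "vanishing_fields r" for g r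
  proof (rule Lim_transform_eventually)
    show "((\<lambda>s. - Br (g s) (r s)) \<longlongrightarrow> 0) (at 0)"
      using tendsto_minus[OF Br_tendsto_zero[OF that]] by simp
    have "\<forall>\<^sub>F s in at 0. g s \<in> gradients K" "\<forall>\<^sub>F s in at 0. r s \<in> gradients K"
      using g r by (simp_all add: tame_def vanishing_fields_def)
    then show "\<forall>\<^sub>F s in at 0. - Br (g s) (r s) = Br (r s) (g s)"
    proof eventually_elim
      case (elim s)
      then show ?case using Br_skew[of "g s" "r s"] by simp
    qed
  qed
  then show ?thesis
    unfolding admissible_form_def
    by (intro conjI ballI allI impI) (rule Br_linear_right Br_linear_left Br_tendsto_zero; assumption | blast)+
qed

text \<open>Product rule for bilinear forms, from the first-order expansions of both curves.\<close>

lemma form_curve_derivative: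
  assumes \<Phi>: "admissible_form \<Phi>" and g: "gradient_curve g g'" and h: "gradient_curve h h'"
  shows "((\<lambda>s. \<Phi> (g s) (h s)) has_real_derivative \<Phi> g' (h 0) + \<Phi> (g 0) h') (at 0)"
proof -
  define r q where "r = difference_quotient g g'" and "q = difference_quotient h h'"
  have r: "vanishing_fields r" and q: "vanishing_fields q"
    unfolding r_def q_def using g h gradient_curve_vanishing by blast+
  have mem: "g 0 \<in> gradients K" "h 0 \<in> gradients K" "g' \<in> gradients K" "h' \<in> gradients K"
    using g h by (simp_all add: gradient_curve_def)
  have linear: "\<Phi> g (add_scaled h c h') = \<Phi> g h + c * \<Phi> g h'"
    "\<Phi> (add_scaled h c h') g = \<Phi> h g + c * \<Phi> h' g"
    if "g \<in> gradients K" "h \<in> gradients K" "h' \<in> gradients K" for g h h' c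
    using \<Phi> that by (simp_all add: admissible_form_def)
  have lim: "((\<lambda>s. \<Phi> (g s) (r s)) \<longlongrightarrow> 0) (at 0)" "((\<lambda>s. \<Phi> (r s) (g s)) \<longlongrightarrow> 0) (at 0)"
    if "tame g" "vanishing_fields r" for g r
    using \<Phi> that by (simp_all add: admissible_form_def)
  \<comment> \<open>The difference quotient of the form, expanded bilinearly. Vanishing families are
    tame, so even the term with both remainders tends to 0.\<close>
  let ?D = "\<lambda>s. \<Phi> g' (h 0) + \<Phi> (g 0) h' + \<Phi> (g 0) (q s) + \<Phi> (r s) (h 0)
    + s * (\<Phi> g' h' + \<Phi> g' (q s) + \<Phi> (r s) h' + \<Phi> (r s) (q s))"
  have "(?D \<longlongrightarrow> \<Phi> g' (h 0) + \<Phi> (g 0) h' + 0 + 0 + 0 * (\<Phi> g' h' + 0 + 0 + 0)) (at 0)"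
    by (intro tendsto_intros lim tame_const tame_vanishing mem r q)
  moreover have "\<forall>\<^sub>F s in at 0. ?D s = (\<Phi> (g s) (h s) - \<Phi> (g 0) (h 0)) / (s - 0)"
  proof -
    have "\<forall>\<^sub>F s in at 0. r s \<in> gradients K" "\<forall>\<^sub>F s in at 0. q s \<in> gradients K"
      using r q by (simp_all add: vanishing_fields_def)
    then show ?thesis
      using eventually_neq_at_within[of "0::real" 0 UNIV]
    proof eventually_elim
      case (elim s)
      then have s: "s \<noteq> 0" by simp
      have gs: "g s = add_scaled (add_scaled (g 0) s g') s (r s)"
        and hs: "h s = add_scaled (add_scaled (h 0) s h') s (q s)"
        using difference_quotient_expand[OF s] unfolding r_def q_def by blast+
      have "\<Phi> (g s) (h s) - \<Phi> (g 0) (h 0) = s * ?D s"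
        unfolding gs hs using elim mem
        by (simp add: linear add_scaled_gradients) (simp add: algebra_simps)
      with s show ?case by simp
    qed
  qed
  ultimately show ?thesis
    unfolding has_field_derivative_iff by (simp add: Lim_transform_eventually)
qed

lemma vanishing_zero:
  assumes "\<forall>\<^sub>F s in at 0. r s = (\<lambda>_. 0)"
  shows "vanishing S C r"
proof -
  have "\<forall>\<^sub>F s in at 0. \<forall>z\<in>S. norm (iterated_derivative ds (r s) z) \<le> 0 * (\<Sum>M\<leftarrow>[]. norm (M z))"
    for ds and M :: "'a \<Rightarrow> 'b"
    using assms by eventually_elim (simp add: iterated_derivative_zero)
  then show ?thesis
    unfolding vanishing_def by (intro allI exI[of _ "[]"] exI[of _ "\<lambda>_. 0"]) auto
qed

lemma difference_quotient_zero_velocity: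
  assumes "\<And>s. s \<noteq> 0 \<Longrightarrow> difference_quotient g g' s = zero_fields"
  shows "has_velocity P K g g'"
proof -
  have ev: "\<forall>\<^sub>F s in at 0. difference_quotient g g' s = zero_fields"
    using assms by (auto simp: eventually_at_filter)
  have "\<forall>\<^sub>F s in at 0. (\<lambda>(x, v). (fst (g s) x v - fst (g 0) x v) / s - fst g' x v) = (\<lambda>_. 0)"
    "\<forall>\<^sub>F s in at 0. (\<lambda>x. (fst (snd (g s)) x - fst (snd (g 0)) x) /\<^sub>R s - fst (snd g') x) = (\<lambda>_. 0)"
    "\<forall>\<^sub>F s in at 0. (\<lambda>x. (snd (snd (g s)) x - snd (snd (g 0)) x) /\<^sub>R s - snd (snd g') x) = (\<lambda>_. 0)"
    using ev by (auto elim!: eventually_mono simp: difference_quotient_def zero_fields_def fun_eq_iff)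
  then show ?thesis
    unfolding has_velocity_def by (intro conjI vanishing_zero)
qed

lemma gradient_curve_const: "g \<in> gradients K \<Longrightarrow> gradient_curve (\<lambda>_. g) zero_fields"
  unfolding gradient_curve_def
  by (auto intro!: difference_quotient_zero_velocity zero_gradients
      A_zero field_zero simp: difference_quotient_def zero_fields_def)

text \<open>On a line the remainder is identically 0, so the chain rule along curves contains the
  directional derivatives that define functional derivatives.\<close>

lemma state_curve_line:
  assumes "u \<in> states P K" "w \<in> states P K"
  shows "state_curve P K (\<lambda>s. add_scaled u s w) u w"
proof -
  have "difference_quotient (\<lambda>s. ratio P (add_scaled u s w)) (ratio P w) s = zero_fields" if "s \<noteq> 0" for s
    using that by (cases u; cases w)
      (simp add: difference_quotient_def zero_fields_def fun_eq_iff add_divide_distrib)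
  then have "has_velocity P K (\<lambda>s. ratio P (add_scaled u s w)) (ratio P w)"
    by (rule difference_quotient_zero_velocity)
  with assms show ?thesis
    by (simp add: state_curve_def add_scaled_states)
qed

lemma state_curve_gradient_curve:
  assumes "state_curve P K c u w" "u \<in> states P K"
  shows "gradient_curve (\<lambda>s. ratio P (c s)) (ratio P w)"
  using assms unfolding state_curve_def gradient_curve_def states_def
  by (auto simp: eventually_nhds_conv_at)

section \<open>Second functional derivatives and the Jacobi identity\<close>

definition twice_differentiable :: "functional \<Rightarrow> (fields \<Rightarrow> fields) \<Rightarrow> (fields \<Rightarrow> fields \<Rightarrow> fields) \<Rightarrow> bool" where
  "twice_differentiable F dF L \<longleftrightarrow> (\<forall>u\<in>states P K. has_functional_derivative P K F u (dF u) \<and>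
     (\<forall>w\<in>states P K. L u w \<in> gradients K) \<and>
     (\<forall>w\<in>states P K. \<forall>w'\<in>states P K. pairing P (L u w) w' = pairing P (L u w') w) \<and>
     (\<forall>c w. state_curve P K c u w \<longrightarrow>
        ((\<lambda>s. F (c s)) has_real_derivative pairing P (dF u) w) (at 0) \<and>
        gradient_curve (\<lambda>s. dF (c s)) (L u w)))"

text \<open>The chain rule applied to lines identifies \<open>dF\<close> as a functional derivative;
  along a curve of states \<open>dF\<close> stays in \<open>gradients K\<close>, so its velocity
  makes it a gradient curve.\<close>

lemma smooth_functional_cases:
  assumes "F \<in> smooth_functionals P K"
  obtains dF L where "twice_differentiable F dF L"
proof -
  obtain dF L where *: "\<forall>u\<in>states P K. dF u \<in> gradients K \<and>
     (\<forall>w\<in>states P K. L u w \<in> gradients K) \<and>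
     (\<forall>w\<in>states P K. \<forall>w'\<in>states P K. pairing P (L u w) w' = pairing P (L u w') w) \<and>
     (\<forall>c w. state_curve P K c u w \<longrightarrow>
        ((\<lambda>s. F (c s)) has_real_derivative pairing P (dF u) w) (at 0) \<and>
        has_velocity P K (\<lambda>s. dF (c s)) (L u w))"
    using assms unfolding smooth_functionals_def by blast
  have curve: "gradient_curve (\<lambda>s. dF (c s)) (L u w)"
    if "u \<in> states P K" and c: "state_curve P K c u w" for c u w
  proof -
    have "\<forall>\<^sub>F s in at 0. c s \<in> states P K" "c 0 = u" "w \<in> states P K"
      using c by (auto simp: state_curve_def eventually_nhds_conv_at)
    moreover from this(1) have "\<forall>\<^sub>F s in at 0. dF (c s) \<in> gradients K"
      using * by (auto elim: eventually_mono)
    ultimately show ?thesis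
      using * that unfolding gradient_curve_def by blast
  qed
  have "has_functional_derivative P K F u (dF u)" if u: "u \<in> states P K" for u
    unfolding has_functional_derivative_def using * u state_curve_line[OF u] by blast
  with * curve show thesis
    by (intro that[of dF L]) (simp add: twice_differentiable_def)
qed

lemma
  assumes "twice_differentiable F dF L" "u \<in> states P K"
  shows twice_differentiable_derivative: "has_functional_derivative P K F u (dF u)"
    and twice_differentiable_gradients: "dF u \<in> gradients K" "w \<in> states P K \<Longrightarrow> L u w \<in> gradients K"
    and twice_differentiable_symmetric: "w \<in> states P K \<Longrightarrow> w' \<in> states P K \<Longrightarrow>
      pairing P (L u w) w' = pairing P (L u w') w"
    and twice_differentiable_along: "state_curve P K c u w \<Longrightarrow>
      ((\<lambda>s. F (c s)) has_real_derivative pairing P (dF u) w) (at 0)"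
    and twice_differentiable_curve: "state_curve P K c u w \<Longrightarrow> gradient_curve (\<lambda>s. dF (c s)) (L u w)"
  using assms unfolding twice_differentiable_def has_functional_derivative_def by blast+

lemma smooth_functionals_subset: "smooth_functionals P K \<subseteq> functionals P K"
  unfolding functionals_def
  by (blast elim: smooth_functional_cases intro: twice_differentiable_derivative)

lemma weighted_J_states: "g \<in> gradients K \<Longrightarrow> weighted P (J g) \<in> states P K"
  by (intro weighted_states J_gradients)

text \<open>Differentiating \<open>Br (dF u) (dG u)\<close> and moving the second derivatives, by their symmetry,
  off the direction of differentiation.\<close>

lemma bracket_has_functional_derivative:
  assumes F: "twice_differentiable F dF LF" and G: "twice_differentiable G dG LG"
    and u: "u \<in> states P K"
  shows "has_functional_derivative P K (bracket P K F G) u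
    (add_scaled (LF u (weighted P (J (dG u)))) (- 1) (LG u (weighted P (J (dF u)))))"
proof -
  note mem = twice_differentiable_gradients(1)[OF F u] twice_differentiable_gradients(1)[OF G u]
  note L = twice_differentiable_gradients(2)[OF F u] twice_differentiable_gradients(2)[OF G u]
  note symF = twice_differentiable_symmetric[OF F u] and symG = twice_differentiable_symmetric[OF G u]
  let ?jF = "weighted P (J (dF u))" and ?jG = "weighted P (J (dG u))"
  have j: "?jF \<in> states P K" "?jG \<in> states P K"
    using mem weighted_J_states by blast+
  have "((\<lambda>s. bracket P K F G (add_scaled u s w)) has_real_derivative
      pairing P (add_scaled (LF u ?jG) (- 1) (LG u ?jF)) w) (at 0)" if w: "w \<in> states P K" for w
  proof -
    note line = state_curve_line[OF u w]
    have "((\<lambda>s. Br (dF (add_scaled u s w)) (dG (add_scaled u s w))) has_real_derivative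
        Br (LF u w) (dG (add_scaled u 0 w)) + Br (dF (add_scaled u 0 w)) (LG u w)) (at 0)"
      by (rule form_curve_derivative[OF admissible_Br twice_differentiable_curve[OF F u line] twice_differentiable_curve[OF G u line]])
    moreover have "bracket P K F G (add_scaled u s w) = Br (dF (add_scaled u s w)) (dG (add_scaled u s w))" for s
      using add_scaled_states[OF u w] by (intro bracket_eq_Br twice_differentiable_derivative[OF F] twice_differentiable_derivative[OF G])
    moreover have "Br (LF u w) (dG u) + Br (dF u) (LG u w)
        = pairing P (add_scaled (LF u ?jG) (- 1) (LG u ?jF)) w"
    proof -
      have "Br (LF u w) (dG u) + Br (dF u) (LG u w) = Br (LF u w) (dG u) - Br (LG u w) (dF u)"
        using Br_skew[of "dF u" "LG u w"] mem L[OF w] by simp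
      also have "\<dots> = pairing P (LF u w) ?jG - pairing P (LG u w) ?jF"
        using mem L[OF w] by (simp add: Br_eq_Q_J pairing_weighted)
      also have "\<dots> = pairing P (LF u ?jG) w - pairing P (LG u ?jF) w"
        using symF[OF w j(2)] symG[OF w j(1)] by simp
      also have "\<dots> = pairing P (add_scaled (LF u ?jG) (- 1) (LG u ?jF)) w"
        using L j w by (simp add: pairing_ratio states_def Q_linear_left)
      finally show ?thesis .
    qed
    ultimately show ?thesis by simp
  qed
  then show ?thesis
    unfolding has_functional_derivative_def using add_scaled_gradients L j by blast
qed

lemma bracket_functional:
  assumes "F \<in> smooth_functionals P K" "G \<in> smooth_functionals P K"
  shows "bracket P K F G \<in> functionals P K"
  using assms unfolding functionals_def
  by (blast elim: smooth_functional_cases intro: bracket_has_functional_derivative)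

lemma bracket_Jacobi:
  assumes "F \<in> smooth_functionals P K" "G \<in> smooth_functionals P K" "M \<in> smooth_functionals P K"
    and u: "u \<in> states P K"
  shows "bracket P K (bracket P K F G) M u + bracket P K (bracket P K G M) F u
        + bracket P K (bracket P K M F) G u = 0"
proof -
  obtain dF LF where F: "twice_differentiable F dF LF"
    using assms(1) by (rule smooth_functional_cases)
  obtain dG LG where G: "twice_differentiable G dG LG"
    using assms(2) by (rule smooth_functional_cases)
  obtain dM LM where M: "twice_differentiable M dM LM"
    using assms(3) by (rule smooth_functional_cases)
  note mem = twice_differentiable_gradients(1)[OF F u] twice_differentiable_gradients(1)[OF G u]
    twice_differentiable_gradients(1)[OF M u]
  let ?j = "\<lambda>d. weighted P (J (d u))"
  have j: "?j dF \<in> states P K" "?j dG \<in> states P K" "?j dM \<in> states P K"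
    using mem weighted_J_states by blast+
  \<comment> \<open>Each nested bracket becomes a difference of two second derivatives evaluated on
    the flow directions; the three cyclic copies contain each second derivative twice with opposite
    signs.\<close>
  have nested: "bracket P K (bracket P K F G) M u
      = pairing P (LF u (?j dG)) (?j dM) - pairing P (LG u (?j dF)) (?j dM)"
    if F: "twice_differentiable F dF LF" and G: "twice_differentiable G dG LG"
      and M: "twice_differentiable M dM LM" for F dF LF G dG LG M dM LM
  proof -
    note mem = twice_differentiable_gradients(1)[OF F u] twice_differentiable_gradients(1)[OF G u]
      twice_differentiable_gradients(1)[OF M u]
    have "LF u (?j dG) \<in> gradients K" "LG u (?j dF) \<in> gradients K"
      using twice_differentiable_gradients(2)[OF F u] twice_differentiable_gradients(2)[OF G u]
        weighted_J_states mem by blast+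
    then show ?thesis
      using mem unfolding bracket_eq_Br[OF bracket_has_functional_derivative[OF F G u]
          twice_differentiable_derivative[OF M u]]
      by (simp add: Br_linear_left Br_eq_Q_J pairing_weighted)
  qed
  show ?thesis
    unfolding nested[OF F G M] nested[OF G M F] nested[OF M F G]
    using twice_differentiable_symmetric[OF F u j(2,3)] twice_differentiable_symmetric[OF G u j(1,3)]
      twice_differentiable_symmetric[OF M u j(1,2)] by simp
qed

lemma poisson: "poisson_bracket P K (bracket P K)"
proof -
  have lin: "(\<lambda>w. F w + c * G w) \<in> functionals P K" and prd: "(\<lambda>w. F w * G w) \<in> functionals P K"
    if "F \<in> functionals P K" "G \<in> functionals P K" for F G c
    using that has_functional_derivative_linear has_functional_derivative_product
    unfolding functionals_def by blast+
  show ?thesis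
    unfolding poisson_bracket_def
  proof (intro conjI ballI allI)
    show "smooth_functionals P K \<subseteq> functionals P K" by (rule smooth_functionals_subset)
  qed (rule lin prd bracket_algebra bracket_functional bracket_Jacobi; assumption)+
qed

end

subsection \<open>Hamiltonian and Casimirs\<close>

text \<open>Lebesgue measure is invariant under reflection, so the integral equals its own
  negative.\<close>

lemma lborel_integral_odd:
  fixes f :: "'a::euclidean_space \<Rightarrow> 'b::euclidean_space"
  assumes [measurable]: "f \<in> borel_measurable borel" and odd: "\<And>v. f (- v) = - f v"
  shows "(LINT v|lborel. f v) = 0"
proof -
  have "lborel = distr (lborel :: 'a measure) borel uminus"
    using lborel_affine[of "- 1" "0 :: 'a"] by (simp add: density_1 one_ennreal_def[symmetric])
  then have "(LINT v|lborel. f v) = (LINT v|distr lborel borel uminus. f v)" by simp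
  also have "\<dots> = (LINT v|lborel. f (- v))" by (rule integral_distr) simp_all
  also have "\<dots> = - (LINT v|lborel. f v)" by (simp add: odd)
  finally have "2 *\<^sub>R (LINT v|lborel. f v) = 0"
    by (metis add.right_inverse scaleR_2)
  then show ?thesis by simp
qed

text \<open>Smoothness enters because \<open>iterated_derivative\<close> is built from chosen
  derivatives, which respect scaling where the function is differentiable.\<close>

lemma vanishing_scale:
  fixes r :: "real \<Rightarrow> 'a::euclidean_space \<Rightarrow> real"
  assumes S: "open S" and r: "vanishing S C r" and smooth: "\<forall>\<^sub>F s in at 0. smooth_on S (r s)"
  shows "vanishing S C (\<lambda>s z. k * r s z)"
  unfolding vanishing_def
proof
  fix ds
  obtain Ms \<delta> where Ms: "set Ms \<subseteq> C" and \<delta>: "(\<delta> \<longlongrightarrow> 0) (at 0)"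
    and ev: "\<forall>\<^sub>F s in at 0. \<forall>z\<in>S. norm (iterated_derivative ds (r s) z) \<le> \<delta> s * (\<Sum>M\<leftarrow>Ms. norm (M z))"
    using r unfolding vanishing_def by meson
  have "\<forall>\<^sub>F s in at 0. \<forall>z\<in>S. norm (iterated_derivative ds (\<lambda>z. k * r s z) z)
      \<le> (\<bar>k\<bar> * \<delta> s) * (\<Sum>M\<leftarrow>Ms. norm (M z))"
    using ev smooth
  proof eventually_elim
    case (elim s)
    then show ?case
      using iterated_derivative_scale[OF S elim(2), of _ ds k]
      by (simp add: abs_mult mult.assoc mult_left_mono)
  qed
  moreover have "((\<lambda>s. \<bar>k\<bar> * \<delta> s) \<longlongrightarrow> 0) (at 0)" using tendsto_mult_right_zero[OF \<delta>] .
  ultimately show "\<exists>Ms \<delta>. set Ms \<subseteq> C \<and> (\<delta> \<longlongrightarrow> 0) (at 0) \<and>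
      (\<forall>\<^sub>F s in at 0. \<forall>z\<in>S. norm (iterated_derivative ds (\<lambda>z. k * r s z) z) \<le> \<delta> s * (\<Sum>M\<leftarrow>Ms. norm (M z)))"
    using Ms by blast
qed

text \<open>The case of no derivatives at a fixed point, used to recover classical time derivatives
  from \<open>has_velocity\<close>.\<close>

lemma vanishing_pointwise:
  fixes r :: "real \<Rightarrow> 'a::euclidean_space \<Rightarrow> 'b::real_normed_vector"
  assumes "vanishing S C r" "z \<in> S"
  shows "((\<lambda>s. r s z) \<longlongrightarrow> 0) (at 0)"
proof -
  obtain Ms :: "('a \<Rightarrow> 'b) list" and \<delta> where \<delta>: "(\<delta> \<longlongrightarrow> 0) (at 0)"
    and ev: "\<forall>\<^sub>F s in at 0. \<forall>z\<in>S. norm (iterated_derivative [] (r s) z) \<le> \<delta> s * (\<Sum>M\<leftarrow>Ms. norm (M z))"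
    using spec[OF assms(1)[unfolded vanishing_def], of "[]"] by blast
  have "\<forall>\<^sub>F s in at 0. norm (r s z) \<le> \<delta> s * (\<Sum>M\<leftarrow>Ms. norm (M z))"
    using ev by eventually_elim (use assms(2) in \<open>simp add: iterated_derivative_def\<close>)
  then show ?thesis
    by (rule Lim_null_comparison) (rule tendsto_mult_left_zero[OF \<delta>])
qed

context vlasov_maxwell
begin

lemma ratio_gradients: "u \<in> states P K \<Longrightarrow> ratio P u \<in> gradients K"
  by (simp add: states_def)

lemma smooth_functionalI:
  assumes dF: "\<And>u. u \<in> states P K \<Longrightarrow> dF u \<in> gradients K"
    and L: "\<And>u w. u \<in> states P K \<Longrightarrow> w \<in> states P K \<Longrightarrow> L u w \<in> gradients K"
    and sym: "\<And>u w w'. u \<in> states P K \<Longrightarrow> w \<in> states P K \<Longrightarrow> w' \<in> states P K \<Longrightarrow>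
      Q (L u w) (ratio P w') = Q (L u w') (ratio P w)"
    and deriv: "\<And>c u w. u \<in> states P K \<Longrightarrow> state_curve P K c u w \<Longrightarrow>
      ((\<lambda>s. F (c s)) has_real_derivative Q (dF u) (ratio P w)) (at 0)"
    and curve: "\<And>c u w. u \<in> states P K \<Longrightarrow> state_curve P K c u w \<Longrightarrow> gradient_curve (\<lambda>s. dF (c s)) (L u w)"
  shows "F \<in> smooth_functionals P K"
  unfolding smooth_functionals_def
  by (intro CollectI exI[of _ dF] exI[of _ L] ballI conjI allI impI)
    (use assms in \<open>auto simp: pairing_ratio gradient_curve_def\<close>)

text \<open>The functional derivative is constant and the second derivative is 0. Such functionals
  serve as tests for the equations of motion and include the Gauss laws.\<close>

lemma linear_functional:
  assumes g: "g \<in> gradients K" and F: "\<And>u. u \<in> states P K \<Longrightarrow> F u = pairing P g u"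
  shows "F \<in> smooth_functionals P K"
    and "u \<in> states P K \<Longrightarrow> has_functional_derivative P K F u g"
proof -
  have deriv: "((\<lambda>s. F (c s)) has_real_derivative Q g (ratio P w)) (at 0)"
    if u: "u \<in> states P K" and c: "state_curve P K c u w" for c u w
  proof -
    have "((\<lambda>s. Q g (ratio P (c s))) has_real_derivative
        Q zero_fields (ratio P (c 0)) + Q g (ratio P w)) (at 0)"
      using form_curve_derivative[OF admissible_Q gradient_curve_const[OF g] state_curve_gradient_curve[OF c u]] .
    moreover have "\<forall>\<^sub>F s in nhds 0. F (c s) = Q g (ratio P (c s))"
      using c unfolding state_curve_def by (auto elim!: eventually_mono simp: F pairing_ratio)
    ultimately show ?thesis
      by (subst DERIV_cong_ev[OF refl _ refl]) (auto simp: Q_zero_left)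
  qed
  show "F \<in> smooth_functionals P K"
    by (rule smooth_functionalI[where dF = "\<lambda>_. g" and L = "\<lambda>_ _. zero_fields"])
      (simp_all add: g zero_gradients Q_zero_left deriv gradient_curve_const)
  show "has_functional_derivative P K F u g" if "u \<in> states P K"
    unfolding has_functional_derivative_def pairing_ratio
    using g deriv[OF that state_curve_line[OF that]] by blast
qed

section \<open>The Hamiltonian and its derivatives\<close>

definition hamiltonian_gradient :: "fields \<Rightarrow> fields" where
  "hamiltonian_gradient = (\<lambda>(a, e, b). (\<lambda>x v. ((alpha P)\<^sup>2 * (vth P)\<^sup>2) * a x v, e, b))"

lemma hamiltonian_gradient_gradients: "g \<in> gradients K \<Longrightarrow> hamiltonian_gradient g \<in> gradients K"
  by (elim gradients_cases) (simp add: hamiltonian_gradient_def A_scale)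

lemma Q_hamiltonian_gradient:
  "g \<in> gradients K \<Longrightarrow> h \<in> gradients K \<Longrightarrow> Q (hamiltonian_gradient g) h = Q g (hamiltonian_gradient h)"
  by (elim gradients_cases) (simp add: hamiltonian_gradient_def Q_def ip_scale_right
      ip_commute[of "\<lambda>x v. (alpha P)\<^sup>2 * (vth P)\<^sup>2 * a x v" for a] ip_commute)

text \<open>With respect to the ratio variables \<open>H\<close> is a quadratic form:
  \<open>f\<^sup>2 / f0\<close> is \<open>f0\<close> times the squared ratio.\<close>

lemma hamiltonian_eq:
  assumes "u \<in> states P K"
  shows "hamiltonian P u = 1 / 2 * Q (hamiltonian_gradient (ratio P u)) (ratio P u)"
proof (cases u)
  case (fields f E B)
  let ?a = "\<lambda>x v. f x v / f0 P x v"
  have "?a \<in> A" using assms by (simp add: fields states_def)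
  then have "ip (\<lambda>x v. ((alpha P)\<^sup>2 * (vth P)\<^sup>2) * ?a x v) ?a = ((alpha P)\<^sup>2 * (vth P)\<^sup>2) * ip ?a ?a"
    by (subst ip_commute) (rule ip_scale_right)
  moreover have "phase_int P (\<lambda>x v. (f x v)\<^sup>2 / f0 P x v) = ip ?a ?a"
    unfolding ip_def by (rule phase_int_cong) (simp add: f0_nonzero power2_eq_square)
  ultimately show ?thesis
    by (simp add: fields hamiltonian_def hamiltonian_gradient_def Q_def sip_def power2_norm_eq_inner
        algebra_simps)
qed

text \<open>The remainder of the new curve is the old one with its phase component multiplied by a
  constant; the field components carry over unchanged.\<close>

lemma gradient_curve_hamiltonian:
  assumes g: "gradient_curve g g'"
  shows "gradient_curve (\<lambda>s. hamiltonian_gradient (g s)) (hamiltonian_gradient g')"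
proof -
  let ?k = "(alpha P)\<^sup>2 * (vth P)\<^sup>2"
  let ?r = "\<lambda>s. difference_quotient g g' s"
  have van: "vanishing_fields ?r" by (rule gradient_curve_vanishing[OF g])
  have "vanishing Z (case_prod ` A) (\<lambda>s z. ?k * case_prod (fst (?r s)) z)"
  proof (rule vanishing_scale)
    show "open Z" using open_Omega by (simp add: open_Times)
    show "vanishing Z (case_prod ` A) (\<lambda>s. case_prod (fst (?r s)))"
      using van by (simp add: vanishing_fields_def)
    have "\<forall>\<^sub>F s in at 0. ?r s \<in> gradients K" using van by (simp add: vanishing_fields_def)
    then show "\<forall>\<^sub>F s in at 0. smooth_on Z (case_prod (fst (?r s)))"
      by eventually_elim (auto elim!: gradients_cases intro: A_smooth)
  qed
  moreover have "(\<lambda>s z. ?k * case_prod (fst (?r s)) z) = (\<lambda>s (x, v).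
      (fst (hamiltonian_gradient (g s)) x v - fst (hamiltonian_gradient (g 0)) x v) / s
        - fst (hamiltonian_gradient g') x v)"
    by (simp add: fun_eq_iff difference_quotient_def hamiltonian_gradient_def case_prod_unfold
        right_diff_distrib)
  moreover have "snd (hamiltonian_gradient h) = snd h" for h
    by (simp add: hamiltonian_gradient_def case_prod_unfold)
  ultimately have "has_velocity P K (\<lambda>s. hamiltonian_gradient (g s)) (hamiltonian_gradient g')"
    using g by (simp add: has_velocity_def gradient_curve_def)
  with g show ?thesis
    unfolding gradient_curve_def
    by (auto elim: eventually_mono intro: hamiltonian_gradient_gradients)
qed

lemma hamiltonian_derivative:
  assumes u: "u \<in> states P K" and c: "state_curve P K c u w"
  shows "((\<lambda>s. hamiltonian P (c s)) has_real_derivative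
    Q (hamiltonian_gradient (ratio P u)) (ratio P w)) (at 0)"
proof -
  note curve = state_curve_gradient_curve[OF c u]
  have mem: "ratio P u \<in> gradients K" "ratio P w \<in> gradients K" and c0: "c 0 = u"
    using u c by (simp_all add: states_def state_curve_def)
  have "((\<lambda>s. 1 / 2 * Q (hamiltonian_gradient (ratio P (c s))) (ratio P (c s))) has_real_derivative
      1 / 2 * (Q (hamiltonian_gradient (ratio P w)) (ratio P (c 0))
        + Q (hamiltonian_gradient (ratio P (c 0))) (ratio P w))) (at 0)"
    by (intro DERIV_cmult form_curve_derivative[OF admissible_Q gradient_curve_hamiltonian[OF curve] curve])
  also have "1 / 2 * (Q (hamiltonian_gradient (ratio P w)) (ratio P (c 0))
        + Q (hamiltonian_gradient (ratio P (c 0))) (ratio P w))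
      = Q (hamiltonian_gradient (ratio P u)) (ratio P w)"
    using Q_hamiltonian_gradient[OF mem(2,1)] by (simp add: c0 Q_commute)
  finally have "((\<lambda>s. 1 / 2 * Q (hamiltonian_gradient (ratio P (c s))) (ratio P (c s)))
      has_real_derivative Q (hamiltonian_gradient (ratio P u)) (ratio P w)) (at 0)" .
  moreover have "\<forall>\<^sub>F s in nhds 0. hamiltonian P (c s)
      = 1 / 2 * Q (hamiltonian_gradient (ratio P (c s))) (ratio P (c s))"
    using c unfolding state_curve_def by (auto elim!: eventually_mono simp: hamiltonian_eq)
  ultimately show ?thesis
    by (subst DERIV_cong_ev[OF refl _ refl])
qed

lemma hamiltonian_smooth: "hamiltonian P \<in> smooth_functionals P K"
proof (rule smooth_functionalI[where dF = "\<lambda>u. hamiltonian_gradient (ratio P u)"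
      and L = "\<lambda>u w. hamiltonian_gradient (ratio P w)"])
  fix w w' assume "w \<in> states P K" "w' \<in> states P K"
  then show "Q (hamiltonian_gradient (ratio P w)) (ratio P w')
      = Q (hamiltonian_gradient (ratio P w')) (ratio P w)"
    using Q_hamiltonian_gradient by (simp add: states_def Q_commute)
qed (blast intro: ratio_gradients hamiltonian_gradient_gradients hamiltonian_derivative
  | rule gradient_curve_hamiltonian[OF state_curve_gradient_curve])+

lemma hamiltonian_functional_derivative:
  "u \<in> states P K \<Longrightarrow>
    has_functional_derivative P K (hamiltonian P) u (hamiltonian_gradient (ratio P u))"
  unfolding has_functional_derivative_def pairing_ratio
  by (intro conjI ballI hamiltonian_gradient_gradients ratio_gradients
      hamiltonian_derivative[OF _ state_curve_line])

section \<open>Casimirs\<close>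

lemma J_simp:
  "J (a, e, b) =
     (\<lambda>x v. \<kappa> * (e x \<bullet> v) + - 1 / ((alpha P)\<^sup>2 * (vth P)\<^sup>2) * transport P a x v,
      \<lambda>x. curl b x + (- \<kappa>) *\<^sub>R flux a x,
      \<lambda>x. (- 1) *\<^sub>R curl e x)"
  by (simp only: J_def prod.case)

text \<open>By skewness the bracket is \<open>- Q h (J g)\<close>, so it suffices that
  \<open>J g\<close> vanishes over the domain.\<close>

lemma casimirI:
  assumes C: "\<And>u. u \<in> states P K \<Longrightarrow> C u = pairing P g u" and g: "g \<in> gradients K"
    and J: "J g = (a, e, b)"
    and zero: "\<And>x v. x \<in> Omega P \<Longrightarrow> a x v = 0" "\<And>x. x \<in> Omega P \<Longrightarrow> e x = 0"
      "\<And>x. x \<in> Omega P \<Longrightarrow> b x = 0"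
  shows "casimir P K (bracket P K) C"
  unfolding casimir_def
proof (intro conjI ballI)
  show "C \<in> smooth_functionals P K" by (rule linear_functional(1)[OF g]) (rule C)
  fix G u assume "G \<in> functionals P K" and u: "u \<in> states P K"
  then obtain h where h: "has_functional_derivative P K G u h" "h \<in> gradients K"
    by (auto simp: functionals_def has_functional_derivative_def)
  have "has_functional_derivative P K C u g" by (rule linear_functional(2)[OF g]) (auto simp: C u)
  then have "bracket P K C G u = Br g h" using h(1) by (rule bracket_eq_Br)
  also have "\<dots> = - Q h (J g)"
    using Br_skew[OF g h(2)] Br_eq_Q_J[OF h(2) g] by simp
  also have "Q h (J g) = Q h zero_fields"
    unfolding J zero_fields_def by (rule Q_cong) (simp_all add: zero)
  finally show "bracket P K C G u = 0" by (simp add: Q_commute[of h] Q_zero_left)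
qed

lemma
  assumes "\<phi> \<in> test_fns K"
  shows test_smooth: "smooth_on (Omega P) \<phi>"
    and test_phase: "(\<lambda>x v. \<phi> x) \<in> A"
    and grad_test: "grad \<phi> \<in> E_fields K" "grad \<phi> \<in> B_fields K"
proof -
  have "test_class P (test_fns K)" using setting by (simp add: formal_setting_def)
  with assms show "smooth_on (Omega P) \<phi>" by (simp add: test_class_def)
  show "(\<lambda>x v. \<phi> x) \<in> A" "grad \<phi> \<in> E_fields K" "grad \<phi> \<in> B_fields K"
    using expressions assms unfolding expressions_defined_def by blast+
qed

lemma divergence_by_parts:
  "\<phi> \<in> test_fns K \<Longrightarrow> e \<in> E_fields K \<union> B_fields K \<Longrightarrow>
    space_int P (\<lambda>x. \<phi> x * divergence e x) = - sip (grad \<phi>) e"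
  using by_parts unfolding no_boundary_terms_def sip_def by blast

text \<open>The Maxwellian is even in velocity, so its product with \<open>v\<close> is odd.\<close>

lemma flux_isotropic:
  "x \<in> Omega P \<Longrightarrow> flux (\<lambda>x v. p x) x = 0"
proof -
  assume x: "x \<in> Omega P"
  have "continuous_on UNIV (\<lambda>v. f0 P x v)"
    by (intro continuous_at_imp_continuous_on ballI differentiable_imp_continuous_within f0_differentiable_v)
  then have "(\<lambda>v. (f0 P x v * p x) *\<^sub>R v) \<in> borel_measurable borel"
    by (intro borel_measurable_continuous_onI continuous_intros)
  then show ?thesis
    unfolding flux_def by (rule lborel_integral_odd) (simp add: f0_def)
qed

text \<open>Without dependence on velocity the force term drops out and only the spatial gradient
  remains.\<close>

lemma transport_space_function:
  assumes "\<phi> \<in> test_fns K" "x \<in> Omega P"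
  shows "transport P (\<lambda>x v. c * \<phi> x) x v = c * (grad \<phi> x \<bullet> v)"
proof -
  have "\<phi> differentiable (at x)"
    using smooth_on_differentiable[OF test_smooth] assms by blast
  then have "grad (\<lambda>y. c * \<phi> y) x = c *\<^sub>R grad \<phi> x"
    using partial_linear[OF differentiable_const, of \<phi> x _ 0 c]
    by (simp add: grad_def vec_eq_iff partial_def frechet_derivative_const)
  moreover have "grad (\<lambda>w. c * \<phi> x) v = 0"
    by (simp add: grad_def vec_eq_iff partial_def frechet_derivative_const)
  ultimately show ?thesis
    by (simp add: transport_def grad_x_def grad_v_def inner_commute)
qed

text \<open>Integration by parts of the divergence produces minus the gradient of
  \<open>\<phi>\<close>; Fubini turns the charge density into a pairing with the phase
  component.\<close>

lemma gauss_E_eq: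
  assumes \<phi>: "\<phi> \<in> test_fns K" and u: "u \<in> states P K"
  shows "gauss_E P \<phi> u
    = pairing P (\<lambda>x v. - ((alpha P)\<^sup>2 / eps P) * \<phi> x, \<lambda>x. (- 1) *\<^sub>R grad \<phi> x, \<lambda>x. 0) u"
proof (cases u)
  case (fields f E B)
  let ?k = "(alpha P)\<^sup>2 / eps P" and ?a = "\<lambda>x v. f x v / f0 P x v"
  have a: "?a \<in> A" and E: "E \<in> E_fields K"
    using u by (simp_all add: fields states_def)
  have int: "phase_integrable P (\<lambda>x v. \<phi> x * f x v)"
    using ip_integrable[OF test_phase[OF \<phi>] a]
    by (subst phase_integrable_cong[where h' = "\<lambda>x v. f0 P x v * \<phi> x * ?a x v"])
      (simp_all add: f0_nonzero)
  have "gauss_E P \<phi> u = space_int P (\<lambda>x. \<phi> x * divergence E x + - ?k * (LINT v|lborel. \<phi> x * f x v))"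
    unfolding fields gauss_E_def prod.case by (intro space_int_cong) (simp add: algebra_simps)
  also have "\<dots> = space_int P (\<lambda>x. \<phi> x * divergence E x)
      + - ?k * space_int P (\<lambda>x. LINT v|lborel. \<phi> x * f x v)"
  proof (rule space_int_linear)
    show "space_integrable P (\<lambda>x. \<phi> x * divergence E x)"
      using expressions \<phi> E unfolding expressions_defined_def by blast
  qed (rule phase_integrable_iterated[OF int])
  also have "\<dots> = - sip (grad \<phi>) E + - ?k * phase_int P (\<lambda>x v. \<phi> x * f x v)"
    using divergence_by_parts[OF \<phi>] E by (simp add: phase_int_iterated[OF int])
  also have "phase_int P (\<lambda>x v. \<phi> x * f x v) = ip ?a (\<lambda>x v. \<phi> x)"
    unfolding ip_def by (rule phase_int_cong) (simp add: f0_nonzero)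
  also have "- sip (grad \<phi>) E + - ?k * ip ?a (\<lambda>x v. \<phi> x)
      = sip E (\<lambda>x. (- 1) *\<^sub>R grad \<phi> x) + ip ?a (\<lambda>x v. - ?k * \<phi> x)"
    unfolding sip_scale_right[OF is_field_class(1) E grad_test(1)[OF \<phi>]]
      ip_scale_right[OF a test_phase[OF \<phi>]] by (simp add: sip_commute)
  finally show ?thesis
    unfolding pairing_ratio fields ratio_simp Q_def prod.case
    by (simp add: ip_commute sip_commute sip_zero_right)
qed

lemma casimir_gauss_E:
  assumes \<phi>: "\<phi> \<in> test_fns K"
  shows "casimir P K (bracket P K) (gauss_E P \<phi>)"
proof (rule casimirI[OF gauss_E_eq[OF \<phi>] _ J_simp])
  let ?k = "(alpha P)\<^sup>2 / eps P"
  show "(\<lambda>x v. - ?k * \<phi> x, \<lambda>x. (- 1) *\<^sub>R grad \<phi> x, \<lambda>x. 0) \<in> gradients K"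
    unfolding gradients_iff
    by (intro conjI A_scale test_phase field_scale grad_test field_zero \<phi> is_field_class)
  fix x assume x: "x \<in> Omega P"
  \<comment> \<open>The factor \<open>\<alpha>\<^sup>2 / \<epsilon>\<close> of the charge density is
    what makes the transport contribution equal \<open>\<kappa>\<close> times
    \<open>grad \<phi> x \<bullet> v\<close> and cancel the coupling.\<close>
  show "\<kappa> * ((- 1) *\<^sub>R grad \<phi> x \<bullet> v)
      + - 1 / ((alpha P)\<^sup>2 * (vth P)\<^sup>2) * transport P (\<lambda>x v. - ?k * \<phi> x) x v = 0" for v
    unfolding transport_space_function[OF \<phi> x]
    using alpha_nonzero eps_nonzero vth_pos by (simp add: field_simps)
  show "curl (\<lambda>x. 0) x + (- \<kappa>) *\<^sub>R flux (\<lambda>x v. - ?k * \<phi> x) x = 0"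
    using flux_isotropic[OF x, of "\<lambda>x. - ?k * \<phi> x"] by (simp add: curl_zero)
  have "curl (\<lambda>x. (- 1) *\<^sub>R grad \<phi> x) x = 0"
    using curl_scale[OF field_differentiable[OF is_field_class(1) grad_test(1)[OF \<phi>] x], of "- 1"]
      curl_grad[OF open_Omega test_smooth[OF \<phi>] x] by simp
  then show "(- 1) *\<^sub>R curl (\<lambda>x. (- 1) *\<^sub>R grad \<phi> x) x = 0" by simp
qed

lemma casimir_gauss_B:
  assumes \<psi>: "\<psi> \<in> test_fns K"
  shows "casimir P K (bracket P K) (gauss_B P \<psi>)"
proof (rule casimirI[OF _ _ J_simp])
  let ?g = "(\<lambda>x v. 0, \<lambda>x. 0, \<lambda>x. (- 1) *\<^sub>R grad \<psi> x) :: fields"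
  show "?g \<in> gradients K"
    unfolding gradients_iff
    by (intro conjI A_zero field_scale grad_test field_zero \<psi> is_field_class)
  show "gauss_B P \<psi> u = pairing P ?g u" if u: "u \<in> states P K" for u
  proof (cases u)
    case (fields f E B)
    then have B: "B \<in> B_fields K" using u by (simp add: states_def)
    then have "gauss_B P \<psi> u = - sip (grad \<psi>) B"
      using divergence_by_parts[OF \<psi>] by (simp add: fields gauss_B_def)
    also have "\<dots> = sip B (\<lambda>x. (- 1) *\<^sub>R grad \<psi> x)"
      unfolding sip_scale_right[OF is_field_class(2) B grad_test(2)[OF \<psi>]] by (simp add: sip_commute)
    finally show ?thesis
      unfolding pairing_ratio fields ratio_simp Q_def prod.case
      by (simp add: ip_commute[of "\<lambda>x v. 0"] sip_commute ip_zero_right sip_zero_right)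
  qed
  fix x assume x: "x \<in> Omega P"
  have "transport P (\<lambda>x v. 0) x v = 0" for v
    by (simp add: transport_def grad_x_def grad_v_def grad_def partial_def frechet_derivative_const
        inner_vec_def)
  then show "\<kappa> * (0 \<bullet> v) + - 1 / ((alpha P)\<^sup>2 * (vth P)\<^sup>2) * transport P (\<lambda>x v. 0) x v = 0" for v
    by simp
  have "curl (\<lambda>x. (- 1) *\<^sub>R grad \<psi> x) x = 0"
    using curl_scale[OF field_differentiable[OF is_field_class(1) grad_test(1)[OF \<psi>] x], of "- 1"]
      curl_grad[OF open_Omega test_smooth[OF \<psi>] x] by simp
  then show "curl (\<lambda>x. (- 1) *\<^sub>R grad \<psi> x) x + (- \<kappa>) *\<^sub>R flux (\<lambda>x v. 0) x = 0"
    using flux_isotropic[OF x, of "\<lambda>x. 0"] by simp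
  show "(- 1) *\<^sub>R curl (\<lambda>x. 0) x = (0 :: R3)"
    by (simp add: curl_zero)
qed

end

subsection \<open>Equations of motion\<close>

lemma has_vector_derivative_difference_quotient:
  fixes f :: "real \<Rightarrow> 'a::real_normed_vector"
  assumes "((\<lambda>h. (f (t + h) - f t) /\<^sub>R h) \<longlongrightarrow> D) (at 0)"
  shows "(f has_vector_derivative D) (at t)"
proof -
  have "((\<lambda>h. norm ((f (t + h) - f t) /\<^sub>R h - D)) \<longlongrightarrow> 0) (at 0)"
    using assms by (intro tendsto_norm_zero LIM_zero)
  moreover have "\<forall>\<^sub>F h in at 0. norm ((f (t + h) - f t) /\<^sub>R h - D) = norm (f (t + h) - f t - h *\<^sub>R D) / norm h"
    using eventually_neq_at_within[of "0::real" 0 UNIV]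
  proof eventually_elim
    case (elim h)
    then have "f (t + h) - f t - h *\<^sub>R D = h *\<^sub>R ((f (t + h) - f t) /\<^sub>R h - D)"
      by (simp add: scaleR_diff_right)
    with elim show ?case by simp
  qed
  ultimately show ?thesis
    unfolding has_vector_derivative_def has_derivative_at
    by (auto intro: Lim_transform_eventually bounded_linear_scaleR_left)
qed

context vlasov_maxwell
begin

text \<open>Velocity of a state curve is measured after division by \<open>f0\<close>, which does
  not depend on time; multiplying back by \<open>f0\<close> at a fixed point gives the classical
  time derivatives.\<close>

lemma curve_velocity:
  assumes curve: "state_curve P K (\<lambda>s. (f (t + s), E (t + s), B (t + s))) (f t, E t, B t) (wa, wE, wB)"
    and x: "x \<in> Omega P"
  shows "deriv (\<lambda>t. f t x v) t = wa x v"
    and "vector_derivative (\<lambda>t. E t x) (at t) = wE x"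
    and "vector_derivative (\<lambda>t. B t x) (at t) = wB x"
proof -
  have van: "vanishing Z (case_prod ` A)
       (\<lambda>s (x, v). (f (t + s) x v / f0 P x v - f t x v / f0 P x v) / s - wa x v / f0 P x v)"
     "vanishing (Omega P) (E_fields K) (\<lambda>s x. (E (t + s) x - E t x) /\<^sub>R s - wE x)"
     "vanishing (Omega P) (B_fields K) (\<lambda>s x. (B (t + s) x - B t x) /\<^sub>R s - wB x)"
    using curve by (simp_all add: state_curve_def has_velocity_def)
  have "((\<lambda>s. f0 P x v * ((f (t + s) x v / f0 P x v - f t x v / f0 P x v) / s - wa x v / f0 P x v))
      \<longlongrightarrow> 0) (at 0)"
    using vanishing_pointwise[OF van(1), of "(x, v)"] x by (intro tendsto_mult_right_zero) simp
  moreover have "f0 P x v * ((p / f0 P x v - q / f0 P x v) / s - w / f0 P x v) = (p - q) / s - w" for p q s w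
    using f0_nonzero[OF x, of v] by (simp add: right_diff_distrib flip: diff_divide_distrib)
        (simp flip: right_diff_distrib)
  ultimately have "((\<lambda>s. (f (t + s) x v - f t x v) / s) \<longlongrightarrow> wa x v) (at 0)"
    by (simp add: LIM_zero_cancel)
  then show "deriv (\<lambda>t. f t x v) t = wa x v"
    by (intro DERIV_imp_deriv) (simp add: DERIV_def)
  show "vector_derivative (\<lambda>t. E t x) (at t) = wE x"
    using LIM_zero_cancel[OF vanishing_pointwise[OF van(2) x]]
    by (intro vector_derivative_at has_vector_derivative_difference_quotient)
  show "vector_derivative (\<lambda>t. B t x) (at t) = wB x"
    using LIM_zero_cancel[OF vanishing_pointwise[OF van(3) x]]
    by (intro vector_derivative_at has_vector_derivative_difference_quotient)
qed

lemma state_curve_states: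
  assumes "state_curve P K c u w"
  shows "u \<in> states P K" "w \<in> states P K"
  using assms eventually_nhds_x_imp_x unfolding state_curve_def by fastforce+

definition hamiltonian_field :: "fields \<Rightarrow> fields" where
  "hamiltonian_field u = J (hamiltonian_gradient (ratio P u))"

lemma hamiltonian_field_gradients: "u \<in> states P K \<Longrightarrow> hamiltonian_field u \<in> gradients K"
  unfolding hamiltonian_field_def
  by (intro J_gradients hamiltonian_gradient_gradients ratio_gradients)

text \<open>The chain rule gives the time derivative of \<open>F\<close> as a \<open>Q\<close>
  product with the velocity, and the bracket with \<open>H\<close> is the \<open>Q\<close> product
  of the same triple with the Hamiltonian field.\<close>

lemma hamiltonian_motion_iff:
  assumes curve: "\<And>t. t \<in> I \<Longrightarrow> state_curve P K (\<lambda>s. u (t + s)) (u t) (w t)"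
  shows "hamiltonian_motion P K (bracket P K) (hamiltonian P) I u
    \<longleftrightarrow> (\<forall>t\<in>I. \<forall>g\<in>gradients K. Q g (ratio P (w t)) = Q g (hamiltonian_field (u t)))"
proof -
  have key: "((\<lambda>t. F (u t)) has_real_derivative bracket P K F (hamiltonian P) (u t)) (at t)
      \<longleftrightarrow> Q g (ratio P (w t)) = Q g (hamiltonian_field (u t))"
    if F: "F \<in> smooth_functionals P K" and g: "has_functional_derivative P K F (u t) g" and t: "t \<in> I" for F g t
  proof -
    note st = state_curve_states[OF curve[OF t]]
    obtain dF L where dF: "twice_differentiable F dF L" using F by (rule smooth_functional_cases)
    have "((\<lambda>s. F (u (s + t))) has_real_derivative pairing P (dF (u t)) (w t)) (at 0)"
      using twice_differentiable_along[OF dF st(1) curve[OF t]] by (simp add: add.commute)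
    then have "((\<lambda>t. F (u t)) has_real_derivative pairing P (dF (u t)) (w t)) (at t)"
      using DERIV_shift[of "\<lambda>t. F (u t)" _ 0 t] by simp
    moreover have "pairing P (dF (u t)) (w t) = Q g (ratio P (w t))"
      unfolding pairing_ratio
      by (rule functional_derivative_unique[OF twice_differentiable_derivative[OF dF st(1)] g
            ratio_gradients[OF st(2)]])
    moreover have "bracket P K F (hamiltonian P) (u t) = Q g (hamiltonian_field (u t))"
      unfolding bracket_eq_Br[OF g hamiltonian_functional_derivative[OF st(1)]] hamiltonian_field_def
      using g by (intro Br_eq_Q_J hamiltonian_gradient_gradients ratio_gradients st)
        (simp add: has_functional_derivative_def)
    ultimately show ?thesis using DERIV_unique by metis
  qed
  show ?thesis
    unfolding hamiltonian_motion_def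
  proof (intro iffI ballI)
    fix t g
    assume motion: "\<forall>F\<in>smooth_functionals P K. \<forall>t\<in>I.
        ((\<lambda>t. F (u t)) has_real_derivative bracket P K F (hamiltonian P) (u t)) (at t)"
      and t: "t \<in> I" and g: "g \<in> gradients K"
    show "Q g (ratio P (w t)) = Q g (hamiltonian_field (u t))"
      \<comment> \<open>Pairing with \<open>g\<close> is a smooth functional whose functional
        derivative is \<open>g\<close>, so every triple occurs as a test.\<close>
      using key[OF linear_functional(1)[OF g refl] linear_functional(2)[OF g refl] t]
        state_curve_states[OF curve[OF t]] linear_functional(1)[OF g refl] motion t by blast
  next
    fix F t
    assume eq: "\<forall>t\<in>I. \<forall>g\<in>gradients K. Q g (ratio P (w t)) = Q g (hamiltonian_field (u t))"
      and F: "F \<in> smooth_functionals P K" and t: "t \<in> I"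
    obtain g where g: "has_functional_derivative P K F (u t) g" "g \<in> gradients K"
      using F smooth_functionals_subset state_curve_states(1)[OF curve[OF t]]
      unfolding functionals_def has_functional_derivative_def by blast
    show "((\<lambda>t. F (u t)) has_real_derivative bracket P K F (hamiltonian P) (u t)) (at t)"
      using key[OF F g(1) t] eq t g(2) by blast
  qed
qed

section \<open>Definiteness of the form \<open>Q\<close> over the domain\<close>

lemma ip_definite:
  assumes a: "a \<in> A" and zero: "ip a a = 0" and x: "x \<in> Omega P"
  shows "a x v = 0"
proof -
  let ?h = "\<lambda>z. weight z * (case_prod a z \<bullet> case_prod a z)"
  have "open Z" using open_Omega by (simp add: open_Times)
  moreover have "continuous_on Z ?h"
    by (intro continuous_intros f0_continuous smooth_on_continuous[OF A_smooth[OF a]])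
  moreover have "?h z \<ge> 0" if "z \<in> Z" for z
    using weight_nonneg[OF that] by simp
  moreover have "(x, v) \<in> Z" using x by simp
  ultimately have "?h (x, v) = 0"
    by (intro continuous_nonneg_integral_zero[OF _ _ _ ip_set_integrable[OF a a] zero[unfolded ip_eq]])
  then show ?thesis using f0_nonzero[OF x] by simp
qed

lemma sip_definite:
  assumes V: "is_field_class V" and e: "e \<in> V" and zero: "sip e e = 0" and x: "x \<in> Omega P"
  shows "e x = 0"
proof -
  have "continuous_on (Omega P) (\<lambda>x. 1 * (e x \<bullet> e x))"
    by (intro continuous_intros smooth_on_continuous[OF field_smooth[OF V e]])
  then have "1 * (e x \<bullet> e x) = 0"
    by (rule continuous_nonneg_integral_zero[OF open_Omega _ _ sip_set_integrable[OF V e e]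
          zero[unfolded sip_eq] x]) simp
  then show ?thesis by simp
qed

lemma ip_nonneg: "ip a a \<ge> 0"
  unfolding ip_eq set_lebesgue_integral_def
  by (rule Bochner_Integration.integral_nonneg) (auto simp: indicator_def intro!: mult_nonneg_nonneg[OF less_imp_le[OF f0_pos]])

lemma sip_nonneg: "sip e e \<ge> 0"
  unfolding sip_eq set_lebesgue_integral_def
  by (rule Bochner_Integration.integral_nonneg) (auto simp: indicator_def)

lemma Q_separates:
  assumes "a \<in> A" "e \<in> E_fields K" "b \<in> B_fields K" "a' \<in> A" "e' \<in> E_fields K" "b' \<in> B_fields K"
  shows "(\<forall>g\<in>gradients K. Q g (a, e, b) = Q g (a', e', b'))
    \<longleftrightarrow> (\<forall>x\<in>Omega P. (\<forall>v. a x v = a' x v) \<and> e x = e' x \<and> b x = b' x)"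
proof (intro iffI ballI)
  fix x assume Q: "\<forall>g\<in>gradients K. Q g (a, e, b) = Q g (a', e', b')" and x: "x \<in> Omega P"
  \<comment> \<open>The difference of the two triples is tested against itself; its three
    nonnegative squares sum to 0.\<close>
  let ?d = "add_scaled (a, e, b) (- 1) (a', e', b')"
  have d: "?d \<in> gradients K" using assms by (intro add_scaled_gradients) auto
  then have "Q ?d ?d = 0" using Q assms by (subst Q_linear_right) auto
  moreover obtain da de db where D: "?d = (da, de, db)" "da \<in> A" "de \<in> E_fields K" "db \<in> B_fields K"
    using d by (rule gradients_cases)
  ultimately have "ip da da + sip de de + sip db db = 0"
    by (simp only: D(1) Q_def prod.case)
  then have "ip da da = 0" "sip de de = 0" "sip db db = 0"
    using ip_nonneg[of da] sip_nonneg[of de] sip_nonneg[of db] by linarith+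
  then have "da x v = 0" "de x = 0" "db x = 0" for v
    using ip_definite[OF D(2) _ x] sip_definite[OF is_field_class(1) D(3) _ x]
      sip_definite[OF is_field_class(2) D(4) _ x] by blast+
  moreover have "da x v = a x v - a' x v" "de x = e x - e' x" "db x = b x - b' x" for v
    using D(1) by auto
  ultimately show "(\<forall>v. a x v = a' x v) \<and> e x = e' x \<and> b x = b' x" by simp
next
  fix g assume "\<forall>x\<in>Omega P. (\<forall>v. a x v = a' x v) \<and> e x = e' x \<and> b x = b' x"
  then show "Q g (a, e, b) = Q g (a', e', b')" by (intro Q_cong) auto
qed

text \<open>Test triples with two zero components isolate the three equations.\<close>

lemma Q_componentwise:
  "(\<forall>g\<in>gradients K. Q g (a, e, b) = Q g (a', e', b'))
    \<longleftrightarrow> (\<forall>g\<in>A. ip g a = ip g a') \<and> (\<forall>g\<in>E_fields K. sip g e = sip g e') \<and> (\<forall>g\<in>B_fields K. sip g b = sip g b')"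
proof (intro iffI conjI ballI)
  assume Q: "\<forall>g\<in>gradients K. Q g (a, e, b) = Q g (a', e', b')"
  have zero: "ip (\<lambda>x v. 0) h = 0" "sip (\<lambda>x. 0) h' = 0" for h h'
    by (simp_all add: ip_zero_right sip_zero_right ip_commute[of "\<lambda>x v. 0"] sip_commute[of "\<lambda>x. 0"])
  show "ip g a = ip g a'" if "g \<in> A" for g
    using Q[rule_format, of "(g, \<lambda>x. 0, \<lambda>x. 0)"] that by (simp add: Q_def zero field_zero)
  show "sip g e = sip g e'" if "g \<in> E_fields K" for g
    using Q[rule_format, of "(\<lambda>x v. 0, g, \<lambda>x. 0)"] that by (simp add: Q_def zero field_zero A_zero)
  show "sip g b = sip g b'" if "g \<in> B_fields K" for g
    using Q[rule_format, of "(\<lambda>x v. 0, \<lambda>x. 0, g)"] that by (simp add: Q_def zero field_zero A_zero)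
qed (auto simp: Q_def elim: gradients_cases)

section \<open>Strong and weak form of the equations of motion\<close>

lemma transport_weighted:
  assumes b: "b \<in> A" and x: "x \<in> Omega P"
  shows "transport P (\<lambda>x v. f0 P x v * b x v) x v = f0 P x v * transport P b x v"
proof -
  have gx: "grad_x (\<lambda>x v. f0 P x v * b x v) x v
      = f0 P x v *\<^sub>R ((\<kappa> * b x v) *\<^sub>R E0 P x + grad_x b x v)"
    by (simp add: vec_eq_iff grad_x_weighted[OF b x])
  have gv: "grad_v (\<lambda>x v. f0 P x v * b x v) x v
      = f0 P x v *\<^sub>R ((- 1 / (vth P)\<^sup>2 * b x v) *\<^sub>R v + grad_v b x v)"
    by (simp add: vec_eq_iff grad_v_weighted[OF b x])
  have "transport P (\<lambda>x v. f0 P x v * b x v) x v = f0 P x v * (transport P b x v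
      + \<kappa> * b x v * (v \<bullet> E0 P x) + 1 / eps P * (- 1 / (vth P)\<^sup>2 * b x v * (v \<bullet> force P x v)))"
    unfolding transport_def gx gv
    by (simp add: inner_add_right inner_commute algebra_simps)
  \<comment> \<open>The two zeroth-order terms cancel, which is the equilibrium condition for
    \<open>f0\<close>.\<close>
  then show ?thesis
    using eps_nonzero vth_pos by (simp add: velocity_dot_force field_simps)
qed

text \<open>\<open>f\<close> agrees with \<open>f0\<close> times its ratio only over the domain;
  openness transfers this to the spatial gradient, and transport commutes with multiplication by
  \<open>f0\<close>.\<close>

lemma transport_ratio:
  assumes \<rho>: "(\<lambda>x v. f x v / f0 P x v) \<in> A" and x: "x \<in> Omega P"
  shows "transport P f x v = f0 P x v * transport P (\<lambda>x v. f x v / f0 P x v) x v"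
proof -
  let ?g = "\<lambda>x v. f0 P x v * (f x v / f0 P x v)"
  have eq: "f y w = ?g y w" if "y \<in> Omega P" for y w
    using f0_nonzero[OF that] by simp
  have "(\<lambda>y. ?g y v) differentiable (at x)"
    by (intro differentiable_mult f0_differentiable_x A_differentiable_x[OF \<rho>] x)
  then have "grad_x f x v = grad_x ?g x v"
    unfolding grad_x_def grad_def partial_def
    using frechet_derivative_cong_open[OF open_Omega x, of "\<lambda>y. f y v" "\<lambda>y. ?g y v"] eq by simp
  moreover have "grad_v f x v = grad_v ?g x v"
    unfolding grad_v_def using eq[OF x] by simp
  ultimately have "transport P f x v = transport P ?g x v"
    by (simp add: transport_def)
  then show ?thesis using transport_weighted[OF \<rho> x] by simp
qed

lemma transport_scale:
  assumes a: "a \<in> A" and x: "x \<in> Omega P"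
  shows "transport P (\<lambda>x v. c * a x v) x v = c * transport P a x v"
proof -
  have "grad_x (\<lambda>x v. c * a x v) x v = c *\<^sub>R grad_x a x v" "grad_v (\<lambda>x v. c * a x v) x v = c *\<^sub>R grad_v a x v"
    using partial_linear[OF differentiable_const A_differentiable_x[OF a x], of _ 0 c]
      partial_linear[OF differentiable_const A_differentiable_v[OF a x], of _ 0 c]
    by (simp_all add: vec_eq_iff grad_x_def grad_v_def grad_def partial_def frechet_derivative_const)
  then show ?thesis by (simp add: transport_def algebra_simps)
qed

lemma flux_ratio:
  assumes x: "x \<in> Omega P"
  shows "flux (\<lambda>x v. c * (f x v / f0 P x v)) x = c *\<^sub>R (LINT v|lborel. f x v *\<^sub>R v)"
proof -
  have "flux (\<lambda>x v. c * (f x v / f0 P x v)) x = (LINT v|lborel. c *\<^sub>R (f x v *\<^sub>R v))"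
    unfolding flux_def using f0_nonzero[OF x] by simp
  also have "\<dots> = c *\<^sub>R (LINT v|lborel. f x v *\<^sub>R v)" by (rule integral_scaleR_right)
  finally show ?thesis .
qed

text \<open>The factor \<open>\<alpha>\<^sup>2 * vth\<^sup>2\<close> from the derivative of
  \<open>H\<close> cancels the constant before transport in \<open>J\<close> and turns
  \<open>\<kappa>\<close> before the current into
  \<open>\<alpha>\<^sup>2 / \<epsilon>\<close>.\<close>

lemma hamiltonian_field_pointwise:
  assumes u: "(f, E, B) \<in> states P K" and X: "hamiltonian_field (f, E, B) = (a, e, b)"
    and x: "x \<in> Omega P"
  shows "f0 P x v * a x v = \<kappa> * (E x \<bullet> v) * f0 P x v - transport P f x v"
    and "e x = curl B x - ((alpha P)\<^sup>2 / eps P) *\<^sub>R (LINT v|lborel. f x v *\<^sub>R v)"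
    and "b x = - curl E x"
proof -
  let ?k = "(alpha P)\<^sup>2 * (vth P)\<^sup>2" and ?\<rho> = "\<lambda>x v. f x v / f0 P x v"
  have \<rho>: "?\<rho> \<in> A" using u by (simp add: states_def)
  have comp: "a = (\<lambda>x v. \<kappa> * (E x \<bullet> v) + - 1 / ((alpha P)\<^sup>2 * (vth P)\<^sup>2) * transport P (\<lambda>x v. ?k * ?\<rho> x v) x v)"
    "e = (\<lambda>x. curl B x + (- \<kappa>) *\<^sub>R flux (\<lambda>x v. ?k * ?\<rho> x v) x)" "b = (\<lambda>x. (- 1) *\<^sub>R curl E x)"
    using X unfolding hamiltonian_field_def ratio_simp hamiltonian_gradient_def prod.case J_simp by blast+
  have k: "?k \<noteq> 0" using alpha_nonzero vth_pos by simp
  have "- 1 / ((alpha P)\<^sup>2 * (vth P)\<^sup>2) * (?k * T) = - T" for T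
    using k by simp
  then have av: "a x v = \<kappa> * (E x \<bullet> v) - transport P ?\<rho> x v"
    unfolding comp(1) transport_scale[OF \<rho> x] by simp
  show "f0 P x v * a x v = \<kappa> * (E x \<bullet> v) * f0 P x v - transport P f x v"
    unfolding transport_ratio[OF \<rho> x] av by (simp add: algebra_simps)
  have "\<kappa> * ?k = (alpha P)\<^sup>2 / eps P" using vth_pos by simp
  then show "e x = curl B x - ((alpha P)\<^sup>2 / eps P) *\<^sub>R (LINT v|lborel. f x v *\<^sub>R v)"
    unfolding comp(2) flux_ratio[OF x] by simp
  show "b x = - curl E x" by (simp add: comp(3))
qed

text \<open>Definiteness replaces the identity tested against all triples by pointwise equality; the
  phase component is then multiplied by the nonzero \<open>f0\<close>.\<close>

lemma linearized_VM_iff: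
  assumes curve: "\<And>t. t \<in> I \<Longrightarrow>
      state_curve P K (\<lambda>s. (f (t + s), E (t + s), B (t + s))) (f t, E t, B t) (w t)"
  shows "linearized_VM P I f E B \<longleftrightarrow> (\<forall>t\<in>I. \<forall>g\<in>gradients K.
    Q g (ratio P (w t)) = Q g (hamiltonian_field (f t, E t, B t)))"
  unfolding linearized_VM_def
proof (rule ball_cong[OF refl])
  fix t assume t: "t \<in> I"
  obtain wa wE wB where w: "w t = (wa, wE, wB)" by (cases "w t")
  obtain a e b where X: "hamiltonian_field (f t, E t, B t) = (a, e, b)"
    by (cases "hamiltonian_field (f t, E t, B t)")
  note c = curve[OF t, unfolded w]
  note st = state_curve_states[OF c]
  have mem: "a \<in> A" "e \<in> E_fields K" "b \<in> B_fields K"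
    using hamiltonian_field_gradients[OF st(1)] by (simp_all add: X)
  have memw: "(\<lambda>x v. wa x v / f0 P x v) \<in> A" "wE \<in> E_fields K" "wB \<in> B_fields K"
    using st(2) by (simp_all add: states_def)
  have "((\<forall>v. deriv (\<lambda>t. f t x v) t + v \<bullet> grad_x (f t) x v + 1 / eps P * (force P x v \<bullet> grad_v (f t) x v)
          = 1 / ((vth P)\<^sup>2 * eps P) * (E t x \<bullet> v) * f0 P x v) \<and>
        vector_derivative (\<lambda>t. E t x) (at t)
          = curl (B t) x - ((alpha P)\<^sup>2 / eps P) *\<^sub>R (LINT v|lborel. f t x v *\<^sub>R v) \<and>
        vector_derivative (\<lambda>t. B t x) (at t) = - curl (E t) x)
     \<longleftrightarrow> (\<forall>v. wa x v / f0 P x v = a x v) \<and> wE x = e x \<and> wB x = b x" if x: "x \<in> Omega P" for x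
  proof -
    note field = hamiltonian_field_pointwise[OF st(1) X x]
    have "wa x v + v \<bullet> grad_x (f t) x v + 1 / eps P * (force P x v \<bullet> grad_v (f t) x v)
          = 1 / ((vth P)\<^sup>2 * eps P) * (E t x \<bullet> v) * f0 P x v \<longleftrightarrow> wa x v / f0 P x v = a x v" for v
    proof -
      have "wa x v + v \<bullet> grad_x (f t) x v + 1 / eps P * (force P x v \<bullet> grad_v (f t) x v)
          = wa x v + transport P (f t) x v" by (simp add: transport_def)
      moreover have "wa x v / f0 P x v = a x v \<longleftrightarrow> wa x v = f0 P x v * a x v"
        using f0_nonzero[OF x, of v] by (simp add: divide_eq_eq mult.commute)
      ultimately show ?thesis unfolding field(1) by (simp add: algebra_simps eq_diff_eq)
    qed
    then show ?thesis unfolding curve_velocity[OF c x] field(2,3)[symmetric] by simp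
  qed
  then show "(\<forall>x\<in>Omega P.
     (\<forall>v. deriv (\<lambda>t. f t x v) t + v \<bullet> grad_x (f t) x v + 1 / eps P * (force P x v \<bullet> grad_v (f t) x v)
          = 1 / ((vth P)\<^sup>2 * eps P) * (E t x \<bullet> v) * f0 P x v) \<and>
     vector_derivative (\<lambda>t. E t x) (at t)
       = curl (B t) x - ((alpha P)\<^sup>2 / eps P) *\<^sub>R (LINT v|lborel. f t x v *\<^sub>R v) \<and>
     vector_derivative (\<lambda>t. B t x) (at t) = - curl (E t) x)
    \<longleftrightarrow> (\<forall>g\<in>gradients K. Q g (ratio P (w t)) = Q g (hamiltonian_field (f t, E t, B t)))"
    unfolding w X ratio_simp Q_separates[OF memw mem] by simp
qed

text \<open>Skewness moves transport from the ratio of the state to the test function, and the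
  weight \<open>f0\<close> restores \<open>f\<close> from its ratio.\<close>

lemma weak_phase_identity:
  assumes u: "(f, E, B) \<in> states P K" and X: "hamiltonian_field (f, E, B) = (a, e, b)"
    and g: "g \<in> A"
  shows "ip g a = phase_int P (\<lambda>x v. f x v * transport P g x v)
    + \<kappa> * phase_int P (\<lambda>x v. g x v * (E x \<bullet> v) * f0 P x v)"
proof -
  let ?k = "(alpha P)\<^sup>2 * (vth P)\<^sup>2" and ?\<rho> = "\<lambda>x v. f x v / f0 P x v"
  have \<rho>: "?\<rho> \<in> A" and E: "E \<in> E_fields K" using u by (simp_all add: states_def)
  have comp: "a = (\<lambda>x v. \<kappa> * (E x \<bullet> v) + - 1 / ((alpha P)\<^sup>2 * (vth P)\<^sup>2) * transport P (\<lambda>x v. ?k * ?\<rho> x v) x v)"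
    using X unfolding hamiltonian_field_def ratio_simp hamiltonian_gradient_def prod.case J_simp by blast
  have "ip g a = ip g (\<lambda>x v. \<kappa> * (E x \<bullet> v)) + - 1 / ?k * ip g (transport P (\<lambda>x v. ?k * ?\<rho> x v))"
    unfolding comp by (intro ip_linear_right g A_scale A_field_velocity A_transport E \<rho>)
  also have "ip g (\<lambda>x v. \<kappa> * (E x \<bullet> v)) = \<kappa> * ip g (\<lambda>x v. E x \<bullet> v)"
    by (intro ip_scale_right g A_field_velocity E)
  also have "ip g (transport P (\<lambda>x v. ?k * ?\<rho> x v)) = - (?k * ip (transport P g) ?\<rho>)"
    unfolding ip_transport[OF g A_scale[OF \<rho>]]
    by (simp only: ip_scale_right[OF A_transport[OF g] \<rho>])
  also have "- 1 / ?k * - (?k * ip (transport P g) ?\<rho>) = ip (transport P g) ?\<rho>"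
    using alpha_nonzero vth_pos by simp
  also have "ip (transport P g) ?\<rho> = phase_int P (\<lambda>x v. f x v * transport P g x v)"
    unfolding ip_def by (rule phase_int_cong) (simp add: f0_nonzero)
  also have "ip g (\<lambda>x v. E x \<bullet> v) = phase_int P (\<lambda>x v. g x v * (E x \<bullet> v) * f0 P x v)"
    unfolding ip_def by (rule phase_int_cong) simp
  finally show ?thesis by simp
qed

text \<open>The components of the tested identity are compared one at a time with the three weak
  equations, curl being moved onto the test field by \<open>sip_curl\<close>.\<close>

lemma weak_linearized_VM_iff:
  assumes curve: "\<And>t. t \<in> I \<Longrightarrow>
      state_curve P K (\<lambda>s. (f (t + s), E (t + s), B (t + s))) (f t, E t, B t) (w t)"
  shows "weak_linearized_VM P K I f E B \<longleftrightarrow> (\<forall>t\<in>I. \<forall>g\<in>gradients K.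
    Q g (ratio P (w t)) = Q g (hamiltonian_field (f t, E t, B t)))"
  unfolding weak_linearized_VM_def
proof (rule ball_cong[OF refl])
  fix t assume t: "t \<in> I"
  obtain wa wE wB where w: "w t = (wa, wE, wB)" by (cases "w t")
  obtain a e b where X: "hamiltonian_field (f t, E t, B t) = (a, e, b)"
    by (cases "hamiltonian_field (f t, E t, B t)")
  note c = curve[OF t, unfolded w]
  note st = state_curve_states[OF c]
  have EB: "(\<lambda>x v. f t x v / f0 P x v) \<in> A" "E t \<in> E_fields K" "B t \<in> B_fields K"
    using st(1) by (simp_all add: states_def)
  have 1: "phase_int P (\<lambda>x v. g x v * deriv (\<lambda>t. f t x v) t)
          - phase_int P (\<lambda>x v. f t x v * (v \<bullet> grad_x g x v + 1 / eps P * (force P x v \<bullet> grad_v g x v)))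
        = 1 / ((vth P)\<^sup>2 * eps P) * phase_int P (\<lambda>x v. g x v * (E t x \<bullet> v) * f0 P x v)
      \<longleftrightarrow> ip g (\<lambda>x v. wa x v / f0 P x v) = ip g a" if g: "g \<in> A" for g
  proof -
    have "phase_int P (\<lambda>x v. g x v * deriv (\<lambda>t. f t x v) t) = ip g (\<lambda>x v. wa x v / f0 P x v)"
      unfolding ip_def by (rule phase_int_cong) (simp add: f0_nonzero curve_velocity(1)[OF c])
    then show ?thesis
      unfolding weak_phase_identity[OF st(1) X g] transport_def[symmetric] by (simp add: diff_eq_eq add.commute)
  qed
  have 2: "space_int P (\<lambda>x. g x \<bullet> vector_derivative (\<lambda>t. E t x) (at t))
        = space_int P (\<lambda>x. curl g x \<bullet> B t x)
          - (alpha P)\<^sup>2 / eps P * space_int P (\<lambda>x. g x \<bullet> (LINT v|lborel. f t x v *\<^sub>R v))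
      \<longleftrightarrow> sip g wE = sip g e" if g: "g \<in> E_fields K" for g
  proof -
    let ?j = "flux (\<lambda>x v. f t x v / f0 P x v)"
    have j: "?j x = (LINT v|lborel. f t x v *\<^sub>R v)" if "x \<in> Omega P" for x
      using flux_ratio[OF that, of 1 "f t"] by simp
    have "sip g e = sip g (\<lambda>x. curl (B t) x + (- ((alpha P)\<^sup>2 / eps P)) *\<^sub>R ?j x)"
      using hamiltonian_field_pointwise(2)[OF st(1) X] by (intro sip_cong) (simp_all add: j)
    also have "\<dots> = sip g (curl (B t)) + - ((alpha P)\<^sup>2 / eps P) * sip g ?j"
      by (intro sip_linear_right[OF is_field_class(1)] g curl_B flux_field EB)
    also have "sip g ?j = space_int P (\<lambda>x. g x \<bullet> (LINT v|lborel. f t x v *\<^sub>R v))"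
      unfolding sip_def by (rule space_int_cong) (simp add: j)
    also have "sip g (curl (B t)) = space_int P (\<lambda>x. curl g x \<bullet> B t x)"
      unfolding sip_curl[OF g EB(3), symmetric] by (simp add: sip_def)
    finally have "sip g e = space_int P (\<lambda>x. curl g x \<bullet> B t x)
          - (alpha P)\<^sup>2 / eps P * space_int P (\<lambda>x. g x \<bullet> (LINT v|lborel. f t x v *\<^sub>R v))" by simp
    moreover have "space_int P (\<lambda>x. g x \<bullet> vector_derivative (\<lambda>t. E t x) (at t)) = sip g wE"
      unfolding sip_def by (rule space_int_cong) (simp add: curve_velocity(2)[OF c])
    ultimately show ?thesis by simp
  qed
  have 3: "space_int P (\<lambda>x. g x \<bullet> vector_derivative (\<lambda>t. B t x) (at t))
        = - space_int P (\<lambda>x. curl g x \<bullet> E t x)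
      \<longleftrightarrow> sip g wB = sip g b" if g: "g \<in> B_fields K" for g
  proof -
    have "sip g b = sip g (\<lambda>x. (- 1) *\<^sub>R curl (E t) x)"
      using hamiltonian_field_pointwise(3)[OF st(1) X] by (intro sip_cong) simp_all
    also have "\<dots> = - sip (curl (E t)) g"
      unfolding sip_scale_right[OF is_field_class(2) g curl_E[OF EB(2)]] by (simp add: sip_commute)
    also have "sip (curl (E t)) g = space_int P (\<lambda>x. curl g x \<bullet> E t x)"
      unfolding sip_curl[OF EB(2) g] by (simp add: sip_def inner_commute)
    finally have "sip g b = - space_int P (\<lambda>x. curl g x \<bullet> E t x)" .
    moreover have "space_int P (\<lambda>x. g x \<bullet> vector_derivative (\<lambda>t. B t x) (at t)) = sip g wB"
      unfolding sip_def by (rule space_int_cong) (simp add: curve_velocity(3)[OF c])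
    ultimately show ?thesis by simp
  qed
  show "((\<forall>a\<in>A. phase_int P (\<lambda>x v. a x v * deriv (\<lambda>t. f t x v) t)
          - phase_int P (\<lambda>x v. f t x v * (v \<bullet> grad_x a x v + 1 / eps P * (force P x v \<bullet> grad_v a x v)))
        = 1 / ((vth P)\<^sup>2 * eps P) * phase_int P (\<lambda>x v. a x v * (E t x \<bullet> v) * f0 P x v)) \<and>
     (\<forall>e\<in>E_fields K. space_int P (\<lambda>x. e x \<bullet> vector_derivative (\<lambda>t. E t x) (at t))
        = space_int P (\<lambda>x. curl e x \<bullet> B t x)
          - (alpha P)\<^sup>2 / eps P * space_int P (\<lambda>x. e x \<bullet> (LINT v|lborel. f t x v *\<^sub>R v))) \<and>
     (\<forall>b\<in>B_fields K. space_int P (\<lambda>x. b x \<bullet> vector_derivative (\<lambda>t. B t x) (at t))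
        = - space_int P (\<lambda>x. curl b x \<bullet> E t x)))
    \<longleftrightarrow> (\<forall>g\<in>gradients K. Q g (ratio P (w t)) = Q g (hamiltonian_field (f t, E t, B t)))"
    unfolding w X ratio_simp Q_componentwise
    by (intro arg_cong2[where f = "(\<and>)"] ball_cong refl 1 2 3)
qed

end

theorem proposition2:
  fixes P :: background and K :: function_classes
  assumes "open (Omega P)"
    and "smooth_on (Omega P) (n0 P)" and "\<forall>x\<in>Omega P. n0 P x > 0"
    and "vth P > 0" and "eps P \<noteq> 0" and "alpha P \<noteq> 0"
    and "formal_setting P K"
  shows "poisson_bracket P K (bracket P K)
    \<and> hamiltonian P \<in> smooth_functionals P K
    \<and> (\<forall>I f1 E1 B1. trajectory P K I (\<lambda>t. (f1 t, E1 t, B1 t)) \<longrightarrow>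
          (hamiltonian_motion P K (bracket P K) (hamiltonian P) I (\<lambda>t. (f1 t, E1 t, B1 t))
             \<longleftrightarrow> weak_linearized_VM P K I f1 E1 B1)
        \<and> (weak_linearized_VM P K I f1 E1 B1 \<longleftrightarrow> linearized_VM P I f1 E1 B1))
    \<and> (\<forall>\<phi>\<in>test_fns K. casimir P K (bracket P K) (gauss_E P \<phi>))
    \<and> (\<forall>\<psi>\<in>test_fns K. casimir P K (bracket P K) (gauss_B P \<psi>))"
proof -
  interpret vlasov_maxwell P K
    using assms by unfold_locales auto
  have motion: "(\<forall>t\<in>I. \<exists>w. state_curve P K (\<lambda>s. (f1 (t + s), E1 (t + s), B1 (t + s))) (f1 t, E1 t, B1 t) w)
      \<Longrightarrow> (hamiltonian_motion P K (bracket P K) (hamiltonian P) I (\<lambda>t. (f1 t, E1 t, B1 t))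
             \<longleftrightarrow> weak_linearized_VM P K I f1 E1 B1)
        \<and> (weak_linearized_VM P K I f1 E1 B1 \<longleftrightarrow> linearized_VM P I f1 E1 B1)" for I f1 E1 B1
  proof -
    assume "\<forall>t\<in>I. \<exists>w. state_curve P K (\<lambda>s. (f1 (t + s), E1 (t + s), B1 (t + s))) (f1 t, E1 t, B1 t) w"
    \<comment> \<open>A trajectory supplies some velocity at each time; a choice of these lets
      Hamiltonian motion, weak form and strong form all reduce to the same identity in
      \<open>Q\<close>.\<close>
    then obtain w where w: "\<And>t. t \<in> I \<Longrightarrow>
        state_curve P K (\<lambda>s. (f1 (t + s), E1 (t + s), B1 (t + s))) (f1 t, E1 t, B1 t) (w t)"
      unfolding bchoice_iff by blast
    have "hamiltonian_motion P K (bracket P K) (hamiltonian P) I (\<lambda>t. (f1 t, E1 t, B1 t))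
        \<longleftrightarrow> (\<forall>t\<in>I. \<forall>g\<in>gradients K. Q g (ratio P (w t)) = Q g (hamiltonian_field (f1 t, E1 t, B1 t)))"
      by (rule hamiltonian_motion_iff) (rule w)
    moreover have "weak_linearized_VM P K I f1 E1 B1
        \<longleftrightarrow> (\<forall>t\<in>I. \<forall>g\<in>gradients K. Q g (ratio P (w t)) = Q g (hamiltonian_field (f1 t, E1 t, B1 t)))"
      by (rule weak_linearized_VM_iff) (rule w)
    moreover have "linearized_VM P I f1 E1 B1
        \<longleftrightarrow> (\<forall>t\<in>I. \<forall>g\<in>gradients K. Q g (ratio P (w t)) = Q g (hamiltonian_field (f1 t, E1 t, B1 t)))"
      by (rule linearized_VM_iff) (rule w)
    ultimately show ?thesis by (simp only: simp_thms)
  qed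
  show ?thesis
    unfolding trajectory_def
    by (intro conjI[OF poisson] conjI[OF hamiltonian_smooth] conjI allI impI ballI casimir_gauss_E
        casimir_gauss_B) (use motion in blast)+
qed

end
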